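(* For each $\epsilon>0$ there is a constant $C_\epsilon$ such that for every $R>1$ the following holds. If $X$ is a disjoint union of unit balls contained in a ball $B_R\subset\mathbb R^3$ of radius $R$ and \[ |X\cap B(x,r)|\lesssim r,\qquad x\in\mathbb R^3,\ r>1, \] then for all $f\in L^2(\mathbb Cone^2)$, \[ \int_X |E_{\mathbb Cone^2}f|^2\,dx\le C_\epsilon R^{1/4+\epsilon}\,\mathbf T_{\mathbb Cone^2}(X)\,\|f\|_{L^2(\mathbb Cone^2)}^2 . \]
   Context: $\mathbb Cone^2=\{(\bar\xi,\xi_3)\in\mathbb R^2\times\mathbb R: 1<|\bar\xi|<2,\ \xi_3=|\bar\xi|\}$, with surface measure $d\sigma$; $L^2(\mathbb Cone^2)=L^2(\mathbb Cone^2,d\sigma)$. The Fourier extension operator is $E_{\mathbb Cone^2}f(x)=\int_{\mathbb Cone^2}f(\xi)e^{2\pi i x\cdot\xi}\,d\sigma(\xi)$, $x\in\mathbb R^3$. $|\cdot|$ is Lebesgue measure. $A\lesssim B$ means $A\le KB$ for a fixed absolute constant $K$ (the constant $C_\epsilon$ may depend on the constant $K$ implicit in the hypothesis on $X$). $\mathbf T_{\mathbb Cone^2}(X)=\sup\{|X\cap T|\}$, where the supremum is over all $1\times1\times R$-tubes $T\subset\mathbb R^3$ (arbitrary position) whose long central axis is parallel to a vector that is orthogonal to the tangent space $T_\xi\mathbb Cone^2$ for some $\xi\in\mathbb Cone^2$. *)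

theory Defs
  imports "HOL-Analysis.Analysis"
begin

definition gradient :: "('a::euclidean_space \<Rightarrow> real) \<Rightarrow> 'a \<Rightarrow> 'a" where
  "gradient \<phi> y = (THE D. GDERIV \<phi> y :> D)"

text \<open>The surface measure of the graph of \<open>\<phi>\<close> over \<open>U\<close>: the measure
  \<open>sqrt (1 + |\<nabla>\<phi> y|^2) dy\<close> on \<open>U\<close>, carried over to the graph.\<close>

definition graph_surface_measure ::
    "('a::euclidean_space \<Rightarrow> real) \<Rightarrow> 'a set \<Rightarrow> ('a \<times> real) measure" where
  "graph_surface_measure \<phi> U =
     distr (density (restrict_space lborel U) (\<lambda>y. ennreal (sqrt (1 + (norm (gradient \<phi> y))\<^sup>2))))
           (restrict_space borel ((\<lambda>y. (y, \<phi> y)) ` U))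
           (\<lambda>y. (y, \<phi> y))"

definition tangent_space :: "'a::real_normed_vector set \<Rightarrow> 'a \<Rightarrow> 'a set" where
  "tangent_space S \<xi> =
     {v. \<exists>\<gamma>::real \<Rightarrow> 'a. \<gamma> 0 = \<xi> \<and> (\<forall>\<^sub>F t in nhds 0. \<gamma> t \<in> S) \<and> (\<gamma> has_vector_derivative v) (at 0)}"

definition cone2 :: "((real ^ 2) \<times> real) set" where
  "cone2 = {(\<eta>, s). 1 < norm \<eta> \<and> norm \<eta> < 2 \<and> s = norm \<eta>}"

definition cone2_measure :: "((real ^ 2) \<times> real) measure" where
  "cone2_measure = graph_surface_measure norm {\<eta>. 1 < norm \<eta> \<and> norm \<eta> < 2}"

definition L2 :: "'a measure \<Rightarrow> ('a \<Rightarrow> complex) set" where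
  "L2 M = {f \<in> borel_measurable M. integrable M (\<lambda>x. (cmod (f x))\<^sup>2)}"

definition L2_norm :: "'a measure \<Rightarrow> ('a \<Rightarrow> complex) \<Rightarrow> real" where
  "L2_norm M f = sqrt (\<integral>x. (cmod (f x))\<^sup>2 \<partial>M)"

definition cone2_extension :: "((real ^ 2) \<times> real \<Rightarrow> complex) \<Rightarrow> (real ^ 2) \<times> real \<Rightarrow> complex" where
  "cone2_extension f x = (\<integral>\<xi>. f \<xi> * exp (2 * of_real pi * \<i> * of_real (x \<bullet> \<xi>)) \<partial>cone2_measure)"

text \<open>The closed \<open>1 \<times> 1 \<times> R\<close> box with centre \<open>c\<close> and edges parallel to \<open>u\<close>, \<open>v\<close>, \<open>w\<close>
  (an orthonormal frame wherever this is used); its central axis has direction \<open>w\<close>.\<close>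

definition tube :: "real \<Rightarrow> 'a::real_vector \<Rightarrow> 'a \<Rightarrow> 'a \<Rightarrow> 'a \<Rightarrow> 'a set" where
  "tube R c u v w = {c + a *\<^sub>R u + b *\<^sub>R v + t *\<^sub>R w | a b t. \<bar>a\<bar> \<le> 1/2 \<and> \<bar>b\<bar> \<le> 1/2 \<and> \<bar>t\<bar> \<le> R/2}"

definition cone2_tubes :: "real \<Rightarrow> ((real ^ 2) \<times> real) set set" where
  "cone2_tubes R =
     {tube R c u v w | c u v w.
        norm u = 1 \<and> norm v = 1 \<and> norm w = 1 \<and> u \<bullet> v = 0 \<and> u \<bullet> w = 0 \<and> v \<bullet> w = 0 \<and>
        (\<exists>\<xi>\<in>cone2. \<forall>\<tau>\<in>tangent_space cone2 \<xi>. w \<bullet> \<tau> = 0)}"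

definition cone2_T :: "real \<Rightarrow> ((real ^ 2) \<times> real) set \<Rightarrow> ennreal" where
  "cone2_T R X = (SUP T\<in>cone2_tubes R. emeasure lborel (X \<inter> T))"

definition disjoint_union_of_unit_balls :: "'a::metric_space set \<Rightarrow> bool" where
  "disjoint_union_of_unit_balls X \<longleftrightarrow>
     (\<exists>P. X = (\<Union>p\<in>P. ball p 1) \<and> disjoint_family_on (\<lambda>p. ball p 1) P)"

end

theory Submission
  imports Defs
begin

text \<open>Let \<open>T\<close> be the largest mass of \<open>X\<close> in a light tube. By duality the estimate reduces to the \<open>L^2(X)\<close> norm of
  convolution with the Fourier transform \<open>k\<close> of a measure dominating the surface measure. For the density
  \<open>exp (-2 pi |\<eta>|) d\<eta>\<close> the kernel is explicit, of modulus \<open>|s| / (2 pi |s^2 + |z'|^2|^(3/2))\<close> with \<open>s = 1 - i z_3\<close>.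
  Dyadically, \<open>k\<close> has size \<open>r^(-1/2) l^(-3/2)\<close> where \<open>|z| ~ r\<close> and \<open>z\<close> is within \<open>l\<close> of the light cone, so it is
  enough to bound the operator with kernel \<open>1[x ~ y]\<close> (this light-like relation at scale \<open>r\<close>, \<open>l\<close>) by \<open>O(l r f T)\<close>,
  where \<open>f = (l/r)^(1/4)\<close>.

  This is a Kovari-Sos-Turan argument with triples. For a function \<open>u\<close>, let \<open>g(y)\<close> be the integral of \<open>u\<close> over those
  \<open>x ~ y\<close> with \<open>u(x) \<le> u(y)\<close>. The \<open>x ~ y\<close> whose direction from \<open>y\<close> lies in a sector of angle \<open>f\<close> are covered by few
  light tubes and have mass \<open>O(l r f T)\<close>. Hence either \<open>g(y) = O(l r f T u(y))\<close>, or a fixed fraction of the triples of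
  neighbours of \<open>y\<close> has pairwise \<open>f\<close>-separated directions. In the second case one counts the common neighbours of such a
  triple: they lie in at most two boxes with sides \<open>l\<close>, \<open>l/f\<close>, \<open>l/f^2\<close>, the longest one light-like, hence have mass
  \<open>O(l^2 T / f)\<close>. Balancing the two cases leads to this choice of \<open>f\<close>, the source of the exponent \<open>1/4\<close>.\<close>

section \<open>The Minkowski form and light directions\<close>

text \<open>Two light cones meet in a curve that no tube controls, while three meet in isolated
  points; hence triples. Seen from a common point y, the cone of x reads H(z) = Q(z) / (2 \<tau>),
  with H linear, Q the Minkowski square and \<tau> the time difference. Three such equations give z
  = Q(z) w for a fixed vector w, so z = 0 or Q(z) = 1/Q(w): this is the origin of the two boxes. The
  thickened equations lose f^-2 when they are inverted, and f^4 r = l is the scale at which this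
  loss is still absorbed. The same scale balances the count. With A = l f r T for the sector bound,
  and mass O(r) in balls of radius r, the separated triples contribute A / (l T^2 f^4 r). This is
  O(A) because a nonempty X contains a unit ball, which bounds T from below. Against the kernel, a
  pair (r, l) then costs r^(-1/2) l^(-3/2) A = (r/l)^(1/4) T, largest at l = 1 and r about R. The
  O(log^2 R) dyadic pairs are paid for by R^\<epsilon>.\<close>

type_synonym spacetime = "(real ^ 2) \<times> real"

definition mink :: "spacetime \<Rightarrow> spacetime \<Rightarrow> real" where
  "mink u v = fst u \<bullet> fst v - snd u * snd v"

definition circ :: "real \<Rightarrow> real ^ 2" where
  "circ \<theta> = vector [cos \<theta>, sin \<theta>]"

lemma inner_vec2: "(x :: real ^ 2) \<bullet> y = x $ 1 * y $ 1 + x $ 2 * y $ 2"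
  by (simp add: inner_vec_def sum_2)

lemma circ_nth [simp]: "circ \<theta> $ 1 = cos \<theta>" "circ \<theta> $ 2 = sin \<theta>"
  by (simp_all add: circ_def)

lemma circ_inner: "circ a \<bullet> circ b = cos (a - b)"
  by (simp add: inner_vec2 cos_diff)

lemma norm_circ [simp]: "norm (circ a) = 1"
  by (simp add: norm_eq_sqrt_inner circ_inner)

lemma unit_vector_circ:
  assumes "norm (e :: real ^ 2) = 1"
  obtains \<theta> where "e = circ \<theta>"
proof -
  have "(e $ 1)\<^sup>2 + (e $ 2)\<^sup>2 = 1"
    using assms by (simp add: norm_eq_sqrt_inner inner_vec2 power2_eq_square)
  then obtain \<theta> where "e $ 1 = cos \<theta>" "e $ 2 = sin \<theta>"
    using sincos_total_2pi by metis
  then have "e = circ \<theta>" by (simp add: vec_eq_iff forall_2)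
  then show ?thesis by (rule that)
qed

lemma half_angle:
  fixes x :: real
  shows "cos x = 1 - 2 * (sin (x / 2))\<^sup>2" "sin x = 2 * sin (x / 2) * cos (x / 2)"
  using cos_double_sin[of "x / 2"] sin_double[of "x / 2"] by (simp_all del: sin_double)

lemma norm_circ_diff: "norm (circ a - circ b) = 2 * \<bar>sin ((a - b) / 2)\<bar>"
proof -
  have "(norm (circ a - circ b))\<^sup>2 = 2 - 2 * cos (a - b)"
    by (simp add: power2_norm_eq_inner inner_diff circ_inner cos_diff algebra_simps)
  also have "cos (a - b) = 1 - 2 * (sin ((a - b) / 2))\<^sup>2"
    by (rule half_angle)
  finally have "(norm (circ a - circ b))\<^sup>2 = (2 * \<bar>sin ((a - b) / 2)\<bar>)\<^sup>2"
    by (simp add: power_mult_distrib)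
  then show ?thesis by (rule power2_eq_imp_eq) auto
qed

lemma mink_commute: "mink u v = mink v u"
  by (simp add: mink_def inner_commute mult.commute)

lemma mink_bilinear:
  "mink (u + v) w = mink u w + mink v w" "mink u (v + w) = mink u v + mink u w"
  "mink (u - v) w = mink u w - mink v w" "mink u (v - w) = mink u v - mink u w"
  "mink (c *\<^sub>R u) w = c * mink u w" "mink u (c *\<^sub>R w) = c * mink u w"
  "mink (- u) w = - mink u w" "mink u (- w) = - mink u w"
  by (simp_all add: mink_def inner_add inner_diff algebra_simps)

lemma norm_prod_sq: "(norm (v :: spacetime))\<^sup>2 = (norm (fst v))\<^sup>2 + (snd v)\<^sup>2"
  by (simp add: norm_prod_def)

lemma mink_self_le: "\<bar>mink v v\<bar> \<le> (norm v)\<^sup>2"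
proof -
  have "mink v v = (norm (fst v))\<^sup>2 - (snd v)\<^sup>2"
    by (simp add: mink_def power2_norm_eq_inner) (simp add: power2_eq_square)
  then show ?thesis unfolding norm_prod_sq by (smt (verit) zero_le_power2)
qed

text \<open>The part \<open>k^2 - snd^2\<close> of the form factors as
  \<open>h * (2 * k - h)\<close>, and this is the polarisation. A large \<open>k\<close> enters only
  multiplied by the light coordinate \<open>h\<close>, never as \<open>k z * k z'\<close>.\<close>

lemma mink_light_coords:
  fixes z z' :: "spacetime" and \<theta> :: real
  defines "k \<equiv> \<lambda>z. fst z \<bullet> circ \<theta>" and "g \<equiv> \<lambda>z. fst z \<bullet> circ (\<theta> + pi / 2)"
  defines "h \<equiv> \<lambda>z. k z - snd z"
  shows "mink z z' = g z * g z' + k z * h z' + k z' * h z - h z * h z'"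
proof -
  have cs: "cos \<theta> * cos \<theta> = 1 - sin \<theta> * sin \<theta>"
    using sin_cos_squared_add3[of \<theta>] by linarith
  have "g z * g z' + k z * k z' = fst z \<bullet> fst z'"
    unfolding g_def k_def inner_vec2
    using cs by (simp add: sin_add cos_add) algebra
  then show ?thesis by (simp add: mink_def h_def algebra_simps)
qed

text \<open>The hypotheses pair \<open>z\<close> with three null covectors, independent but nearly
  parallel when \<open>f\<close> is small. Inverting them is anisotropic: one factor 1/f is lost
  across the ray \<open>a\<close> and two along it. Dividing the differences of the constraints by
  sines of half angles leaves the system \<open>F b\<close>, \<open>F c\<close> in \<open>k\<close>
  and \<open>g\<close>, with determinant \<open>D\<close>.\<close>

lemma three_light_constraints:
  fixes z :: "spacetime"
  assumes m: "\<bar>fst z \<bullet> circ a - snd z\<bar> \<le> m" "\<bar>fst z \<bullet> circ b - snd z\<bar> \<le> m"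
      "\<bar>fst z \<bullet> circ c - snd z\<bar> \<le> m"
    and f: "f > 0" "f \<le> \<bar>sin ((b - a) / 2)\<bar>" "f \<le> \<bar>sin ((c - a) / 2)\<bar>" "f \<le> \<bar>sin ((b - c) / 2)\<bar>"
  shows "\<bar>fst z \<bullet> circ a\<bar> \<le> 2 * m / f\<^sup>2" "\<bar>fst z \<bullet> circ (a + pi / 2)\<bar> \<le> 4 * m / f"
proof -
  define k where "k = fst z \<bullet> circ a"
  define g where "g = fst z \<bullet> circ (a + pi / 2)"
  define S where "S x = sin ((x - a) / 2)" for x
  define C where "C x = cos ((x - a) / 2)" for x
  define F where "F x = g * C x - k * S x" for x
  have m0: "m \<ge> 0" using m(1) by linarith
  have exp: "fst z \<bullet> circ x = k + 2 * S x * F x" for x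
  proof -
    have 1: "cos (x - a) = 1 - 2 * (S x)\<^sup>2" "sin (x - a) = 2 * S x * C x"
      unfolding S_def C_def by (rule half_angle)+
    have "fst z \<bullet> circ x = k * cos (x - a) + g * sin (x - a)"
    proof -
      have x: "cos x = cos (x - a) * cos a - sin (x - a) * sin a" 
              "sin x = sin (x - a) * cos a + cos (x - a) * sin a"
        using cos_add[of "x - a" a] sin_add[of "x - a" a] by simp_all
      show ?thesis unfolding k_def g_def inner_vec2
        by (simp add: x sin_add cos_add algebra_simps)
    qed
    then show ?thesis by (simp add: 1 F_def algebra_simps power2_eq_square)
  qed
  have FS: "\<bar>S x * F x\<bar> \<le> m" if "\<bar>fst z \<bullet> circ x - snd z\<bar> \<le> m" for x
    using that m(1) unfolding exp[of x] k_def[symmetric] by (auto simp: abs_mult)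
  have Sb: "f \<le> \<bar>S b\<bar>" "f \<le> \<bar>S c\<bar>" using f by (auto simp: S_def)
  have Fb: "\<bar>F b\<bar> \<le> m / \<bar>S b\<bar>" "\<bar>F c\<bar> \<le> m / \<bar>S c\<bar>"
    using FS[OF m(2)] FS[OF m(3)] Sb f(1) by (auto simp: field_simps abs_mult)
  define D where "D = sin ((b - c) / 2)"
  have D: "D = S b * C c - S c * C b"
  proof -
    have "(b - c) / 2 = (b - a) / 2 - (c - a) / 2" by (simp add: field_simps)
    then show ?thesis unfolding D_def S_def C_def by (simp only: sin_diff mult.commute)
  qed
  have s1: "S b = D * C c + cos ((b - c) / 2) * S c"
  proof -
    have "(b - a) / 2 = (b - c) / 2 + (c - a) / 2" by (simp add: field_simps)
    then show ?thesis unfolding D_def S_def C_def by (simp only: sin_add)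
  qed
  have s2: "S c = - D * C b + cos ((b - c) / 2) * S b"
  proof -
    have "(c - a) / 2 = (b - a) / 2 - (b - c) / 2" by (simp add: field_simps)
    then show ?thesis unfolding D_def S_def C_def by (simp only: sin_diff) simp
  qed
  have bnd: "\<bar>u * v + w * t\<bar> \<le> \<bar>u\<bar> + \<bar>t\<bar>" if "\<bar>v\<bar> \<le> 1" "\<bar>w\<bar> \<le> 1" for u v w t :: real
    using abs_triangle_ineq[of "u * v" "w * t"] mult_left_le[OF that(1), of "\<bar>u\<bar>"]
      mult_left_le_one_le[OF _ _ that(2), of "\<bar>t\<bar>"] by (simp add: abs_mult)
  have one: "\<bar>C x\<bar> \<le> 1" "\<bar>cos y\<bar> \<le> 1" for x y :: real by (simp_all add: C_def)
  have tri: "\<bar>S b\<bar> \<le> \<bar>D\<bar> + \<bar>S c\<bar>" "\<bar>S c\<bar> \<le> \<bar>D\<bar> + \<bar>S b\<bar>"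
    using bnd[OF one(1)[of c] one(2)[of "(b - c) / 2"], of D "S c"]
      bnd[OF one(1)[of b] one(2)[of "(b - c) / 2"], of "- D" "S b"]
    unfolding s1[symmetric] s2[symmetric] by simp_all
  have D0: "f \<le> \<bar>D\<bar>" using f by (simp add: D_def)
  have kD: "k * D = F c * C b - F b * C c"
    by (simp add: D F_def algebra_simps)
  have gD: "g * D = F c * S b - F b * S c"
    by (simp add: D F_def algebra_simps)
  have "\<bar>F b\<bar> \<le> m / f" "\<bar>F c\<bar> \<le> m / f"
    using Fb Sb f(1) m0 by (meson divide_left_mono order_trans mult_pos_pos less_le_trans)+
  then have "\<bar>F c * C b\<bar> \<le> m / f" "\<bar>F b * C c\<bar> \<le> m / f"
    using one(1)[of b] one(1)[of c] by (auto simp: abs_mult intro: order_trans[OF mult_left_le])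
  then have "\<bar>k\<bar> * \<bar>D\<bar> \<le> 2 * m / f" unfolding abs_mult[symmetric] kD by linarith
  then have "\<bar>k\<bar> * f \<le> 2 * m / f"
    using D0 by (meson abs_ge_zero mult_left_mono order_trans)
  then show "\<bar>fst z \<bullet> circ a\<bar> \<le> 2 * m / f\<^sup>2"
    using f(1) by (simp add: k_def field_simps power2_eq_square)
  \<comment> \<open>Bounding \<open>F b\<close> and \<open>F c\<close> by \<open>m / f\<close> again
    would give only 1/f^2 for \<open>g\<close>. Instead the sines stay in a quotient:
    \<open>S b\<close> and \<open>S c\<close> differ in modulus by at most |D|, and the division by
    \<open>D\<close> then costs a single 1/f.\<close>
  have q: "x / y \<le> 1 + \<bar>D\<bar> / f" if "x \<le> \<bar>D\<bar> + y" "f \<le> y" for x y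
  proof -
    have "x / y \<le> (\<bar>D\<bar> + y) / y" using that f(1) by (simp add: divide_right_mono)
    also have "\<dots> = \<bar>D\<bar> / y + 1" using that f(1) by (simp add: field_simps)
    also have "\<bar>D\<bar> / y \<le> \<bar>D\<bar> / f" using that f(1) by (simp add: frac_le)
    finally show ?thesis by simp
  qed
  have "\<bar>F c * S b\<bar> \<le> m * (\<bar>S b\<bar> / \<bar>S c\<bar>)" "\<bar>F b * S c\<bar> \<le> m * (\<bar>S c\<bar> / \<bar>S b\<bar>)"
    using mult_right_mono[OF Fb(2), of "\<bar>S b\<bar>"] mult_right_mono[OF Fb(1), of "\<bar>S c\<bar>"]
    by (simp_all add: abs_mult)
  moreover have "m * (\<bar>S b\<bar> / \<bar>S c\<bar>) \<le> m * (1 + \<bar>D\<bar> / f)" "m * (\<bar>S c\<bar> / \<bar>S b\<bar>) \<le> m * (1 + \<bar>D\<bar> / f)"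
    by (rule mult_left_mono[OF q[OF tri(1) Sb(2)] m0], rule mult_left_mono[OF q[OF tri(2) Sb(1)] m0])
  ultimately have "\<bar>g\<bar> * \<bar>D\<bar> \<le> 2 * m * (1 + \<bar>D\<bar> / f)"
    unfolding abs_mult[symmetric] gD by linarith
  also have "\<dots> \<le> 2 * m * (\<bar>D\<bar> / f + \<bar>D\<bar> / f)"
    using D0 f(1) m0 by (intro mult_left_mono) (auto simp: field_simps)
  finally have "\<bar>g\<bar> * \<bar>D\<bar> \<le> (4 * m / f) * \<bar>D\<bar>" by simp
  then show "\<bar>fst z \<bullet> circ (a + pi / 2)\<bar> \<le> 4 * m / f"
    using D0 f(1) unfolding g_def[symmetric] by (auto intro: mult_right_le_imp_le[of _ "\<bar>D\<bar>"])
qed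

text \<open>\<open>mink v v\<close> is (p - s)(p + s) for the lengths p, s of the two components,
  and p + s is comparable to r; so the last condition puts \<open>v\<close> within a distance of
  order l of the light cone.\<close>

definition near_light :: "real \<Rightarrow> real \<Rightarrow> spacetime \<Rightarrow> bool" where
  "near_light r l v \<longleftrightarrow> r \<le> norm v \<and> norm v \<le> 2 * r \<and> \<bar>mink v v\<bar> \<le> l * r"

text \<open>The sign of the time component is divided out: \<open>v\<close> and \<open>- v\<close>
  get the same direction, that of the null line near them, and \<open>fst v\<close> is close to
  \<open>snd v *\<^sub>R light_dir v\<close> for both time orientations.\<close>

definition light_dir :: "spacetime \<Rightarrow> real ^ 2" where
  "light_dir v = (sgn (snd v) / norm (fst v)) *\<^sub>R fst v"

lemma near_light_approx:
  assumes v: "near_light r l v" and l: "1 \<le> l" "4 * l \<le> r"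
  shows "r / 2 \<le> \<bar>snd v\<bar>" "norm (light_dir v) = 1"
    "norm (fst v - snd v *\<^sub>R light_dir v) \<le> l"
proof -
  define p where "p = norm (fst v)"
  define s where "s = \<bar>snd v\<bar>"
  have p0: "p \<ge> 0" "s \<ge> 0" by (simp_all add: p_def s_def)
  have r0: "r > 0" using l by linarith
  have nv: "r \<le> norm v" "(norm v)\<^sup>2 = p\<^sup>2 + s\<^sup>2" "mink v v = p\<^sup>2 - s\<^sup>2" "\<bar>mink v v\<bar> \<le> l * r"
    using v unfolding near_light_def p_def s_def norm_prod_sq mink_def
    by (simp_all add: power2_norm_eq_inner) (simp add: power2_eq_square)
  have rr: "r\<^sup>2 \<le> p\<^sup>2 + s\<^sup>2" using nv r0 by (metis power_mono less_imp_le)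
  \<comment> \<open>With \<open>4 * l \<le> r\<close> the difference of p^2 and s^2 is at most a
    quarter of their sum, so neither can fall below r^2/4.\<close>
  have "l * r \<le> r\<^sup>2 / 4" using mult_right_mono[OF l(2), of r] r0 by (simp add: power2_eq_square)
  then have "r\<^sup>2 / 4 \<le> s\<^sup>2" "r\<^sup>2 / 4 \<le> p\<^sup>2" using rr nv(3,4) by linarith+
  then have "(r / 2)\<^sup>2 \<le> s\<^sup>2" "(r / 2)\<^sup>2 \<le> p\<^sup>2" by (simp_all add: power_divide)
  then have s: "r / 2 \<le> s" "r / 2 \<le> p" using p0 power2_le_imp_le by blast+
  show "r / 2 \<le> \<bar>snd v\<bar>" using s by (simp add: s_def)
  have nz: "snd v \<noteq> 0" "p > 0" using s r0 s_def by auto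
  then have sg: "\<bar>sgn (snd v)\<bar> = 1" by (simp add: abs_sgn_eq)
  show "norm (light_dir v) = 1"
    using nz sg by (simp add: light_dir_def p_def)
  have "fst v - snd v *\<^sub>R light_dir v = ((p - s) / p) *\<^sub>R fst v"
    using nz by (simp add: light_dir_def p_def[symmetric] s_def abs_sgn diff_divide_distrib scaleR_diff_left)
  then have "norm (fst v - snd v *\<^sub>R light_dir v) = \<bar>p - s\<bar>"
    using nz(2) by (simp add: p_def[symmetric])
  moreover have "\<bar>p - s\<bar> * (p + s) \<le> l * (p + s)"
  proof -
    have "\<bar>p - s\<bar> * (p + s) = \<bar>p\<^sup>2 - s\<^sup>2\<bar>"
      using p0 by (simp add: square_diff_square_factored power2_eq_square abs_mult abs_of_nonneg mult.commute)
    also have "\<dots> \<le> l * r" using nv by simp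
    also have "\<dots> \<le> l * (p + s)" using s l by (intro mult_left_mono) auto
    finally show ?thesis .
  qed
  ultimately show "norm (fst v - snd v *\<^sub>R light_dir v) \<le> l"
    using s r0 by (simp add: mult_le_cancel_right)
qed

text \<open>With \<open>v = x - y\<close>: subtract the light cone equations of \<open>x\<close> at \<open>y\<close> and at \<open>y + z\<close>.\<close>

lemma common_neighbour_constraint:
  assumes v: "near_light r l v" "near_light r l (v - z)" and l: "1 \<le> l" "4 * l \<le> r"
  shows "\<bar>(fst z \<bullet> light_dir v - snd z) - mink z z / (2 * snd v)\<bar> \<le> 10 * l"
proof -
  note a = near_light_approx[OF v(1) l]
  have r0: "r > 0" using l by linarith
  define E where "E = fst v - snd v *\<^sub>R light_dir v"
  define H where "H = fst z \<bullet> light_dir v - snd z"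
  have z: "norm z \<le> 4 * r"
    using v norm_triangle_ineq4[of v "v - z"] unfolding near_light_def by simp
  have "norm (fst z) \<le> norm z" by (rule norm_fst_le[of "fst z" "snd z", simplified])
  then have "\<bar>fst z \<bullet> E\<bar> \<le> (4 * r) * l"
    using Cauchy_Schwarz_ineq2[of "fst z" E] a(3) z mult_mono[of "norm (fst z)" "4 * r" "norm E" l] r0 unfolding E_def
    by fastforce
  moreover have "mink v z = snd v * H + fst z \<bullet> E"
    by (simp add: mink_def H_def E_def inner_diff inner_commute algebra_simps)
  moreover have "mink (v - z) (v - z) = mink v v - 2 * mink v z + mink z z"
    by (simp add: mink_bilinear mink_commute)
  moreover have "\<bar>mink v v\<bar> \<le> l * r" "\<bar>mink (v - z) (v - z)\<bar> \<le> l * r"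
    using v by (auto simp: near_light_def)
  ultimately have "\<bar>snd v * H - mink z z / 2\<bar> \<le> 5 * (l * r)"
    by (simp add: algebra_simps)
  moreover have "snd v * H - mink z z / 2 = snd v * (H - mink z z / (2 * snd v))"
    using a(1) r0 by (auto simp: field_simps)
  ultimately have "\<bar>snd v\<bar> * \<bar>H - mink z z / (2 * snd v)\<bar> \<le> 5 * (l * r)" by (simp add: abs_mult)
  then have "(r / 2) * \<bar>H - mink z z / (2 * snd v)\<bar> \<le> 5 * (l * r)"
    using a(1) by (meson abs_ge_zero mult_right_mono order_trans)
  then show ?thesis using r0 unfolding H_def by (simp add: field_simps)
qed

text \<open>By \<open>three_light_constraints\<close> the coordinates k, g, h of \<open>z\<close>
  have sizes m/f^2, m/f, m. Every term of \<open>mink_light_coords\<close> pairs them with a total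
  weight of at most f^-2, whereas the Euclidean product would lose f^-4. The constant is 16 + 2 + 2
  + 1.\<close>

lemma mink_le_of_constraints:
  fixes z z' :: "spacetime"
  assumes z: "\<And>x. x \<in> {a, b, c} \<Longrightarrow> \<bar>fst z \<bullet> circ x - snd z\<bar> \<le> m"
    and z': "\<And>x. x \<in> {a, b, c} \<Longrightarrow> \<bar>fst z' \<bullet> circ x - snd z'\<bar> \<le> m'"
    and f: "f > 0" "f \<le> \<bar>sin ((b - a) / 2)\<bar>" "f \<le> \<bar>sin ((c - a) / 2)\<bar>" "f \<le> \<bar>sin ((b - c) / 2)\<bar>"
  shows "\<bar>mink z z'\<bar> \<le> 21 * m * m' / f\<^sup>2"
proof -
  have f1: "f \<le> 1" using f(2) abs_sin_le_one[of "(b - a) / 2"] by linarith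
  then have f2: "0 < f\<^sup>2" "f\<^sup>2 \<le> 1" using f(1) by (auto simp: power_le_one)
  have m: "m \<ge> 0" "m' \<ge> 0" using z[of a] z'[of a] by auto
  define k g where "k z = fst z \<bullet> circ a" and "g z = fst z \<bullet> circ (a + pi / 2)" for z :: "spacetime"
  define h where "h z = k z - snd z" for z :: "spacetime"
  have B: "\<bar>k z\<bar> \<le> 2 * m / f\<^sup>2" "\<bar>g z\<bar> \<le> 4 * m / f" "\<bar>h z\<bar> \<le> m"
          "\<bar>k z'\<bar> \<le> 2 * m' / f\<^sup>2" "\<bar>g z'\<bar> \<le> 4 * m' / f" "\<bar>h z'\<bar> \<le> m'"
    unfolding h_def k_def g_def
    using three_light_constraints[OF z z z f] three_light_constraints[OF z' z' z' f] z[of a] z'[of a] by simp_all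
  have "mink z z' = g z * g z' + k z * h z' + k z' * h z - h z * h z'"
    unfolding h_def k_def g_def by (rule mink_light_coords)
  then have "\<bar>mink z z'\<bar> \<le> \<bar>g z\<bar> * \<bar>g z'\<bar> + \<bar>k z\<bar> * \<bar>h z'\<bar> + \<bar>k z'\<bar> * \<bar>h z\<bar> + \<bar>h z\<bar> * \<bar>h z'\<bar>"
    unfolding abs_mult[symmetric] by linarith
  also have "\<dots> \<le> (4 * m / f) * (4 * m' / f) + (2 * m / f\<^sup>2) * m' + (2 * m' / f\<^sup>2) * m + m * m'"
  proof -
    have nn: "0 \<le> 4 * m / f" "0 \<le> 2 * m / f\<^sup>2" "0 \<le> 2 * m' / f\<^sup>2" using m f(1) by simp_all
    show ?thesis
      by (intro add_mono mult_mono' B abs_ge_zero)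
  qed
  also have "m * m' \<le> m * m' / f\<^sup>2"
    using f2 m by (simp add: pos_le_divide_eq mult_left_le)
  also have "(4 * m / f) * (4 * m' / f) + (2 * m / f\<^sup>2) * m' + (2 * m' / f\<^sup>2) * m + m * m' / f\<^sup>2 = 21 * m * m' / f\<^sup>2"
    using f(1) by (simp add: field_simps power2_eq_square)
  finally show ?thesis by simp
qed

text \<open>Both \<open>z\<close> and \<open>w\<close> almost satisfy three independent linear equations with right-hand sides proportional to their squares
  \<open>Q\<close>, so \<open>w\<close> is nearly \<open>\<rho> z\<close> with \<open>\<rho> = Q(w)/Q(z)\<close>, and comparing squares forces \<open>\<rho>\<close> to be close to 1.\<close>

lemma far_pair_near_aux:
  fixes z w :: "spacetime"
  assumes z: "\<And>x. x \<in> {a, b, c} \<Longrightarrow> \<bar>(fst z \<bullet> circ x - snd z) - mink z z / (2 * \<tau> x)\<bar> \<le> 10 * l"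
    and w: "\<And>x. x \<in> {a, b, c} \<Longrightarrow> \<bar>(fst w \<bullet> circ x - snd w) - mink w w / (2 * \<tau> x)\<bar> \<le> 10 * l"
    and \<tau>: "\<And>x. x \<in> {a, b, c} \<Longrightarrow> r / 2 \<le> \<bar>\<tau> x\<bar>"
    and f: "f > 0" "f \<le> \<bar>sin ((b - a) / 2)\<bar>" "f \<le> \<bar>sin ((c - a) / 2)\<bar>" "f \<le> \<bar>sin ((b - c) / 2)\<bar>"
    and l: "l > 0" "r > 0" "f\<^sup>2 * f\<^sup>2 * r = l" and nz: "norm z \<le> 4 * r"
    and far: "100000000 * (l * r) < \<bar>mink z z\<bar>" "100000000 * (l * r) < \<bar>mink w w\<bar>"
    and le: "\<bar>mink w w\<bar> \<le> \<bar>mink z z\<bar>"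
  shows "\<bar>mink (w - z) (w - z)\<bar> \<le> 100000000 * (l * r)"
proof -
  define q where "q = mink z z"
  define \<rho> where "\<rho> = mink w w / q"
  define e where "e = w - \<rho> *\<^sub>R z"
  define \<eta> where "\<eta> = f\<^sup>2"
  have f1: "f \<le> 1" using f(2) abs_sin_le_one[of "(b - a) / 2"] by linarith
  have \<eta>: "0 < \<eta>" "\<eta> \<le> 1" using f(1) f1 by (auto simp: \<eta>_def power_le_one)
  have lr: "l * r > 0" using l by simp
  have q0: "q \<noteq> 0" "\<bar>q\<bar> > 0" using far(1) lr by (auto simp: q_def)
  have \<rho>1: "\<bar>\<rho>\<bar> \<le> 1" using le q0 by (simp add: \<rho>_def q_def)
  have \<rho>q: "mink w w = \<rho> * q" using q0 by (simp add: \<rho>_def)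
  have e: "\<bar>fst e \<bullet> circ x - snd e\<bar> \<le> 20 * l" if x: "x \<in> {a, b, c}" for x
  proof -
    have "fst e \<bullet> circ x - snd e = ((fst w \<bullet> circ x - snd w) - mink w w / (2 * \<tau> x))
        - \<rho> * ((fst z \<bullet> circ x - snd z) - mink z z / (2 * \<tau> x))"
      unfolding \<rho>q q_def[symmetric] by (simp add: e_def inner_diff algebra_simps)
    moreover have "\<bar>\<rho> * ((fst z \<bullet> circ x - snd z) - mink z z / (2 * \<tau> x))\<bar> \<le> 1 * (10 * l)"
      unfolding abs_mult using z[OF x] \<rho>1 by (intro mult_mono) auto
    ultimately show ?thesis using w[OF x] by linarith
  qed
  have z2: "\<bar>fst z \<bullet> circ x - snd z\<bar> \<le> 2 * \<bar>q\<bar> / r" if x: "x \<in> {a, b, c}" for x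
  proof -
    have "\<bar>mink z z / (2 * \<tau> x)\<bar> \<le> \<bar>q\<bar> / r"
      unfolding q_def[symmetric] abs_divide using \<tau>[OF x] l by (intro frac_le) auto
    moreover have "10 * l \<le> \<bar>q\<bar> / r"
    proof -
      have "10 * (l * r) \<le> \<bar>q\<bar>" using far(1) lr unfolding q_def by linarith
      then show ?thesis using l by (simp add: pos_le_divide_eq)
    qed
    moreover have "2 * \<bar>q\<bar> / r = \<bar>q\<bar> / r + \<bar>q\<bar> / r" by simp
    ultimately show ?thesis using z[OF x] by linarith
  qed
  \<comment> \<open>Here \<open>f^4 * r = l\<close> acts on the geometry: the errors of both
    pairings below become \<eta> times the natural sizes |q| and l r, so that they can be
    absorbed.\<close>
  have lre3: "\<eta> * \<eta> * r = l" using l(3) by (simp only: \<eta>_def)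
  have "l / (r * \<eta>) = \<eta>" "l\<^sup>2 / \<eta> = l * r * \<eta>"
    unfolding lre3[symmetric] using l(2) \<eta>(1) by (simp_all add: power2_eq_square)
  note lre = this lre3
  define B where "B = mink z e"
  have Bz: "\<bar>B\<bar> \<le> 840 * \<bar>q\<bar> * \<eta>"
  proof -
    have "\<bar>B\<bar> \<le> 21 * (2 * \<bar>q\<bar> / r) * (20 * l) / \<eta>"
      unfolding B_def \<eta>_def by (rule mink_le_of_constraints[OF z2 e f])
    also have "\<dots> = 840 * \<bar>q\<bar> * (l / (r * \<eta>))" by simp
    finally show ?thesis unfolding lre .
  qed
  have Qe: "\<bar>mink e e\<bar> \<le> 8400 * (l * r * \<eta>)"
  proof -
    have "\<bar>mink e e\<bar> \<le> 21 * (20 * l) * (20 * l) / \<eta>"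
      unfolding \<eta>_def by (rule mink_le_of_constraints[OF e e f])
    also have "\<dots> = 8400 * (l\<^sup>2 / \<eta>)" by (simp add: power2_eq_square)
    finally show ?thesis unfolding lre .
  qed
  have w: "w = \<rho> *\<^sub>R z + e" by (simp add: e_def)
  have "\<rho> * q = \<rho> * \<rho> * q + 2 * \<rho> * B + mink e e"
  proof -
    have "mink w w = mink (\<rho> *\<^sub>R z + e) (\<rho> *\<^sub>R z + e)" by (simp only: w[symmetric])
    then show ?thesis
      unfolding \<rho>q B_def q_def by (simp add: mink_bilinear mink_commute[of e z] algebra_simps)
  qed
  then have "\<rho> * q * (1 - \<rho>) = 2 * \<rho> * B + mink e e" by (simp add: algebra_simps)
  then have "\<bar>\<rho> * q\<bar> * \<bar>1 - \<rho>\<bar> \<le> 2 * (\<bar>\<rho>\<bar> * \<bar>B\<bar>) + \<bar>mink e e\<bar>"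
    by (simp add: abs_mult[symmetric] algebra_simps)
  also have "\<bar>\<rho>\<bar> * \<bar>B\<bar> \<le> \<bar>\<rho>\<bar> * (840 * \<bar>q\<bar> * \<eta>)" using Bz by (simp add: mult_left_mono)
  also have "\<bar>mink e e\<bar> \<le> \<bar>\<rho> * q\<bar> * \<eta>"
  proof -
    have "8400 * (l * r) \<le> \<bar>\<rho> * q\<bar>" using far(2) lr unfolding \<rho>q by linarith
    then have "8400 * (l * r) * \<eta> \<le> \<bar>\<rho> * q\<bar> * \<eta>" using \<eta> by (simp add: mult_right_mono)
    then show ?thesis using Qe by simp
  qed
  \<comment> \<open>1681 = 2 * 840 + 1. Division by the modulus of \<rho> q, positive because
    \<open>w\<close> is far, pins \<rho> to 1 up to O(\<eta>).\<close>
  finally have "\<bar>\<rho> * q\<bar> * \<bar>1 - \<rho>\<bar> \<le> \<bar>\<rho> * q\<bar> * (1681 * \<eta>)" by (simp add: abs_mult algebra_simps)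
  moreover have "\<bar>\<rho> * q\<bar> > 0" using far(2) lr unfolding \<rho>q by linarith
  ultimately have "\<bar>1 - \<rho>\<bar> \<le> 1681 * \<eta>" by (simp only: mult_le_cancel_left_pos)
  then have \<rho>2: "\<bar>\<rho> - 1\<bar> \<le> 1681 * \<eta>" by linarith
  \<comment> \<open>The crude bound |q| \<le> 16 r^2 is turned by \<eta>^2 r = l into the size l r
    allowed for the result.\<close>
  have qr: "\<eta> * \<eta> * \<bar>q\<bar> \<le> 16 * (l * r)"
  proof -
    have "\<bar>q\<bar> \<le> (4 * r)\<^sup>2" unfolding q_def
      using mink_self_le[of z] power_mono[OF nz, of 2] by simp
    then have "\<eta> * \<eta> * \<bar>q\<bar> \<le> \<eta> * \<eta> * (4 * r)\<^sup>2" using \<eta> by (intro mult_left_mono) auto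
    also have "\<dots> = 16 * ((\<eta> * \<eta> * r) * r)" by (simp add: power2_eq_square)
    finally show ?thesis unfolding lre .
  qed
  have "mink (w - z) (w - z) = (\<rho> - 1) * (\<rho> - 1) * q + 2 * ((\<rho> - 1) * B) + mink e e"
  proof -
    have wz: "w - z = (\<rho> - 1) *\<^sub>R z + e" by (simp add: e_def algebra_simps)
    show ?thesis
      unfolding wz B_def q_def by (simp only: mink_bilinear mink_commute[of e z]) (simp add: algebra_simps)
  qed
  then have "\<bar>mink (w - z) (w - z)\<bar> \<le> \<bar>\<rho> - 1\<bar> * \<bar>\<rho> - 1\<bar> * \<bar>q\<bar> + 2 * (\<bar>\<rho> - 1\<bar> * \<bar>B\<bar>) + \<bar>mink e e\<bar>"
    unfolding abs_mult[symmetric] by linarith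
  also have "\<bar>\<rho> - 1\<bar> * \<bar>\<rho> - 1\<bar> * \<bar>q\<bar> \<le> (1681 * \<eta>) * (1681 * \<eta>) * \<bar>q\<bar>"
    using \<rho>2 \<eta> by (intro mult_mono) auto
  also have "\<bar>\<rho> - 1\<bar> * \<bar>B\<bar> \<le> (1681 * \<eta>) * (840 * \<bar>q\<bar> * \<eta>)"
    using \<rho>2 Bz \<eta> by (intro mult_mono) auto
  also have "\<bar>mink e e\<bar> \<le> 8400 * (l * r)"
    using Qe mult_left_le[OF \<eta>(2), of "l * r"] lr by linarith
  \<comment> \<open>5649841 = 1681^2 + 2 * 1681 * 840. Multiplied by the 16 of \<open>qr\<close>,
    and with 8400 added, it stays below 10^8; this is the origin of the threshold between near and
    far pairs.\<close>
  finally have "\<bar>mink (w - z) (w - z)\<bar> \<le> 5649841 * (\<eta> * \<eta> * \<bar>q\<bar>) + 8400 * (l * r)"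
    by (simp add: algebra_simps)
  then show ?thesis using qr lr by linarith
qed

lemma far_pair_near:
  fixes z w :: "spacetime"
  assumes z: "\<And>x. x \<in> {a, b, c} \<Longrightarrow> \<bar>(fst z \<bullet> circ x - snd z) - mink z z / (2 * \<tau> x)\<bar> \<le> 10 * l"
    and w: "\<And>x. x \<in> {a, b, c} \<Longrightarrow> \<bar>(fst w \<bullet> circ x - snd w) - mink w w / (2 * \<tau> x)\<bar> \<le> 10 * l"
    and \<tau>: "\<And>x. x \<in> {a, b, c} \<Longrightarrow> r / 2 \<le> \<bar>\<tau> x\<bar>"
    and f: "f > 0" "f \<le> \<bar>sin ((b - a) / 2)\<bar>" "f \<le> \<bar>sin ((c - a) / 2)\<bar>" "f \<le> \<bar>sin ((b - c) / 2)\<bar>"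
    and l: "l > 0" "r > 0" "f\<^sup>2 * f\<^sup>2 * r = l" and n: "norm z \<le> 4 * r" "norm w \<le> 4 * r"
    and far: "100000000 * (l * r) < \<bar>mink z z\<bar>" "100000000 * (l * r) < \<bar>mink w w\<bar>"
  shows "\<bar>mink (w - z) (w - z)\<bar> \<le> 100000000 * (l * r)"
proof (cases "\<bar>mink w w\<bar> \<le> \<bar>mink z z\<bar>")
  case True
  then show ?thesis by (intro far_pair_near_aux[OF z w \<tau> f l n(1) far])
next
  case False
  then have "\<bar>mink (z - w) (z - w)\<bar> \<le> 100000000 * (l * r)"
    by (intro far_pair_near_aux[OF w z \<tau> f l n(2) far(2,1)]) auto
  then show ?thesis by (simp add: mink_bilinear mink_commute algebra_simps)
qed

section \<open>Angles and chords on the circle\<close>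

lemma abs_le_two_abs_sin:
  fixes y :: real
  assumes "\<bar>y\<bar> \<le> pi / 2"
  shows "\<bar>y\<bar> \<le> 2 * \<bar>sin y\<bar>"
proof -
  have "\<bar>sin y - (\<Sum>m<3. sin_coeff m * y ^ m)\<bar> \<le> inverse (fact 3) * \<bar>y\<bar> ^ 3"
    by (rule Maclaurin_sin_bound)
  then have 1: "\<bar>sin y - y\<bar> \<le> \<bar>y\<bar> * y\<^sup>2 / 6"
    by (simp add: eval_nat_numeral sin_coeff_def abs_mult)
  have "pi \<le> 32 / 10" by (rule order_trans[OF pi_approx(2)]) simp
  with assms have "\<bar>y\<bar> \<le> 16 / 10" by linarith
  then have "y\<^sup>2 \<le> (16 / 10)\<^sup>2" by (metis abs_ge_zero power2_abs power_mono)
  then have "\<bar>y\<bar> * y\<^sup>2 / 6 \<le> \<bar>y\<bar> * 3 / 6" by (intro divide_right_mono mult_left_mono) (auto simp: power2_eq_square)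
  with 1 show ?thesis by linarith
qed

lemma circ_shift: "circ (a - 2 * pi * of_int n) = circ a"
  by (simp only: circ_def cos_diff sin_diff cos_int_2pin sin_int_2pin) simp

lemma circ_near:
  assumes "norm (circ a - circ b) < 2 * f"
  obtains d where "circ a = circ (b + d)" "\<bar>d\<bar> \<le> 4 * f"
proof -
  define x where "x = (a - b) / 2"
  \<comment> \<open>Reduction is modulo pi, not 2 pi: \<open>x\<close> is a half difference, the
    modulus of its sine has period pi, and a shift by pi is a full turn of the angle itself.\<close>
  define n where "n = round (x / pi)"
  have s: "\<bar>sin x\<bar> < f" using assms by (simp add: norm_circ_diff x_def)
  have "\<bar>of_int n - x / pi\<bar> \<le> 1 / 2" unfolding n_def by (rule of_int_round_abs_le)
  then have "\<bar>of_int n - x / pi\<bar> * pi \<le> 1 / 2 * pi" by (intro mult_right_mono) auto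
  also have "\<bar>of_int n - x / pi\<bar> * pi = \<bar>x - of_int n * pi\<bar>"
  proof -
    have "x - of_int n * pi = - (of_int n - x / pi) * pi" by (simp add: field_simps)
    then show ?thesis by (simp only: abs_mult) simp
  qed
  finally have y: "\<bar>x - of_int n * pi\<bar> \<le> pi / 2" by simp
  have "\<bar>sin (x - of_int n * pi)\<bar> = \<bar>sin x\<bar>"
  proof -
    have 0: "sin (of_int n * pi) = 0" using sin_npi_int[of n] by (simp add: mult.commute)
    then have "\<bar>cos (of_int n * pi)\<bar> = 1"
      using sin_cos_squared_add[of "of_int n * pi"] by (simp add: power2_eq_1_iff) linarith
    then show ?thesis by (simp add: sin_diff 0 abs_mult)
  qed
  with abs_le_two_abs_sin[OF y] s have "\<bar>x - of_int n * pi\<bar> \<le> 2 * f" by linarith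
  moreover have "circ (b + 2 * (x - of_int n * pi)) = circ (a - 2 * pi * of_int n)"
    by (rule arg_cong[where f = circ]) (simp add: x_def field_simps)
  ultimately show ?thesis using circ_shift by (intro that[of "2 * (x - of_int n * pi)"]) auto
qed

section \<open>Orthonormal frames along light rays, and the mass of boxes\<close>

definition frame_u :: "real \<Rightarrow> spacetime" where "frame_u \<theta> = (circ (\<theta> + pi / 2), 0)"
text \<open>The Euclidean normal of the light cone along the ray of \<open>frame_w\<close>. Up to
  the factor sqrt 2, pairing with it is the light coordinate \<open>h\<close> of
  \<open>mink_light_coords\<close>, so the light constraints bound the \<open>frame_v\<close> side
  of a box.\<close>

definition frame_v :: "real \<Rightarrow> spacetime" where "frame_v \<theta> = (1 / sqrt 2) *\<^sub>R (circ \<theta>, -1)"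
definition frame_w :: "real \<Rightarrow> spacetime" where "frame_w \<theta> = (1 / sqrt 2) *\<^sub>R (circ \<theta>, 1)"

lemma frame_orthonormal:
  "frame_u \<theta> \<bullet> frame_u \<theta> = 1" "frame_v \<theta> \<bullet> frame_v \<theta> = 1" "frame_w \<theta> \<bullet> frame_w \<theta> = 1"
  "frame_u \<theta> \<bullet> frame_v \<theta> = 0" "frame_u \<theta> \<bullet> frame_w \<theta> = 0" "frame_v \<theta> \<bullet> frame_w \<theta> = 0"
  "frame_v \<theta> \<bullet> frame_u \<theta> = 0" "frame_w \<theta> \<bullet> frame_u \<theta> = 0" "frame_w \<theta> \<bullet> frame_v \<theta> = 0"
  by (simp_all add: frame_u_def frame_v_def frame_w_def inner_prod_def circ_inner)

lemma inner_frame: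
  "z \<bullet> frame_u \<theta> = fst z \<bullet> circ (\<theta> + pi / 2)"
  "z \<bullet> frame_v \<theta> = (fst z \<bullet> circ \<theta> - snd z) / sqrt 2"
  "z \<bullet> frame_w \<theta> = (fst z \<bullet> circ \<theta> + snd z) / sqrt 2"
  by (simp_all add: frame_u_def frame_v_def frame_w_def inner_prod_def field_simps)

definition light_box :: "real \<Rightarrow> spacetime \<Rightarrow> real \<Rightarrow> real \<Rightarrow> real \<Rightarrow> spacetime set" where
  "light_box \<theta> c A B L = {x. \<bar>(x - c) \<bullet> frame_u \<theta>\<bar> \<le> A \<and> \<bar>(x - c) \<bullet> frame_v \<theta>\<bar> \<le> B \<and> \<bar>(x - c) \<bullet> frame_w \<theta>\<bar> \<le> L}"

lemma closed_light_box: "closed (light_box \<theta> c A B L)"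
  unfolding light_box_def by (intro closed_Collect_conj closed_Collect_le continuous_intros)

lemma light_box_borel [measurable]: "light_box \<theta> c A B L \<in> sets borel"
  using closed_light_box by (rule borel_closed)

lemma abs_divide_sqrt2_le: "\<bar>x / sqrt 2\<bar> \<le> \<bar>x\<bar>"
  using divide_left_mono[of 1 "sqrt 2" "\<bar>x\<bar>"] by (simp add: abs_divide)

text \<open>\<open>M\<close> stands for Lebesgue measure on X, or for its restriction to a ball, and
  \<open>t\<close> for the largest tube mass. Every tube is written as a light box, with its axis
  along a null ray.\<close>

locale light_weight = finite_measure M
  for M :: "spacetime measure" +
  fixes R t :: real
  assumes sets_M [measurable_cong, simp]: "sets M = sets borel"
    and R_pos: "R > 0" and t_pos: "t > 0"
    and tube_mass: "\<And>\<theta> c. emeasure M (light_box \<theta> c (1/2) (1/2) (R/2)) \<le> ennreal t"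
begin

text \<open>Rounding the frame coordinates to integers, the last one in units of R, covers the box
  by tubes; there are at most 2A + 2 integers of modulus up to A + 1/2. A length comparable to R
  thus costs only a constant.\<close>

lemma box_mass:
  assumes "A \<ge> 0" "B \<ge> 0" "L \<ge> 0"
  shows "emeasure M (light_box \<theta> c A B L) \<le> ennreal ((2 * A + 2) * (2 * B + 2) * (2 * (L / R) + 2) * t)"
proof -
  define I where "I A = {i :: int. \<bar>of_int i\<bar> \<le> A + 1/2}" for A :: real
  have I: "I A = {- \<lfloor>A + 1/2\<rfloor>..\<lfloor>A + 1/2\<rfloor>}" for A
    by (auto simp: I_def abs_le_iff le_floor_iff minus_le_iff[of _ "real_of_int _"]) (simp_all add: le_floor_iff minus_le_iff)
  have finI: "finite (I A)" for A by (simp add: I)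
  have cardI: "real (card (I A)) \<le> 2 * A + 2" if "A \<ge> 0" for A
  proof -
    have "0 \<le> \<lfloor>A + 1/2\<rfloor>" using that by simp
    then have "real (card (I A)) = 2 * of_int \<lfloor>A + 1/2\<rfloor> + 1" by (simp add: I)
    then show ?thesis using of_int_floor_le[of "A + 1/2"] by linarith
  qed
  define J where "J = I A \<times> I B \<times> I (L / R)"
  define cc where "cc = (\<lambda>(i, j, k). c + of_int i *\<^sub>R frame_u \<theta> + of_int j *\<^sub>R frame_v \<theta> + (R * of_int k) *\<^sub>R frame_w \<theta>)"
  have "light_box \<theta> c A B L \<subseteq> (\<Union>p\<in>J. light_box \<theta> (cc p) (1/2) (1/2) (R/2))"
  proof
    fix x assume x: "x \<in> light_box \<theta> c A B L"
    define a b d where "a = (x - c) \<bullet> frame_u \<theta>" and "b = (x - c) \<bullet> frame_v \<theta>" and "d = (x - c) \<bullet> frame_w \<theta> / R"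
    have L: "\<bar>a\<bar> \<le> A" "\<bar>b\<bar> \<le> B" "\<bar>d\<bar> \<le> L / R"
      using x R_pos by (auto simp: light_box_def a_def b_def d_def abs_divide divide_right_mono)
    have rd: "\<bar>a - of_int (round a)\<bar> \<le> 1/2" for a :: real
      using of_int_round_abs_le[of a] by (simp add: abs_minus_commute)
    have rI: "round a \<in> I A" if "\<bar>a\<bar> \<le> A" for a A
      using rd[of a] that unfolding I_def mem_Collect_eq by linarith
    have "x \<in> light_box \<theta> (cc (round a, round b, round d)) (1/2) (1/2) (R/2)"
    proof -
      have "(x - cc (round a, round b, round d)) \<bullet> frame_u \<theta> = a - of_int (round a)"
        "(x - cc (round a, round b, round d)) \<bullet> frame_v \<theta> = b - of_int (round b)"
        "(x - cc (round a, round b, round d)) \<bullet> frame_w \<theta> = (d - of_int (round d)) * R"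
        using R_pos by (simp_all add: cc_def inner_diff_left inner_add_left frame_orthonormal a_def b_def d_def)
          (simp add: field_simps)
      moreover have "\<bar>(d - of_int (round d)) * R\<bar> \<le> R / 2"
        using mult_right_mono[OF rd[of d], of R] R_pos by (simp add: abs_mult)
      ultimately show ?thesis using rd[of a] rd[of b] by (simp add: light_box_def)
    qed
    moreover have "(round a, round b, round d) \<in> J" using rI L by (simp add: J_def)
    ultimately show "x \<in> (\<Union>p\<in>J. light_box \<theta> (cc p) (1/2) (1/2) (R/2))" by blast
  qed
  then have "emeasure M (light_box \<theta> c A B L) \<le> emeasure M (\<Union>p\<in>J. light_box \<theta> (cc p) (1/2) (1/2) (R/2))"
    by (intro emeasure_mono) (auto intro!: sets.finite_UN simp: J_def finI)
  also have "\<dots> \<le> (\<Sum>p\<in>J. emeasure M (light_box \<theta> (cc p) (1/2) (1/2) (R/2)))"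
    by (intro emeasure_subadditive_finite) (auto simp: J_def finI)
  also have "\<dots> \<le> (\<Sum>p\<in>J. ennreal t)" by (intro sum_mono tube_mass)
  also have "\<dots> = ennreal (real (card J) * t)"
    using t_pos by (simp add: ennreal_mult ennreal_of_nat_eq_real_of_nat)
  also have "\<dots> \<le> ennreal ((2 * A + 2) * (2 * B + 2) * (2 * (L / R) + 2) * t)"
  proof (intro ennreal_leI mult_right_mono)
    have "real (card J) = real (card (I A)) * (real (card (I B)) * real (card (I (L / R))))"
      by (simp add: J_def card_cartesian_product)
    also have "\<dots> \<le> (2 * A + 2) * ((2 * B + 2) * (2 * (L / R) + 2))"
      using assms R_pos by (intro mult_mono cardI) auto
    finally show "real (card J) \<le> (2 * A + 2) * (2 * B + 2) * (2 * (L / R) + 2)" by (simp add: mult.assoc)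
  qed (use t_pos in auto)
  finally show ?thesis .
qed

end

lemma inner_unit_le: "norm b = 1 \<Longrightarrow> \<bar>a \<bullet> b\<bar> \<le> norm a"
  using Cauchy_Schwarz_ineq2[of a b] by simp

text \<open>A turn by at most l/(2r) moves a point at distance at most 2r by at most l, and the
  distance to the cone adds another l.\<close>

lemma light_box_of_direction:
  assumes v: "near_light r l v" and l: "1 \<le> l" "4 * l \<le> r"
    and d: "light_dir v = circ (\<theta> + d)" "\<bar>d\<bar> \<le> l / (2 * r)"
  shows "c + v \<in> light_box \<theta> c (2 * l) (2 * l) (2 * r)"
proof -
  note a = near_light_approx[OF v l]
  have r0: "r > 0" using l by linarith
  define E where "E = fst v - snd v *\<^sub>R light_dir v"
  have v2: "norm v \<le> 2 * r" using v by (simp add: near_light_def)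
  have "\<bar>snd v\<bar> \<le> norm v" using norm_snd_le[of "snd v" "fst v"] by simp
  then have sd: "\<bar>snd v\<bar> * \<bar>d\<bar> \<le> l"
    using mult_mono[of "\<bar>snd v\<bar>" "2 * r" "\<bar>d\<bar>" "l / (2 * r)"] v2 d(2) r0 by simp
  have fv: "fst v = E + snd v *\<^sub>R circ (\<theta> + d)" by (simp add: E_def d(1))
  have E: "\<bar>E \<bullet> circ x\<bar> \<le> l" for x using inner_unit_le[of "circ x" E] a(3) unfolding E_def by simp
  have 1: "\<bar>v \<bullet> frame_u \<theta>\<bar> \<le> 2 * l"
  proof -
    have "v \<bullet> frame_u \<theta> = E \<bullet> circ (\<theta> + pi / 2) + snd v * sin d"
      by (simp add: inner_frame fv inner_add_left circ_inner cos_diff)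
    moreover have "\<bar>snd v * sin d\<bar> \<le> \<bar>snd v\<bar> * \<bar>d\<bar>"
      unfolding abs_mult by (intro mult_left_mono abs_sin_x_le_abs_x) auto
    ultimately show ?thesis using E[of "\<theta> + pi / 2"] sd by linarith
  qed
  have 2: "\<bar>v \<bullet> frame_v \<theta>\<bar> \<le> 2 * l"
  proof -
    have "fst v \<bullet> circ \<theta> - snd v = E \<bullet> circ \<theta> + snd v * (cos d - 1)"
      by (simp add: fv inner_add_left circ_inner algebra_simps)
    moreover have "\<bar>cos d - 1\<bar> \<le> \<bar>d\<bar>"
    proof -
      have "\<bar>cos d - 1\<bar> = 2 * (\<bar>sin (d / 2)\<bar> * \<bar>sin (d / 2)\<bar>)"
        using half_angle(1)[of d] by (simp add: power2_eq_square abs_mult)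
      also have "\<dots> \<le> 2 * (\<bar>d / 2\<bar> * 1)"
        using abs_sin_x_le_abs_x[of "d / 2"] by (intro mult_left_mono mult_mono) auto
      finally show ?thesis by simp
    qed
    then have "\<bar>snd v * (cos d - 1)\<bar> \<le> \<bar>snd v\<bar> * \<bar>d\<bar>"
      unfolding abs_mult by (intro mult_left_mono) auto
    ultimately have "\<bar>fst v \<bullet> circ \<theta> - snd v\<bar> \<le> 2 * l" using E[of \<theta>] sd by linarith
    then show ?thesis unfolding inner_frame by (rule order_trans[OF abs_divide_sqrt2_le])
  qed
  have 3: "\<bar>v \<bullet> frame_w \<theta>\<bar> \<le> 2 * r"
    using inner_unit_le[of "frame_w \<theta>" v] v2 by (simp add: norm_eq_sqrt_inner[of "frame_w \<theta>"] frame_orthonormal)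
  show ?thesis using 1 2 3 by (simp add: light_box_def)
qed

context light_weight begin

text \<open>A sector of angle f splits into about f r / l slices of angle l/r. Each slice lies in an
  l by l by r box, of mass O(l^2 t) because \<open>r \<le> 2 * R\<close>; the product is l f r t. By
  \<open>l \<le> f * r\<close> there is at least one full slice, which absorbs the rounding.\<close>

lemma sector_mass:
  assumes l: "1 \<le> l" "4 * l \<le> r" and r: "r \<le> 2 * R" and f: "0 < f" "f \<le> 1" "l \<le> f * r"
    and e: "norm e = 1"
  shows "emeasure M {x. near_light r l (x - y) \<and> norm (light_dir (x - y) - e) < 2 * f}
     \<le> ennreal (4000 * (l * f * r) * t)"
proof -
  obtain \<theta> where \<theta>: "e = circ \<theta>" using unit_vector_circ[OF e] .
  have r0: "r > 0" using l by linarith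
  define s where "s = l / r"
  have s0: "s > 0" using l r0 by (simp add: s_def)
  define N where "N = \<lfloor>4 * f / s + 1/2\<rfloor>"
  have N0: "N \<ge> 0" using f s0 by (simp add: N_def)
  have fs: "1 \<le> f / s" using f r0 l by (simp add: s_def field_simps)
  have cN: "real (card {-N..N}) \<le> 10 * (f / s)"
    using N0 of_int_floor_le[of "4 * f / s + 1/2"] fs unfolding N_def[symmetric] by simp
  let ?box = "\<lambda>j. light_box (\<theta> + of_int j * s) y (2 * l) (2 * l) (2 * r)"
  have "{x. near_light r l (x - y) \<and> norm (light_dir (x - y) - e) < 2 * f} \<subseteq> (\<Union>j\<in>{-N..N}. ?box j)"
  proof
    fix x assume "x \<in> {x. near_light r l (x - y) \<and> norm (light_dir (x - y) - e) < 2 * f}"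
    then have x: "near_light r l (x - y)" "norm (light_dir (x - y) - circ \<theta>) < 2 * f" by (auto simp: \<theta>)
    obtain \<alpha> where \<alpha>: "light_dir (x - y) = circ \<alpha>"
      using unit_vector_circ near_light_approx(2)[OF x(1) l] by blast
    obtain d where d: "circ \<alpha> = circ (\<theta> + d)" "\<bar>d\<bar> \<le> 4 * f"
      using circ_near[of \<alpha> \<theta> f] x(2) \<alpha> by auto
    define j where "j = round (d / s)"
    have j: "\<bar>d / s - of_int j\<bar> \<le> 1 / 2"
      using of_int_round_abs_le[of "d / s"] by (simp add: j_def abs_minus_commute)
    have "\<bar>d / s\<bar> \<le> 4 * f / s" using d(2) s0 by (simp add: abs_divide divide_right_mono)
    then have "\<bar>of_int j\<bar> \<le> 4 * f / s + 1/2" using j by linarith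
    then have jN: "j \<in> {-N..N}" unfolding N_def by (auto simp: abs_le_iff le_floor_iff minus_le_iff)
    have "\<bar>d - of_int j * s\<bar> = \<bar>d / s - of_int j\<bar> * s"
    proof -
      have "d - of_int j * s = (d / s - of_int j) * s" using s0 by (simp add: field_simps)
      then show ?thesis using s0 by (simp only: abs_mult abs_of_pos)
    qed
    also have "\<dots> \<le> 1 / 2 * s" using j s0 by (intro mult_right_mono) auto
    finally have "\<bar>d - of_int j * s\<bar> \<le> l / (2 * r)" by (simp add: s_def)
    moreover have "light_dir (x - y) = circ ((\<theta> + of_int j * s) + (d - of_int j * s))"
      using \<alpha> d(1) by simp
    ultimately have "y + (x - y) \<in> ?box j" by (intro light_box_of_direction[OF x(1) l])
    then show "x \<in> (\<Union>j\<in>{-N..N}. ?box j)" using jN by auto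
  qed
  then have "emeasure M {x. near_light r l (x - y) \<and> norm (light_dir (x - y) - e) < 2 * f}
     \<le> emeasure M (\<Union>j\<in>{-N..N}. ?box j)"
    by (intro emeasure_mono) auto
  also have "\<dots> \<le> (\<Sum>j\<in>{-N..N}. emeasure M (?box j))"
    by (intro emeasure_subadditive_finite) auto
  also have "\<dots> \<le> (\<Sum>j\<in>{-N..N}. ennreal (400 * (l * l) * t))"
  proof (rule sum_mono)
    fix j
    have "emeasure M (?box j) \<le> ennreal ((2 * (2 * l) + 2) * (2 * (2 * l) + 2) * (2 * (2 * r / R) + 2) * t)"
      using l r0 by (intro box_mass) auto
    also have "\<dots> \<le> ennreal ((6 * l) * (6 * l) * 10 * t)"
      using l t_pos R_pos r by (intro ennreal_leI mult_right_mono mult_mono) (auto simp: field_simps)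
    also have "\<dots> \<le> ennreal (400 * (l * l) * t)"
      using l t_pos by (intro ennreal_leI) simp
    finally show "emeasure M (?box j) \<le> ennreal (400 * (l * l) * t)" .
  qed
  also have "\<dots> = ennreal (real (card {-N..N}) * (400 * (l * l) * t))"
    using t_pos l by (simp add: ennreal_mult ennreal_of_nat_eq_real_of_nat)
  also have "\<dots> \<le> ennreal (10 * (f / s) * (400 * (l * l) * t))"
    using cN t_pos l by (intro ennreal_leI mult_right_mono) auto
  also have "10 * (f / s) * (400 * (l * l) * t) = 4000 * (l * f * r) * t"
    using l by (simp add: s_def)
  finally show ?thesis .
qed

end

section \<open>Common neighbours of a separated triple\<close>

definition separated3 :: "real \<Rightarrow> real \<Rightarrow> real \<Rightarrow> spacetime \<Rightarrow> spacetime \<Rightarrow> spacetime \<Rightarrow> spacetime \<Rightarrow> bool" where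
  "separated3 r l f x1 x2 x3 y \<longleftrightarrow>
     near_light r l (x1 - y) \<and> near_light r l (x2 - y) \<and> near_light r l (x3 - y) \<and>
     2 * f \<le> norm (light_dir (x2 - y) - light_dir (x1 - y)) \<and>
     2 * f \<le> norm (light_dir (x3 - y) - light_dir (x1 - y)) \<and>
     2 * f \<le> norm (light_dir (x3 - y) - light_dir (x2 - y))"

text \<open>The common neighbours of \<open>x 0\<close>, \<open>x 1\<close>, \<open>x 2\<close> are
  measured from one of them, \<open>y\<close>, and written \<open>y + z\<close>: then
  \<open>z = 0\<close> is one solution, and the three directions are those seen from
  \<open>y\<close>.\<close>

locale tangent_triple =
  fixes r l f :: real and x :: "nat \<Rightarrow> spacetime" and y
  assumes sep: "separated3 r l f (x 0) (x 1) (x 2) y"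
    and l: "1 \<le> l" "4 * l \<le> r" and f: "0 < f" "f\<^sup>2 * f\<^sup>2 * r = l"
begin

lemma r0: "r > 0" using l by linarith

lemma near: "i < 3 \<Longrightarrow> near_light r l (x i - y)"
  using sep by (auto simp: separated3_def numeral_3_eq_3 less_Suc_eq numeral_2_eq_2)

definition "ang i = (SOME \<theta>. light_dir (x i - y) = circ \<theta>)"

lemma ang: "light_dir (x i - y) = circ (ang i)" if "i < 3"
proof -
  have "\<exists>\<theta>. light_dir (x i - y) = circ \<theta>"
    using unit_vector_circ near_light_approx(2)[OF near[OF that] l] by blast
  then show ?thesis unfolding ang_def by (rule someI_ex)
qed

lemma ang_sep: "f \<le> \<bar>sin ((ang 1 - ang 0) / 2)\<bar>" "f \<le> \<bar>sin ((ang 2 - ang 0) / 2)\<bar>" "f \<le> \<bar>sin ((ang 1 - ang 2) / 2)\<bar>"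
  using sep unfolding separated3_def norm_minus_commute[of "light_dir (x 2 - y)" "light_dir (x 1 - y)"]
  by (simp_all add: ang[of 0, simplified] ang[of 1, simplified] ang[of 2, simplified] norm_circ_diff)

lemma f_le_1: "f \<le> 1" using ang_sep(1) abs_sin_le_one[of "(ang 1 - ang 0) / 2"] by linarith

definition "common z \<longleftrightarrow> (\<forall>i<3. near_light r l (x i - (y + z)))"

lemma common_constraint:
  assumes "common z" "i < 3"
  shows "\<bar>(fst z \<bullet> circ (ang i) - snd z) - mink z z / (2 * snd (x i - y))\<bar> \<le> 10 * l"
  using common_neighbour_constraint[OF near[OF assms(2)] _ l, of z] assms
  by (simp add: common_def ang diff_diff_eq)

lemma common_norm: assumes "common z" shows "norm z \<le> 4 * r"
proof -
  have "near_light r l (x 0 - (y + z))" using assms by (simp add: common_def)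
  then show ?thesis
    using near[of 0] norm_triangle_ineq4[of "x 0 - y" "x 0 - (y + z)"] unfolding near_light_def by simp
qed

lemma far_common_near:
  assumes "common z" "common w" and far: "100000000 * (l * r) < \<bar>mink z z\<bar>" "100000000 * (l * r) < \<bar>mink w w\<bar>"
  shows "\<bar>mink (w - z) (w - z)\<bar> \<le> 100000000 * (l * r)"
proof -
  \<comment> \<open>\<open>far_pair_near\<close> indexes its constraints by angle, so the time
    differences are transported from indices to angles; the separation makes the three angles
    distinct.\<close>
  define \<tau> where "\<tau> a = snd (x (if a = ang 0 then 0 else if a = ang 1 then 1 else 2) - y)" for a
  have ne: "ang 0 \<noteq> ang 1" "ang 0 \<noteq> ang 2" "ang 1 \<noteq> ang 2" using ang_sep f(1) by auto
  have \<tau>: "\<tau> (ang 0) = snd (x 0 - y)" "\<tau> (ang 1) = snd (x 1 - y)" "\<tau> (ang 2) = snd (x 2 - y)"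
    using ne ne[symmetric] by (simp_all add: \<tau>_def)
  have index: "\<exists>i<3. a = ang i \<and> \<tau> a = snd (x i - y)" if "a \<in> {ang 0, ang 1, ang 2}" for a
    using that
  proof (elim insertE emptyE)
    show "\<exists>i<3. a = ang i \<and> \<tau> a = snd (x i - y)" if "a = ang 0" using that \<tau>(1) by (intro exI[of _ 0]) simp
    show "\<exists>i<3. a = ang i \<and> \<tau> a = snd (x i - y)" if "a = ang 1" using that \<tau>(2) by (intro exI[of _ 1]) simp
    show "\<exists>i<3. a = ang i \<and> \<tau> a = snd (x i - y)" if "a = ang 2" using that \<tau>(3) by (intro exI[of _ 2]) simp
  qed
  show ?thesis
  proof (rule far_pair_near[where a = "ang 0" and b = "ang 1" and c = "ang 2" and \<tau> = \<tau> and f = f and l = l and r = r])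
    show "\<bar>fst z \<bullet> circ a - snd z - mink z z / (2 * \<tau> a)\<bar> \<le> 10 * l" if "a \<in> {ang 0, ang 1, ang 2}" for a
      using index[OF that] common_constraint[OF assms(1)] by metis
    show "\<bar>fst w \<bullet> circ a - snd w - mink w w / (2 * \<tau> a)\<bar> \<le> 10 * l" if "a \<in> {ang 0, ang 1, ang 2}" for a
      using index[OF that] common_constraint[OF assms(2)] by metis
    show "r / 2 \<le> \<bar>\<tau> a\<bar>" if "a \<in> {ang 0, ang 1, ang 2}" for a
      using index[OF that] near_light_approx(1)[OF near l] by metis
  qed (use ang_sep f l r0 far common_norm assms in auto)
qed

text \<open>For small \<open>mink z z\<close> the quadratic term is itself O(l), as the time
  differences are at least r/2, and three purely linear constraints with m = c l remain (10^8 + 10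
  is rounded up to c). The long side l/f^2 = f^2 r is enlarged to order r, which costs only a
  constant once r \<le> 2 R.\<close>

lemma near_common_box:
  assumes "common z" and nr: "\<bar>mink z z\<bar> \<le> 100000000 * (l * r)"
  defines "c \<equiv> 200000000"
  shows "y + z \<in> light_box (ang 0) y (4 * c * l / f) (c * l) (5 * c * r)"
proof -
  have H: "\<bar>fst z \<bullet> circ (ang i) - snd z\<bar> \<le> c * l" if i: "i < 3" for i
  proof -
    have s: "r / 2 \<le> \<bar>snd (x i - y)\<bar>" by (rule near_light_approx(1)[OF near[OF i] l])
    have "\<bar>mink z z / (2 * snd (x i - y))\<bar> \<le> 100000000 * (l * r) / r"
    proof -
      have "r \<le> \<bar>2 * snd (x i - y)\<bar>" unfolding abs_mult using s by simp
      then show ?thesis unfolding abs_divide using nr r0 by (intro frac_le) auto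
    qed
    then have "\<bar>mink z z / (2 * snd (x i - y))\<bar> \<le> 100000000 * l" using r0 by simp
    then show ?thesis using common_constraint[OF assms(1) i] l unfolding c_def by linarith
  qed
  have c0: "c > 0" by (simp add: c_def)
  note T = three_light_constraints[OF H H H f(1) ang_sep, simplified]
  have f2: "f\<^sup>2 \<le> 1" "f\<^sup>2 > 0" using f_le_1 f(1) by (simp_all add: power_le_one)
  have "c * l / f\<^sup>2 = c * (f\<^sup>2 * r)" using f by (simp add: field_simps flip: f(2))
  also have "\<dots> \<le> c * (1 * r)" using f2 r0 c0 by (intro mult_left_mono mult_right_mono) auto
  finally have k: "\<bar>fst z \<bullet> circ (ang 0)\<bar> \<le> 2 * (c * r)" using T(1) by (simp add: mult.assoc)
  have cl: "c * l \<le> c * r" using l c0 by simp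
  have "\<bar>fst z \<bullet> circ (ang 0) + snd z\<bar> \<le> 5 * c * r"
  proof -
    have "\<bar>fst z \<bullet> circ (ang 0) - snd z\<bar> \<le> c * l" using H[of 0] by simp
    moreover have "0 \<le> c * r" using c0 r0 by simp
    ultimately show ?thesis using k cl unfolding mult.assoc by linarith
  qed
  then have "\<bar>z \<bullet> frame_w (ang 0)\<bar> \<le> 5 * c * r"
    unfolding inner_frame by (rule order_trans[OF abs_divide_sqrt2_le])
  moreover have "\<bar>z \<bullet> frame_v (ang 0)\<bar> \<le> c * l"
    unfolding inner_frame using H[of 0] by (intro order_trans[OF abs_divide_sqrt2_le]) simp
  moreover have "\<bar>z \<bullet> frame_u (ang 0)\<bar> \<le> 4 * c * l / f"
    unfolding inner_frame using T(2) by (simp add: mult.assoc)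
  ultimately show ?thesis by (simp add: light_box_def)
qed

end


text \<open>Fix one common neighbour \<open>y0\<close>. Those near it lie in a box at
  \<open>y0\<close>. If some \<open>y1\<close> is far from \<open>y0\<close>, then by
  \<open>far_common_near\<close> everything far from \<open>y0\<close> is near \<open>y1\<close>,
  hence in a box at \<open>y1\<close>; otherwise one box suffices. A box of sides l/f, l, r has mass
  O(l^2 t / f).\<close>

lemma (in light_weight) separated3_mass:
  assumes l: "1 \<le> l" "4 * l \<le> r" and r: "r \<le> 2 * R" and f: "0 < f" "f\<^sup>2 * f\<^sup>2 * r = l"
  shows "emeasure M {y. separated3 r l f x1 x2 x3 y} \<le> ennreal (1760 * 200000000 ^ 3 * (l\<^sup>2 / f) * t)"
proof (cases "{y. separated3 r l f x1 x2 x3 y} = {}")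
  case False
  define x where "x i = (if i = 0 then x1 else if i = 1 then x2 else x3)" for i :: nat
  define S where "S = {y. separated3 r l f x1 x2 x3 y}"
  define c :: real where "c = 200000000"
  have T: "tangent_triple r l f x y" if "y \<in> S" for y
    using that l f by (simp add: tangent_triple_def S_def x_def)
  have com: "tangent_triple.common r l x y (z - y)" if "y \<in> S" "z \<in> S" for y z
    using tangent_triple.near[OF T[OF that(2)]] by (simp add: tangent_triple.common_def[OF T[OF that(1)]])
  define box where "box y = light_box (tangent_triple.ang x y 0) y (4 * c * l / f) (c * l) (5 * c * r)" for y
  have inbox: "z \<in> box y" if "y \<in> S" "z \<in> S" "\<bar>mink (z - y) (z - y)\<bar> \<le> 100000000 * (l * r)" for y z
    using tangent_triple.near_common_box[OF T[OF that(1)] com[OF that(1,2)] that(3)] by (simp add: box_def c_def)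
  obtain y0 where y0: "y0 \<in> S" using False by (auto simp: S_def)
  have f1: "f \<le> 1" by (rule tangent_triple.f_le_1[OF T[OF y0]])
  have "\<exists>y1\<in>S. S \<subseteq> box y0 \<union> box y1"
  proof (cases "\<exists>y1\<in>S. 100000000 * (l * r) < \<bar>mink (y1 - y0) (y1 - y0)\<bar>")
    case True
    then obtain y1 where y1: "y1 \<in> S" "100000000 * (l * r) < \<bar>mink (y1 - y0) (y1 - y0)\<bar>" by blast
    have "z \<in> box y0 \<union> box y1" if z: "z \<in> S" for z
    proof (cases "\<bar>mink (z - y0) (z - y0)\<bar> \<le> 100000000 * (l * r)")
      case False
      then have "\<bar>mink ((z - y0) - (y1 - y0)) ((z - y0) - (y1 - y0))\<bar> \<le> 100000000 * (l * r)"
        using y1 z y0 by (intro tangent_triple.far_common_near[OF T[OF y0] com com]) auto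
      then show ?thesis using inbox[OF y1(1) z] by simp
    qed (use inbox[OF y0 z] in auto)
    then show ?thesis using y1(1) by blast
  next
    case False
    then show ?thesis using inbox[OF y0] y0 by (intro bexI[of _ y0]) force+
  qed
  then obtain y1 where S: "S \<subseteq> box y0 \<union> box y1" by blast
  have mass: "emeasure M (box y) \<le> ennreal (880 * c ^ 3 * (l\<^sup>2 / f) * t)" for y
  proof -
    have c1: "c \<ge> 1" by (simp add: c_def)
    have cl: "1 \<le> c * l" using mult_mono[of 1 c 1 l] l c1 by simp
    have clf: "1 \<le> c * l / f" using cl f f1 by (simp add: pos_le_divide_eq)
    have "emeasure M (box y) \<le> ennreal ((2 * (4 * c * l / f) + 2) * (2 * (c * l) + 2) * (2 * (5 * c * r / R) + 2) * t)"
      unfolding box_def using cl clf c1 l by (intro box_mass) auto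
    also have "\<dots> \<le> ennreal ((10 * (c * l / f)) * (4 * (c * l)) * (22 * c) * t)"
    proof (intro ennreal_leI mult_right_mono mult_mono)
      have "c * r / R \<le> c * 2" using r R_pos c1 by (simp add: pos_divide_le_eq)
      then show "2 * (5 * c * r / R) + 2 \<le> 22 * c" using c1 by simp
      show "2 * (4 * c * l / f) + 2 \<le> 10 * (c * l / f)" using clf by simp
    qed (use clf cl c1 t_pos R_pos l f(1) in auto)
    \<comment> \<open>880 = 10 * 4 * 22, and c^3 collects one factor from each side; the second box
      doubles this to 1760.\<close>
    also have "(10 * (c * l / f)) * (4 * (c * l)) * (22 * c) * t = 880 * c ^ 3 * (l\<^sup>2 / f) * t"
      by (simp add: power2_eq_square power3_eq_cube)
    finally show ?thesis .
  qed
  have "emeasure M S \<le> emeasure M (box y0 \<union> box y1)"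
    using S by (rule emeasure_mono) (simp add: box_def)
  also have "\<dots> \<le> emeasure M (box y0) + emeasure M (box y1)"
    by (rule emeasure_subadditive) (simp_all add: box_def)
  also have "\<dots> \<le> ennreal (880 * c ^ 3 * (l\<^sup>2 / f) * t) + ennreal (880 * c ^ 3 * (l\<^sup>2 / f) * t)"
    by (intro add_mono mass)
  also have "\<dots> = ennreal (1760 * c ^ 3 * (l\<^sup>2 / f) * t)"
    using f t_pos by (subst ennreal_plus[symmetric]) (auto simp: c_def)
  finally show ?thesis by (simp add: S_def c_def)
next
  case True
  then show ?thesis by (simp only: emeasure_empty) simp
qed

section \<open>The incidence estimate\<close>

lemma ennreal_half_absorb:
  fixes g s I :: ennreal
  assumes "g \<le> s + I" "2 * s \<le> g" "g < \<infinity>"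
  shows "g \<le> 2 * I"
proof -
  have "g + g \<le> 2 * s + 2 * I"
    using add_mono[OF assms(1) assms(1)] by (simp add: mult_2 add_ac)
  also have "\<dots> \<le> g + 2 * I" using assms(2) by (rule add_right_mono)
  finally show ?thesis using assms(3) by (auto simp: ennreal_add_left_cancel_le)
qed

lemma near_light_minus: "near_light r l (- v) = near_light r l v"
  by (simp add: near_light_def mink_bilinear)

section \<open>Measurability of the light-like relation\<close>

lemma measurable_mink [measurable (raw)]:
  assumes "u \<in> borel_measurable N" "v \<in> borel_measurable N"
  shows "(\<lambda>x. mink (u x) (v x)) \<in> borel_measurable N"
proof -
  have [measurable]: "u \<in> N \<rightarrow>\<^sub>M borel \<Otimes>\<^sub>M borel" "v \<in> N \<rightarrow>\<^sub>M borel \<Otimes>\<^sub>M borel"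
    using assms by (simp_all add: borel_prod)
  show ?thesis unfolding mink_def by measurable
qed

lemma measurable_near_light [measurable (raw)]:
  assumes [measurable]: "u \<in> borel_measurable N"
  shows "Measurable.pred N (\<lambda>x. near_light r l (u x))"
  unfolding near_light_def by measurable

lemma measurable_light_dir [measurable (raw)]:
  assumes "u \<in> borel_measurable N"
  shows "(\<lambda>x. light_dir (u x)) \<in> borel_measurable N"
proof -
  have [measurable]: "u \<in> N \<rightarrow>\<^sub>M borel \<Otimes>\<^sub>M borel"
    using assms by (simp_all add: borel_prod)
  show ?thesis unfolding light_dir_def by measurable
qed

lemma measurable_separated3 [measurable (raw)]:
  assumes [measurable]: "u1 \<in> borel_measurable N" "u2 \<in> borel_measurable N" "u3 \<in> borel_measurable N" "v \<in> borel_measurable N"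
  shows "Measurable.pred N (\<lambda>x. separated3 r l f (u1 x) (u2 x) (u3 x) (v x))"
  unfolding separated3_def by measurable

lemma nn_integral_swap:
  assumes "sigma_finite_measure M" "sigma_finite_measure N"
    and "(\<lambda>(x, y). h x y) \<in> borel_measurable (M \<Otimes>\<^sub>M N)"
  shows "(\<integral>\<^sup>+x. \<integral>\<^sup>+y. h x y \<partial>N \<partial>M) = (\<integral>\<^sup>+y. \<integral>\<^sup>+x. h x y \<partial>M \<partial>N)"
proof -
  interpret pair_sigma_finite M N using assms(1,2) by (simp add: pair_sigma_finite_def)
  show ?thesis using Fubini'[OF assms(3)] by simp
qed

text \<open>Choose the three points in turn. The first is free, the second must avoid the sector of
  the first, the third the sectors of both. If a sector carries at most a quarter of the total, at
  least half of it remains at the second and at the third choice, so separated triples make up at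
  least a quarter of the cube.\<close>

lemma (in light_weight) triple_dichotomy:
  fixes w :: "spacetime \<Rightarrow> ennreal"
  assumes [measurable]: "w \<in> borel_measurable borel"
    and w: "\<And>x. w x \<noteq> 0 \<Longrightarrow> near_light r l (x - y)" and l: "1 \<le> l" "4 * l \<le> r"
    and sector: "\<And>e. norm e = 1 \<Longrightarrow> (\<integral>\<^sup>+x. w x * indicator {x. norm (light_dir (x - y) - e) < 2 * f} x \<partial>M) \<le> S"
    and g: "(\<integral>\<^sup>+x. w x \<partial>M) < \<infinity>"
  shows "(\<integral>\<^sup>+x. w x \<partial>M) \<le> 4 * S \<or>
    (\<integral>\<^sup>+x. w x \<partial>M) ^ 3 \<le> 4 * (\<integral>\<^sup>+x1. \<integral>\<^sup>+x2. \<integral>\<^sup>+x3. w x1 * w x2 * w x3 * of_bool (separated3 r l f x1 x2 x3 y) \<partial>M \<partial>M \<partial>M)"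
proof (rule disjCI)
  let ?W = "\<lambda>x1 x2 x3. w x1 * w x2 * w x3 * of_bool (separated3 r l f x1 x2 x3 y)"
  let ?G2 = "\<lambda>x1 x2. \<integral>\<^sup>+x3. ?W x1 x2 x3 \<partial>M"
  let ?G1 = "\<lambda>x1. \<integral>\<^sup>+x2. ?G2 x1 x2 \<partial>M"
  let ?G = "\<integral>\<^sup>+x1. ?G1 x1 \<partial>M"
  define g where "g = (\<integral>\<^sup>+x. w x \<partial>M)"
  assume "\<not> (\<integral>\<^sup>+x. w x \<partial>M) ^ 3 \<le> 4 * ?G"
  then have ng: "\<not> g ^ 3 \<le> 4 * ?G"
    by (simp add: g_def)
  show "(\<integral>\<^sup>+x. w x \<partial>M) \<le> 4 * S"
  proof (rule ccontr)
    assume "\<not> (\<integral>\<^sup>+x. w x \<partial>M) \<le> 4 * S"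
    then have S: "4 * S \<le> g" by (simp add: g_def)
    have "2 * S \<le> 4 * S" by (intro mult_right_mono) auto
    with S have S2: "2 * S \<le> g" by (rule order_trans[rotated])
    have gf: "g < \<infinity>" using g by (simp add: g_def)
    define D where "D x = light_dir (x - y)" for x
    have [measurable]: "D \<in> borel_measurable borel" unfolding D_def by measurable
    have D1: "norm (D x) = 1" if "w x \<noteq> 0" for x
      unfolding D_def by (rule near_light_approx(2)[OF w[OF that] l])
    define s where "s x x' \<longleftrightarrow> 2 * f \<le> norm (D x' - D x)" for x x'
    have sep: "of_bool (separated3 r l f x1 x2 x3 y) = (of_bool (s x1 x2) * of_bool (s x1 x3 \<and> s x2 x3) :: ennreal)"
      if "w x1 \<noteq> 0" "w x2 \<noteq> 0" "w x3 \<noteq> 0" for x1 x2 x3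
      using w[OF that(1)] w[OF that(2)] w[OF that(3)] by (auto simp: separated3_def s_def D_def indicator_def)
    have [measurable]: "Measurable.pred borel (\<lambda>x. s x1 x)" for x1 unfolding s_def by measurable
    define I2 where "I2 x1 = (\<integral>\<^sup>+x2. w x2 * of_bool (s x1 x2) \<partial>M)" for x1
    define I3 where "I3 x1 x2 = (\<integral>\<^sup>+x3. w x3 * of_bool (s x1 x3 \<and> s x2 x3) \<partial>M)" for x1 x2
    have I2: "g \<le> 2 * I2 x1" if "w x1 \<noteq> 0" for x1
    proof (rule ennreal_half_absorb[OF _ S2 gf])
      have "g \<le> (\<integral>\<^sup>+x. w x * indicator {x. norm (light_dir (x - y) - D x1) < 2 * f} x + w x * of_bool (s x1 x) \<partial>M)"
        unfolding g_def by (intro nn_integral_mono) (auto simp: s_def D_def indicator_def)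
      also have "\<dots> = (\<integral>\<^sup>+x. w x * indicator {x. norm (light_dir (x - y) - D x1) < 2 * f} x \<partial>M) + I2 x1"
        unfolding I2_def by (rule nn_integral_add) measurable
      also have "\<dots> \<le> S + I2 x1" by (intro add_right_mono sector D1 that)
      finally show "g \<le> S + I2 x1" .
    qed
    have I3: "g \<le> 2 * I3 x1 x2" if "w x1 \<noteq> 0" "w x2 \<noteq> 0" for x1 x2
    proof (rule ennreal_half_absorb[OF _ _ gf])
      let ?b = "\<lambda>x1 x. w x * indicator {x. norm (light_dir (x - y) - D x1) < 2 * f} x"
      have "g \<le> (\<integral>\<^sup>+x. (?b x1 x + ?b x2 x) + w x * of_bool (s x1 x \<and> s x2 x) \<partial>M)"
        unfolding g_def by (intro nn_integral_mono) (auto simp: s_def D_def indicator_def)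
      also have "\<dots> = (\<integral>\<^sup>+x. ?b x1 x + ?b x2 x \<partial>M) + I3 x1 x2"
        unfolding I3_def by (rule nn_integral_add) measurable
      also have "(\<integral>\<^sup>+x. ?b x1 x + ?b x2 x \<partial>M) = (\<integral>\<^sup>+x. ?b x1 x \<partial>M) + (\<integral>\<^sup>+x. ?b x2 x \<partial>M)"
        by (rule nn_integral_add) measurable
      also have "\<dots> \<le> S + S" by (intro add_mono sector D1 that)
      finally show "g \<le> 2 * S + I3 x1 x2" by (simp add: mult_2 add_right_mono)
      show "2 * (2 * S) \<le> g" using S by (simp add: mult.assoc[symmetric])
    qed
    have "g ^ 3 = g * g * (\<integral>\<^sup>+x1. w x1 \<partial>M)" by (simp add: power3_eq_cube g_def)
    also have "\<dots> = (\<integral>\<^sup>+x1. g * g * w x1 \<partial>M)" by (rule nn_integral_cmult[symmetric]) measurable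
    also have "\<dots> \<le> (\<integral>\<^sup>+x1. 4 * ?G1 x1 \<partial>M)"
    proof (rule nn_integral_mono)
      fix x1
      show "g * g * w x1 \<le> 4 * ?G1 x1"
      proof (cases "w x1 = 0")
        case False
        have "g * g * w x1 \<le> g * (2 * I2 x1) * w x1" by (intro mult_right_mono mult_left_mono I2 False) auto
        also have "\<dots> = 2 * (g * w x1 * I2 x1)" by (simp add: ac_simps)
        also have "g * w x1 * I2 x1 = (\<integral>\<^sup>+x2. g * w x1 * (w x2 * of_bool (s x1 x2)) \<partial>M)"
          unfolding I2_def by (rule nn_integral_cmult[symmetric]) measurable
        also have "\<dots> \<le> (\<integral>\<^sup>+x2. 2 * ?G2 x1 x2 \<partial>M)"
        proof (rule nn_integral_mono)
          fix x2
          show "g * w x1 * (w x2 * of_bool (s x1 x2)) \<le> 2 * ?G2 x1 x2"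
          proof (cases "w x2 = 0")
            case False
            have "g * w x1 * (w x2 * of_bool (s x1 x2)) \<le> (2 * I3 x1 x2) * w x1 * (w x2 * of_bool (s x1 x2))"
              by (intro mult_right_mono I3 False \<open>w x1 \<noteq> 0\<close>) auto
            also have "\<dots> = 2 * ((w x1 * w x2 * of_bool (s x1 x2)) * I3 x1 x2)" by (simp add: ac_simps)
            also have "(w x1 * w x2 * of_bool (s x1 x2)) * I3 x1 x2 =
                (\<integral>\<^sup>+x3. (w x1 * w x2 * of_bool (s x1 x2)) * (w x3 * of_bool (s x1 x3 \<and> s x2 x3)) \<partial>M)"
              unfolding I3_def by (rule nn_integral_cmult[symmetric]) measurable
            also have "\<dots> = ?G2 x1 x2"
            proof (rule nn_integral_cong)
              fix x3
              show "(w x1 * w x2 * of_bool (s x1 x2)) * (w x3 * of_bool (s x1 x3 \<and> s x2 x3)) =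
                  ?W x1 x2 x3"
                using sep[OF \<open>w x1 \<noteq> 0\<close> False, of x3] by (cases "w x3 = 0") (simp_all only: ac_simps, simp_all)
            qed
            finally show ?thesis .
          qed simp
        qed
        also have "\<dots> = 2 * ?G1 x1"
          by (rule nn_integral_cmult) measurable
        finally show ?thesis by (simp add: mult_left_mono mult.assoc[symmetric])
      qed simp
    qed
    also have "\<dots> = 4 * ?G"
      by (rule nn_integral_cmult) measurable
    finally show False using ng by simp
  qed
qed

text \<open>As \<open>m * r\<close> bounds the total mass, the L^1 norm of \<open>u\<close> is
  controlled by its L^2 norm, and this pays for the triple count, which is cubic in
  \<open>J\<close>. The constant depends on \<open>m\<close> and \<open>t\<close> through m^2/t^2,
  hence is uniform once \<open>t\<close> is bounded below.\<close>

lemma (in light_weight) local_bilinear: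
  fixes u :: "spacetime \<Rightarrow> real"
  assumes u [measurable]: "u \<in> borel_measurable borel" and u0: "\<And>x. 0 \<le> u x"
    and l: "1 \<le> l" "4 * l \<le> r" and r: "r \<le> 2 * R" and f: "0 < f" "f\<^sup>2 * f\<^sup>2 * r = l"
    and m: "m > 0" "emeasure M (space M) \<le> ennreal (m * r)"
  shows "(\<integral>\<^sup>+y. \<integral>\<^sup>+x. ennreal (u x * u y) * of_bool (near_light r l (x - y)) \<partial>M \<partial>M)
    \<le> ennreal (2 * (16002 + 4 * (1760 * 200000000 ^ 3) * m\<^sup>2 / t\<^sup>2) * (l * f * r * t)) * (\<integral>\<^sup>+x. ennreal ((u x)\<^sup>2) \<partial>M)"
proof -
  define P where "P = (1760 * 200000000 ^ 3 :: real)"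
  define A where "A = l * f * r * t"
  define N where "N = (\<integral>\<^sup>+x. ennreal ((u x)\<^sup>2) \<partial>M)"
  define J where "J = (\<integral>\<^sup>+x. ennreal (u x) \<partial>M)"
  define near where "near x y \<longleftrightarrow> near_light r l (x - y)" for x y
  have [measurable]: "Measurable.pred (borel \<Otimes>\<^sub>M borel) (\<lambda>p. near (fst p) (snd p))"
    unfolding near_def by measurable
  have [measurable]: "Measurable.pred borel (\<lambda>p. near p y)" "Measurable.pred borel (near y)" for y
    unfolding near_def by measurable
  have near_sym: "near x y = near y x" for x y
    unfolding near_def using near_light_minus[of r l "x - y"] by simp
  have r0: "r > 0" using l by linarith
  have A0: "A > 0" using l f r0 t_pos by (simp add: A_def)
  have P0: "P > 0" by (simp add: P_def)
  have f1: "f \<le> 1"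
  proof (rule ccontr)
    assume "\<not> f \<le> 1"
    then have "1 \<le> f\<^sup>2" by (simp add: one_le_power)
    then have "1 * 1 \<le> f\<^sup>2 * f\<^sup>2" by (intro mult_mono) auto
    then have "1 * r \<le> l" unfolding f(2)[symmetric] using r0 by (intro mult_right_mono) auto
    then show False using l by linarith
  qed
  have lfr: "l \<le> f * r"
  proof -
    have "f\<^sup>2 \<le> 1" using f1 f(1) by (simp add: power_le_one)
    then have "f\<^sup>2 * f\<^sup>2 \<le> f * 1" using f1 f(1) by (intro mult_mono) (auto simp: power2_eq_square mult_left_le)
    then show ?thesis unfolding f(2)[symmetric] using r0 by (intro mult_right_mono) auto
  qed
  have Jsq: "J\<^sup>2 \<le> N * ennreal (m * r)"
  proof -
    have "J\<^sup>2 \<le> (\<integral>\<^sup>+x. ennreal (u x) ^ 2 \<partial>M) * (\<integral>\<^sup>+x. 1 ^ 2 \<partial>M)"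
      unfolding J_def using Cauchy_Schwarz_nn_integral[of "\<lambda>x. ennreal (u x)" M "\<lambda>_. 1"] by simp
    also have "(\<integral>\<^sup>+x. ennreal (u x) ^ 2 \<partial>M) = N"
      unfolding N_def using u0 by (simp add: ennreal_power)
    also have "N * (\<integral>\<^sup>+x. 1 ^ 2 \<partial>M) \<le> N * ennreal (m * r)" using m by (intro mult_left_mono) auto
    finally show ?thesis .
  qed
  have all_le: "(\<integral>\<^sup>+y. \<integral>\<^sup>+x. ennreal (u x * u y) * of_bool (near x y) \<partial>M \<partial>M) \<le> J\<^sup>2"
  proof -
    have "(\<integral>\<^sup>+y. \<integral>\<^sup>+x. ennreal (u x * u y) * of_bool (near x y) \<partial>M \<partial>M) \<le> (\<integral>\<^sup>+y. \<integral>\<^sup>+x. ennreal (u y) * ennreal (u x) \<partial>M \<partial>M)"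
      using u0 by (intro nn_integral_mono) (auto simp: ennreal_mult mult.commute)
    also have "\<dots> = J\<^sup>2"
      by (simp add: nn_integral_cmult nn_integral_multc J_def power2_eq_square)
    finally show ?thesis .
  qed
  show ?thesis
  \<comment> \<open>Outside the two trivial cases the norm is a positive real, as the cut-off
    \<open>c\<close> below requires.\<close>
  proof (cases "N = \<infinity> \<or> N = 0")
    case True
    then show ?thesis
    proof
      assume "N = \<infinity>"
      moreover have q: "0 < 2 * (16002 + 4 * (1760 * 200000000 ^ 3) * m\<^sup>2 / t\<^sup>2) * (l * f * r * t)"
        using m t_pos by (intro mult_pos_pos[OF _ A0[unfolded A_def]] mult_pos_pos add_pos_nonneg) auto
      have "ennreal q * N = \<infinity>" if "q > 0" for q using that \<open>N = \<infinity>\<close> by (simp add: ennreal_mult_top)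
      from this[OF q] show ?thesis unfolding N_def by (simp only:) simp
    next
      assume "N = 0"
      then show ?thesis using all_le Jsq by (simp add: near_def)
    qed
  next
    case False
    then obtain \<nu> where \<nu>: "N = ennreal \<nu>" "\<nu> > 0"
      by (cases N) (auto simp: less_le)
    have "J \<noteq> \<infinity>" using Jsq \<nu> m r0 by (auto simp: ennreal_mult[symmetric] top_unique)
    then obtain j where j: "J = ennreal j" "j \<ge> 0" by (cases J) auto
    have jsq: "j\<^sup>2 \<le> m * r * \<nu>"
      using Jsq \<nu> m r0 j by (simp add: ennreal_power ennreal_mult[symmetric] mult.commute)
    \<comment> \<open>Cut-off for \<open>g\<close>: points with \<open>g y \<le> c\<close>
      contribute at most c^2 (m r) / A = A \<nu> in total, which is the target; larger values are
      handled by g^2 \<le> g^3 / c and the triple count.\<close>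
    define c where "c = sqrt (m * r * \<nu>) * A / (m * r)"
    have c0: "c > 0" using m r0 \<nu> A0 by (simp add: c_def)
    have c2: "c\<^sup>2 = \<nu> * A\<^sup>2 / (m * r)"
    proof -
      have "c\<^sup>2 = (m * r * \<nu>) * A\<^sup>2 / (m * r)\<^sup>2"
        unfolding c_def power_divide power_mult_distrib[of _ A] using m r0 \<nu> by simp
      then show ?thesis using m r0 by (simp add: power2_eq_square)
    qed
    have jc: "j ^ 3 / c \<le> (m * r)\<^sup>2 * \<nu> / A"
    proof -
      have "j \<le> sqrt (m * r * \<nu>)" using jsq by (simp add: real_le_rsqrt)
      then have "j ^ 3 \<le> sqrt (m * r * \<nu>) * (m * r * \<nu>)"
        unfolding power3_eq_cube using jsq j m r0 \<nu> mult_mono[of j "sqrt (m * r * \<nu>)" "j\<^sup>2" "m * r * \<nu>"]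
        by (simp add: power2_eq_square mult.assoc)
      then have "j ^ 3 / c \<le> sqrt (m * r * \<nu>) * (m * r * \<nu>) / c" using c0 by (intro divide_right_mono) auto
      also have "\<dots> = (m * r)\<^sup>2 * \<nu> / A"
      proof -
        have "s * (m * r * \<nu>) / (s * A / (m * r)) = (m * r)\<^sup>2 * \<nu> / A" if "s > 0" for s
          using that m r0 A0 by (simp add: power2_eq_square)
        then show ?thesis unfolding c_def using m r0 \<nu> by simp
      qed
      finally show ?thesis .
    qed
    define S where "S y = ennreal (u y * (4000 * A))" for y
    \<comment> \<open>The truncation \<open>u x \<le> u y\<close> bounds the weighted mass of a
      sector by \<open>u y\<close> times its \<open>M\<close>-mass, which makes the first
      alternative proportional to \<open>u y\<close>. By symmetry of the relation it costs a factor
      2 at the end.\<close>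
    define w where "w y x = ennreal (u x) * of_bool (near x y \<and> u x \<le> u y)" for x y
    define g where "g y = (\<integral>\<^sup>+x. w y x \<partial>M)" for y
    have [measurable]: "(\<lambda>p. w (fst p) (snd p)) \<in> borel_measurable (borel \<Otimes>\<^sub>M borel)"
      unfolding w_def near_def by measurable
    have [measurable]: "w y \<in> borel_measurable borel" for y unfolding w_def by measurable
    define G where "G y = (\<integral>\<^sup>+x1. \<integral>\<^sup>+x2. \<integral>\<^sup>+x3. ennreal (u x1) * ennreal (u x2) * ennreal (u x3) * of_bool (separated3 r l f x1 x2 x3 y) \<partial>M \<partial>M \<partial>M)" for y
    have [measurable]: "G \<in> borel_measurable borel" "g \<in> borel_measurable borel"
      unfolding G_def g_def by measurable
    have gJ: "g y \<le> J" for y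
      unfolding g_def J_def w_def by (intro nn_integral_mono) auto
    have dich: "g y \<le> 4 * S y \<or> g y ^ 3 \<le> 4 * G y" for y
    proof -
      have sec: "(\<integral>\<^sup>+x. w y x * indicator {x. norm (light_dir (x - y) - e) < 2 * f} x \<partial>M) \<le> S y" if e: "norm e = 1" for e
      proof -
        have "(\<integral>\<^sup>+x. w y x * indicator {x. norm (light_dir (x - y) - e) < 2 * f} x \<partial>M)
          \<le> (\<integral>\<^sup>+x. ennreal (u y) * indicator {x. near_light r l (x - y) \<and> norm (light_dir (x - y) - e) < 2 * f} x \<partial>M)"
          by (intro nn_integral_mono) (auto simp: w_def near_def indicator_def intro: ennreal_leI)
        also have "\<dots> = ennreal (u y) * emeasure M {x. near_light r l (x - y) \<and> norm (light_dir (x - y) - e) < 2 * f}"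
          by (rule nn_integral_cmult_indicator) measurable
        also have "\<dots> \<le> ennreal (u y) * ennreal (4000 * (l * f * r) * t)"
          by (intro mult_left_mono sector_mass l r f f1 lfr e) auto
        also have "\<dots> = S y" using A0 u0 by (simp add: S_def A_def ennreal_mult[symmetric] mult_ac)
        finally show ?thesis .
      qed
      have gf: "(\<integral>\<^sup>+x. w y x \<partial>M) < \<infinity>" using gJ[of y] j by (auto simp: g_def less_top[symmetric] top_unique)
      have "(\<integral>\<^sup>+x1. \<integral>\<^sup>+x2. \<integral>\<^sup>+x3. w y x1 * w y x2 * w y x3 * of_bool (separated3 r l f x1 x2 x3 y) \<partial>M \<partial>M \<partial>M) \<le> G y"
        unfolding G_def w_def by (intro nn_integral_mono) auto
      then have "4 * (\<integral>\<^sup>+x1. \<integral>\<^sup>+x2. \<integral>\<^sup>+x3. w y x1 * w y x2 * w y x3 * of_bool (separated3 r l f x1 x2 x3 y) \<partial>M \<partial>M \<partial>M) \<le> 4 * G y"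
        by (intro mult_left_mono) auto
      moreover have wn: "near_light r l (x - y)" if "w y x \<noteq> 0" for x
        using that by (auto simp: w_def near_def)
      moreover have "w y \<in> borel_measurable borel" by measurable
      ultimately show ?thesis
        using triple_dichotomy[of "w y" r l y f "S y", OF _ wn l sec gf] unfolding g_def
        by (meson order_trans)
    qed
    have Gint: "(\<integral>\<^sup>+y. G y \<partial>M) \<le> ennreal (P * (l\<^sup>2 / f) * t * j ^ 3)"
    proof -
      have sf: "sigma_finite_measure M" ..
      have "(\<integral>\<^sup>+y. G y \<partial>M) = (\<integral>\<^sup>+x1. \<integral>\<^sup>+y. \<integral>\<^sup>+x2. \<integral>\<^sup>+x3. ennreal (u x1) * ennreal (u x2) * ennreal (u x3) * of_bool (separated3 r l f x1 x2 x3 y) \<partial>M \<partial>M \<partial>M \<partial>M)"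
        unfolding G_def by (rule nn_integral_swap[OF sf sf]) measurable
      also have "\<dots> = (\<integral>\<^sup>+x1. \<integral>\<^sup>+x2. \<integral>\<^sup>+y. \<integral>\<^sup>+x3. ennreal (u x1) * ennreal (u x2) * ennreal (u x3) * of_bool (separated3 r l f x1 x2 x3 y) \<partial>M \<partial>M \<partial>M \<partial>M)"
        by (intro nn_integral_cong nn_integral_swap[OF sf sf]) measurable
      also have "\<dots> = (\<integral>\<^sup>+x1. \<integral>\<^sup>+x2. \<integral>\<^sup>+x3. \<integral>\<^sup>+y. ennreal (u x1) * ennreal (u x2) * ennreal (u x3) * of_bool (separated3 r l f x1 x2 x3 y) \<partial>M \<partial>M \<partial>M \<partial>M)"
        by (intro nn_integral_cong nn_integral_swap[OF sf sf]) measurable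
      also have "\<dots> \<le> (\<integral>\<^sup>+x1. \<integral>\<^sup>+x2. \<integral>\<^sup>+x3. ennreal (u x1) * ennreal (u x2) * ennreal (u x3) * ennreal (P * (l\<^sup>2 / f) * t) \<partial>M \<partial>M \<partial>M)"
      proof (intro nn_integral_mono)
        fix x1 x2 x3
        have "(\<integral>\<^sup>+y. ennreal (u x1) * ennreal (u x2) * ennreal (u x3) * of_bool (separated3 r l f x1 x2 x3 y) \<partial>M)
          = (\<integral>\<^sup>+y. ennreal (u x1) * ennreal (u x2) * ennreal (u x3) * indicator {y. separated3 r l f x1 x2 x3 y} y \<partial>M)"
          by (intro nn_integral_cong) (auto simp: indicator_def)
        also have "\<dots> = ennreal (u x1) * ennreal (u x2) * ennreal (u x3) * emeasure M {y. separated3 r l f x1 x2 x3 y}"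
          by (rule nn_integral_cmult_indicator) measurable
        also have "\<dots> \<le> ennreal (u x1) * ennreal (u x2) * ennreal (u x3) * ennreal (P * (l\<^sup>2 / f) * t)"
          unfolding P_def by (intro mult_left_mono separated3_mass l r f) auto
        finally show "(\<integral>\<^sup>+y. ennreal (u x1) * ennreal (u x2) * ennreal (u x3) * of_bool (separated3 r l f x1 x2 x3 y) \<partial>M)
          \<le> ennreal (u x1) * ennreal (u x2) * ennreal (u x3) * ennreal (P * (l\<^sup>2 / f) * t)" .
      qed
      also have "\<dots> = J * J * J * ennreal (P * (l\<^sup>2 / f) * t)"
        by (simp add: nn_integral_cmult nn_integral_multc J_def)
      also have "\<dots> = ennreal (P * (l\<^sup>2 / f) * t * j ^ 3)"
        using P0 f t_pos j by (simp add: ennreal_mult[symmetric] power3_eq_cube mult_ac)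
      finally show ?thesis .
    qed
    \<comment> \<open>In the first alternative \<open>g\<close> is itself O(A u). In the second,
      Young's inequality splits off A u^2 and leaves g^2 / A for the cut-off argument. Adding both
      bounds avoids splitting the domain of integration.\<close>
    have point: "ennreal (u y) * g y \<le> ennreal (16001 * A) * ennreal ((u y)\<^sup>2) + (ennreal (c\<^sup>2 / A) + ennreal (4 / (A * c)) * G y)" for y
    proof (cases "G y")
      case top
      then show ?thesis using A0 c0 by (simp add: ennreal_mult_top)
    next
      case (real \<Gamma>)
      have "g y \<noteq> \<infinity>" using gJ[of y] j by (auto simp: top_unique)
      then obtain \<gamma> where \<gamma>: "g y = ennreal \<gamma>" "\<gamma> \<ge> 0" by (cases "g y") auto
      have "u y * \<gamma> \<le> 16001 * A * (u y)\<^sup>2 + (c\<^sup>2 / A + 4 / (A * c) * \<Gamma>)"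
        using dich[of y]
      proof
        assume "g y \<le> 4 * S y"
        then have "\<gamma> \<le> 4 * (u y * (4000 * A))"
          using u0[of y] A0 unfolding \<gamma> S_def by (simp add: ennreal_mult'[symmetric] flip: ennreal_numeral)
        then have "u y * \<gamma> \<le> u y * (4 * (u y * (4000 * A)))" using u0 by (intro mult_left_mono) auto
        also have "\<dots> = 16000 * A * (u y)\<^sup>2" by (simp add: power2_eq_square)
        also have "\<dots> \<le> 16001 * A * (u y)\<^sup>2" using A0 by (intro mult_right_mono) auto
        finally show ?thesis using A0 c0 real(1) by (simp add: add_increasing2)
      next
        assume "g y ^ 3 \<le> 4 * G y"
        then have g3: "\<gamma> ^ 3 \<le> 4 * \<Gamma>"
          using \<gamma>(2) real(1) unfolding \<gamma> real(2) by (simp add: ennreal_power ennreal_mult'[symmetric] flip: ennreal_numeral)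
        have "\<gamma>\<^sup>2 \<le> c\<^sup>2 + 4 * \<Gamma> / c"
        proof (cases "\<gamma> \<le> c")
          case True
          then show ?thesis using \<gamma>(2) real(1) c0 by (simp add: power_mono add_increasing2)
        next
          case False
          then have "\<gamma>\<^sup>2 * c \<le> \<gamma>\<^sup>2 * \<gamma>" by (intro mult_left_mono) auto
          also have "\<dots> \<le> 4 * \<Gamma>" using g3 by (simp add: power3_eq_cube power2_eq_square)
          finally have "\<gamma>\<^sup>2 \<le> 4 * \<Gamma> / c" using c0 by (simp add: pos_le_divide_eq)
          then show ?thesis by (simp add: add_increasing)
        qed
        then have "\<gamma>\<^sup>2 / A \<le> (c\<^sup>2 + 4 * \<Gamma> / c) / A" using A0 by (intro divide_right_mono) auto
        moreover have "u y * \<gamma> \<le> A * (u y)\<^sup>2 + \<gamma>\<^sup>2 / A"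
        proof -
          have "0 \<le> (A * u y - \<gamma>)\<^sup>2" by simp
          then have "2 * (u y * \<gamma>) * A \<le> (A * (u y)\<^sup>2 + \<gamma>\<^sup>2 / A) * A"
            using A0 by (simp add: power2_eq_square algebra_simps)
          then have "2 * (u y * \<gamma>) \<le> A * (u y)\<^sup>2 + \<gamma>\<^sup>2 / A" using A0 by (simp only: mult_le_cancel_right_pos)
          moreover have "0 \<le> u y * \<gamma>" using u0 \<gamma> by simp
          ultimately show ?thesis by linarith
        qed
        moreover have "A * (u y)\<^sup>2 \<le> 16001 * A * (u y)\<^sup>2" using A0 by (intro mult_right_mono) auto
        moreover have "(c\<^sup>2 + 4 * \<Gamma> / c) / A = c\<^sup>2 / A + 4 / (A * c) * \<Gamma>" by (simp add: add_divide_distrib)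
        ultimately show ?thesis by linarith
      qed
      then have "ennreal (u y * \<gamma>) \<le> ennreal (16001 * A * (u y)\<^sup>2 + (c\<^sup>2 / A + 4 / (A * c) * \<Gamma>))" by (rule ennreal_leI)
      then show ?thesis
        using u0[of y] A0 c0 \<gamma>(2) real(1) unfolding \<gamma>(1) real(2)
        by (simp only: ennreal_mult[symmetric] ennreal_plus[symmetric] zero_le_power2 mult_nonneg_nonneg divide_nonneg_pos
            zero_le_numeral less_imp_le mult_pos_pos add_nonneg_nonneg)
    qed
    have half: "(\<integral>\<^sup>+y. ennreal (u y) * g y \<partial>M) \<le> ennreal ((16002 + 4 * P * m\<^sup>2 / t\<^sup>2) * A * \<nu>)"
    proof -
      have "(\<integral>\<^sup>+y. ennreal (u y) * g y \<partial>M)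
        \<le> (\<integral>\<^sup>+y. ennreal (16001 * A) * ennreal ((u y)\<^sup>2) + (ennreal (c\<^sup>2 / A) + ennreal (4 / (A * c)) * G y) \<partial>M)"
        by (intro nn_integral_mono point)
      also have "\<dots> = ennreal (16001 * A) * N + (ennreal (c\<^sup>2 / A) * emeasure M (space M) + ennreal (4 / (A * c)) * (\<integral>\<^sup>+y. G y \<partial>M))"
        by (simp add: nn_integral_add nn_integral_cmult N_def)
      also have "\<dots> \<le> ennreal (16001 * A) * ennreal \<nu> + (ennreal (c\<^sup>2 / A) * ennreal (m * r) + ennreal (4 / (A * c)) * ennreal (P * (l\<^sup>2 / f) * t * j ^ 3))"
        unfolding \<nu>(1) by (intro add_mono mult_left_mono m Gint order_refl) auto
      also have "\<dots> = ennreal (16001 * A * \<nu> + (c\<^sup>2 / A * (m * r) + 4 / (A * c) * (P * (l\<^sup>2 / f) * t * j ^ 3)))"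
        using A0 \<nu> c0 m r0 P0 f t_pos j by (simp add: ennreal_mult[symmetric] ennreal_plus[symmetric] del: ennreal_plus)
      also have "\<dots> \<le> ennreal ((16002 + 4 * P * m\<^sup>2 / t\<^sup>2) * A * \<nu>)"
      proof (rule ennreal_leI)
        have 1: "c\<^sup>2 / A * (m * r) = A * \<nu>" unfolding c2 using A0 m r0 by (simp add: power2_eq_square)
        have "4 / (A * c) * (P * (l\<^sup>2 / f) * t * j ^ 3) = 4 * P * (l\<^sup>2 / f) * t / A * (j ^ 3 / c)"
          by (simp add: mult_ac)
        also have "\<dots> \<le> 4 * P * (l\<^sup>2 / f) * t / A * ((m * r)\<^sup>2 * \<nu> / A)"
          using P0 f t_pos A0 by (intro mult_left_mono jc) auto
        also have "\<dots> = 4 * P * m\<^sup>2 * (l\<^sup>2 * t * r\<^sup>2 / (f * A ^ 3)) * A * \<nu>"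
          using A0 f by (simp add: field_simps power2_eq_square power3_eq_cube)
        \<comment> \<open>The balance behind \<open>f\<close>: the two cases agree up to 1 / (l t^2
          f^4 r), and f^4 r = l makes this at most 1/t^2.\<close>
        also have "l\<^sup>2 * t * r\<^sup>2 / (f * A ^ 3) = 1 / (l * t\<^sup>2) * (1 / (f\<^sup>2 * f\<^sup>2 * r))"
          using A0 f(1) l r0 t_pos by (simp add: A_def field_simps power2_eq_square power3_eq_cube)
        also have "\<dots> \<le> 1 / (1 * t\<^sup>2) * (1 / 1)"
          unfolding f(2) using l t_pos by (intro mult_mono divide_left_mono mult_right_mono) auto
        finally have "4 / (A * c) * (P * (l\<^sup>2 / f) * t * j ^ 3) \<le> 4 * P * m\<^sup>2 * (1 / (1 * t\<^sup>2) * (1 / 1)) * A * \<nu>"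
          using P0 A0 \<nu> by (simp add: mult_right_mono mult_left_mono)
        then show "16001 * A * \<nu> + (c\<^sup>2 / A * (m * r) + 4 / (A * c) * (P * (l\<^sup>2 / f) * t * j ^ 3)) \<le> (16002 + 4 * P * m\<^sup>2 / t\<^sup>2) * A * \<nu>"
          unfolding 1 by (simp add: algebra_simps)
      qed
      finally show ?thesis .
    qed
    have sf: "sigma_finite_measure M" ..
    have ug: "ennreal (u y) * g y = (\<integral>\<^sup>+x. ennreal (u x * u y) * of_bool (near x y \<and> u x \<le> u y) \<partial>M)" for y
    proof -
      have "ennreal (u y) * g y = (\<integral>\<^sup>+x. ennreal (u y) * w y x \<partial>M)"
        unfolding g_def by (rule nn_integral_cmult[symmetric]) measurable
      also have "\<dots> = (\<integral>\<^sup>+x. ennreal (u x * u y) * of_bool (near x y \<and> u x \<le> u y) \<partial>M)"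
        using u0 by (intro nn_integral_cong) (simp add: w_def ennreal_mult mult_ac)
      finally show ?thesis .
    qed
    \<comment> \<open>Every pair is charged to its endpoint with the larger value of
      \<open>u\<close>; ties are counted twice.\<close>
    have "(\<integral>\<^sup>+y. \<integral>\<^sup>+x. ennreal (u x * u y) * of_bool (near x y) \<partial>M \<partial>M)
      \<le> (\<integral>\<^sup>+y. \<integral>\<^sup>+x. ennreal (u x * u y) * of_bool (near x y \<and> u x \<le> u y) + ennreal (u y * u x) * of_bool (near y x \<and> u y \<le> u x) \<partial>M \<partial>M)"
      by (intro nn_integral_mono) (auto simp: near_sym mult.commute)
    also have "\<dots> = (\<integral>\<^sup>+y. \<integral>\<^sup>+x. ennreal (u x * u y) * of_bool (near x y \<and> u x \<le> u y) \<partial>M \<partial>M)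
        + (\<integral>\<^sup>+y. \<integral>\<^sup>+x. ennreal (u y * u x) * of_bool (near y x \<and> u y \<le> u x) \<partial>M \<partial>M)"
      unfolding near_def by (simp add: nn_integral_add)
    also have "(\<integral>\<^sup>+y. \<integral>\<^sup>+x. ennreal (u y * u x) * of_bool (near y x \<and> u y \<le> u x) \<partial>M \<partial>M) =
       (\<integral>\<^sup>+y. \<integral>\<^sup>+x. ennreal (u x * u y) * of_bool (near x y \<and> u x \<le> u y) \<partial>M \<partial>M)"
      unfolding near_def by (rule nn_integral_swap[OF sf sf]) measurable
    also have "(\<integral>\<^sup>+y. \<integral>\<^sup>+x. ennreal (u x * u y) * of_bool (near x y \<and> u x \<le> u y) \<partial>M \<partial>M) + (\<integral>\<^sup>+y. \<integral>\<^sup>+x. ennreal (u x * u y) * of_bool (near x y \<and> u x \<le> u y) \<partial>M \<partial>M)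
      \<le> ennreal ((16002 + 4 * P * m\<^sup>2 / t\<^sup>2) * A * \<nu>) + ennreal ((16002 + 4 * P * m\<^sup>2 / t\<^sup>2) * A * \<nu>)"
      using half unfolding ug by (intro add_mono)
    also have "\<dots> = ennreal (2 * (16002 + 4 * P * m\<^sup>2 / t\<^sup>2) * A) * N"
      using A0 P0 \<nu> by (simp add: ennreal_mult[symmetric] ennreal_plus[symmetric] algebra_simps del: ennreal_plus)
    finally show ?thesis unfolding near_def A_def P_def N_def by (simp only: mult.assoc)
  qed
qed

lemma emeasure_ball_double:
  fixes p q :: "spacetime"
  assumes "s \<ge> 0"
  shows "emeasure lborel (ball p (2 * s)) = 8 * emeasure lborel (ball q s)"
  using assms by (simp add: emeasure_ball power_mult_distrib ennreal_mult mult_ac)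

locale ball_light_weight = light_weight +
  fixes K :: real
  assumes K_pos: "K > 0" and ball_mass: "\<And>x s. s > 1 \<Longrightarrow> emeasure M (ball x s) \<le> ennreal (K * s)"
begin

text \<open>The mass bound of the local estimate is obtained by restricting to balls of radius \<open>4 r\<close> and averaging over their centres.\<close>

lemma near_light_bilinear:
  fixes u :: "spacetime \<Rightarrow> real"
  assumes u [measurable]: "u \<in> borel_measurable borel" and u0: "\<And>x. 0 \<le> u x"
    and l: "1 \<le> l" "4 * l \<le> r" and r: "r \<le> 2 * R" and f: "0 < f" "f\<^sup>2 * f\<^sup>2 * r = l"
  defines "C \<equiv> 16 * (16002 + 4 * (1760 * 200000000 ^ 3) * (4 * K)\<^sup>2 / t\<^sup>2)"
  shows "(\<integral>\<^sup>+y. \<integral>\<^sup>+x. ennreal (u x * u y) * of_bool (near_light r l (x - y)) \<partial>M \<partial>M)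
    \<le> ennreal (C * (l * f * r * t)) * (\<integral>\<^sup>+x. ennreal ((u x)\<^sup>2) \<partial>M)"
proof -
  have r0: "r > 1" using l by linarith
  have C0: "C > 0" unfolding C_def by (intro mult_pos_pos add_pos_nonneg) auto
  define q where "q = C / 8 * (l * f * r * t)"
  have q0: "q > 0" using C0 l f r0 t_pos by (simp add: q_def)
  define F where "F x y = ennreal (u x * u y) * of_bool (near_light r l (x - y))" for x y
  define B where "B = (\<integral>\<^sup>+y. \<integral>\<^sup>+x. F x y \<partial>M \<partial>M)"
  define N where "N = (\<integral>\<^sup>+x. ennreal ((u x)\<^sup>2) \<partial>M)"
  \<comment> \<open>A window of radius 4r: two points at distance at most 2r both lie in it whenever
    its centre is within 2r of the first. \<open>V\<close> below is the volume of these
    centres.\<close>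
  define b :: "spacetime \<Rightarrow> spacetime \<Rightarrow> ennreal" where "b p x = of_bool (dist p x < 4 * r)" for p x
  have [measurable]: "(\<lambda>p. F (fst p) (snd p)) \<in> borel_measurable (borel \<Otimes>\<^sub>M borel)"
    unfolding F_def by measurable
  have [measurable]: "(\<lambda>p. b (fst p) (snd p)) \<in> borel_measurable (borel \<Otimes>\<^sub>M borel)"
    unfolding b_def by measurable
  have [measurable]: "b p \<in> borel_measurable borel" for p unfolding b_def by measurable
  have local: "(\<integral>\<^sup>+y. \<integral>\<^sup>+x. b p y * (b p x * F x y) \<partial>M \<partial>M) \<le> ennreal q * (\<integral>\<^sup>+x. b p x * ennreal ((u x)\<^sup>2) \<partial>M)" for p
  proof -
    let ?M = "density M (b p)"
    have b1: "b p x \<le> 1" for x by (simp add: b_def)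
    have le: "emeasure ?M A \<le> emeasure M A" if "A \<in> sets borel" for A
    proof -
      have "emeasure ?M A = (\<integral>\<^sup>+x. b p x * indicator A x \<partial>M)" using that by (simp add: emeasure_density)
      also have "\<dots> \<le> (\<integral>\<^sup>+x. indicator A x \<partial>M)"
        using b1 by (intro nn_integral_mono) (auto simp: indicator_def)
      finally show ?thesis using that by simp
    qed
    interpret L: light_weight ?M R t
    proof (intro light_weight.intro light_weight_axioms.intro finite_measureI)
      show "emeasure ?M (space ?M) \<noteq> \<infinity>"
        using le[of UNIV] emeasure_finite[of UNIV] sets_eq_imp_space_eq[OF sets_M] by (auto simp: top_unique)
      show "emeasure ?M (light_box \<theta> c (1/2) (1/2) (R/2)) \<le> ennreal t" for \<theta> c
        using le[OF light_box_borel] tube_mass by (rule order_trans)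
      show "sets ?M = sets borel" by (simp only: sets_density sets_M)
    qed (fact R_pos, fact t_pos)
    have "emeasure ?M (space ?M) \<le> ennreal (K * (4 * r))"
    proof -
      have "emeasure ?M (space ?M) = (\<integral>\<^sup>+x. b p x \<partial>M)"
        using sets_eq_imp_space_eq[OF sets_M] by (subst emeasure_density) auto
      also have "\<dots> = (\<integral>\<^sup>+x. indicator (ball p (4 * r)) x \<partial>M)"
        by (intro nn_integral_cong) (auto simp: b_def indicator_def)
      also have "\<dots> = emeasure M (ball p (4 * r))" by simp
      also have "\<dots> \<le> ennreal (K * (4 * r))" using r0 by (intro ball_mass) auto
      finally show ?thesis .
    qed
    then have "(\<integral>\<^sup>+y. \<integral>\<^sup>+x. F x y \<partial>?M \<partial>?M) \<le> ennreal (2 * (16002 + 4 * (1760 * 200000000 ^ 3) * (4 * K)\<^sup>2 / t\<^sup>2) * (l * f * r * t)) * (\<integral>\<^sup>+x. ennreal ((u x)\<^sup>2) \<partial>?M)"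
      unfolding F_def using K_pos by (intro L.local_bilinear u u0 l r f) (simp_all add: mult_ac)
    moreover have "2 * (16002 + 4 * (1760 * 200000000 ^ 3) * (4 * K)\<^sup>2 / t\<^sup>2) = C / 8" by (simp add: C_def)
    ultimately have "(\<integral>\<^sup>+y. \<integral>\<^sup>+x. F x y \<partial>?M \<partial>?M) \<le> ennreal q * (\<integral>\<^sup>+x. ennreal ((u x)\<^sup>2) \<partial>?M)" by (simp only: q_def)
    moreover have "(\<integral>\<^sup>+y. \<integral>\<^sup>+x. F x y \<partial>?M \<partial>?M) = (\<integral>\<^sup>+y. \<integral>\<^sup>+x. b p y * (b p x * F x y) \<partial>M \<partial>M)"
    proof -
      have [measurable]: "(\<lambda>x. F x y) \<in> borel_measurable borel" for y unfolding F_def by measurable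
      have 1: "(\<integral>\<^sup>+x. F x y \<partial>?M) = (\<integral>\<^sup>+x. b p x * F x y \<partial>M)" for y
        by (rule nn_integral_density) (unfold F_def b_def, measurable)
      have 2: "(\<integral>\<^sup>+y. \<integral>\<^sup>+x. b p x * F x y \<partial>M \<partial>?M) = (\<integral>\<^sup>+y. b p y * (\<integral>\<^sup>+x. b p x * F x y \<partial>M) \<partial>M)"
        by (rule nn_integral_density) (unfold F_def b_def, measurable)
      have 3: "b p y * (\<integral>\<^sup>+x. b p x * F x y \<partial>M) = (\<integral>\<^sup>+x. b p y * (b p x * F x y) \<partial>M)" for y
        by (rule nn_integral_cmult[symmetric]) (unfold F_def b_def, measurable)
      show ?thesis by (simp only: 1 2 3)
    qed
    moreover have "(\<integral>\<^sup>+x. ennreal ((u x)\<^sup>2) \<partial>?M) = (\<integral>\<^sup>+x. b p x * ennreal ((u x)\<^sup>2) \<partial>M)"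
      by (simp add: nn_integral_density)
    ultimately show ?thesis by simp
  qed
  define V where "V = emeasure lborel (ball (0 :: spacetime) (2 * r))"
  have V: "V \<noteq> 0" "V \<noteq> \<infinity>"
    using r0 emeasure_lborel_ball_finite[of "0 :: spacetime" "2 * r"] unfolding V_def
    by (auto simp: emeasure_ball unit_ball_vol_pos less_imp_neq[symmetric])
  have sf: "sigma_finite_measure M" ..
  have sfl: "sigma_finite_measure (lborel :: spacetime measure)" ..
  have "V * B = (\<integral>\<^sup>+y. \<integral>\<^sup>+x. V * F x y \<partial>M \<partial>M)"
  proof -
    have 1: "(\<integral>\<^sup>+x. V * F x y \<partial>M) = V * (\<integral>\<^sup>+x. F x y \<partial>M)" for y
      by (rule nn_integral_cmult) (unfold F_def, measurable)
    have "(\<integral>\<^sup>+y. V * (\<integral>\<^sup>+x. F x y \<partial>M) \<partial>M) = V * B"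
      unfolding B_def by (rule nn_integral_cmult) (unfold F_def, measurable)
    then show ?thesis by (simp only: 1)
  qed
  also have "\<dots> \<le> (\<integral>\<^sup>+y. \<integral>\<^sup>+x. \<integral>\<^sup>+p. b p y * (b p x * F x y) \<partial>lborel \<partial>M \<partial>M)"
  proof (intro nn_integral_mono)
    fix x y
    show "V * F x y \<le> (\<integral>\<^sup>+p. b p y * (b p x * F x y) \<partial>lborel)"
    proof (cases "near_light r l (x - y)")
      case True
      have "V = emeasure lborel (ball x (2 * r))" unfolding V_def using r0 by (subst (1 2) emeasure_ball) auto
      then have "V * F x y = (\<integral>\<^sup>+p. indicator (ball x (2 * r)) p * F x y \<partial>lborel)"
        by (subst nn_integral_multc) (auto intro!: borel_measurable_indicator)
      also have "\<dots> \<le> (\<integral>\<^sup>+p. b p y * (b p x * F x y) \<partial>lborel)"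
      proof (intro nn_integral_mono)
        fix p
        have "b p x = 1 \<and> b p y = 1" if "dist x p < 2 * r"
          using that True dist_triangle[of p y x] r0 unfolding b_def near_light_def by (simp add: dist_norm norm_minus_commute)
        then show "indicator (ball x (2 * r)) p * F x y \<le> b p y * (b p x * F x y)"
          by (auto simp: indicator_def)
      qed
      finally show ?thesis .
    qed (simp add: F_def)
  qed
  also have "\<dots> = (\<integral>\<^sup>+y. \<integral>\<^sup>+p. \<integral>\<^sup>+x. b p y * (b p x * F x y) \<partial>M \<partial>lborel \<partial>M)"
    by (intro nn_integral_cong nn_integral_swap[OF sf sfl]) (unfold F_def b_def, measurable)
  also have "\<dots> = (\<integral>\<^sup>+p. \<integral>\<^sup>+y. \<integral>\<^sup>+x. b p y * (b p x * F x y) \<partial>M \<partial>M \<partial>lborel)"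
    by (rule nn_integral_swap[OF sf sfl]) (unfold F_def b_def, measurable)
  also have "\<dots> \<le> (\<integral>\<^sup>+p. ennreal q * (\<integral>\<^sup>+x. b p x * ennreal ((u x)\<^sup>2) \<partial>M) \<partial>lborel)"
    by (intro nn_integral_mono local)
  also have "\<dots> = ennreal q * (\<integral>\<^sup>+p. \<integral>\<^sup>+x. b p x * ennreal ((u x)\<^sup>2) \<partial>M \<partial>lborel)"
    by (rule nn_integral_cmult) (unfold F_def b_def, measurable)
  also have "(\<integral>\<^sup>+p. \<integral>\<^sup>+x. b p x * ennreal ((u x)\<^sup>2) \<partial>M \<partial>lborel) = (\<integral>\<^sup>+x. \<integral>\<^sup>+p. b p x * ennreal ((u x)\<^sup>2) \<partial>lborel \<partial>M)"
    by (rule nn_integral_swap[OF sfl sf]) (unfold F_def b_def, measurable)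
  \<comment> \<open>Conversely, the windows containing a given point have their centres in a ball of
    radius 4r, of volume 8 V. This overlap turns the 2 of \<open>local_bilinear\<close> into the 16
    of \<open>C\<close>.\<close>
  also have "\<dots> = (\<integral>\<^sup>+x. (8 * V) * ennreal ((u x)\<^sup>2) \<partial>M)"
  proof (rule nn_integral_cong)
    fix x
    have "(\<integral>\<^sup>+p. b p x * ennreal ((u x)\<^sup>2) \<partial>lborel) = (\<integral>\<^sup>+p. indicator (ball x (2 * (2 * r))) p * ennreal ((u x)\<^sup>2) \<partial>lborel)"
      by (intro nn_integral_cong) (auto simp: b_def indicator_def dist_commute)
    also have "\<dots> = emeasure lborel (ball x (2 * (2 * r))) * ennreal ((u x)\<^sup>2)" by (subst nn_integral_multc) (auto intro!: borel_measurable_indicator)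
    also have "emeasure lborel (ball x (2 * (2 * r))) = 8 * V" unfolding V_def using r0 by (intro emeasure_ball_double) auto
    finally show "(\<integral>\<^sup>+p. b p x * ennreal ((u x)\<^sup>2) \<partial>lborel) = (8 * V) * ennreal ((u x)\<^sup>2)" .
  qed
  also have "\<dots> = (8 * V) * N" unfolding N_def by (rule nn_integral_cmult) measurable
  also have "ennreal q * ((8 * V) * N) = V * ((ennreal 8 * ennreal q) * N)" by (simp add: mult_ac)
  finally have "V * B \<le> V * (ennreal (8 * q) * N)" using q0 by (simp only: ennreal_mult)
  then have "B \<le> ennreal (8 * q) * N"
    using V by (simp add: ennreal_mult_le_mult_iff)
  then show ?thesis by (simp add: B_def F_def N_def q_def mult.assoc)
qed

text \<open>Schur's test: \<open>u x * u y\<close> is at most the mean of the two squares, and each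
  square is integrated against a ball of mass at most K s.\<close>

lemma close_bilinear:
  fixes u :: "spacetime \<Rightarrow> real"
  assumes u [measurable]: "u \<in> borel_measurable borel" and u0: "\<And>x. 0 \<le> u x" and s: "s > 1"
  shows "(\<integral>\<^sup>+y. \<integral>\<^sup>+x. ennreal (u x * u y) * of_bool (norm (x - y) < s) \<partial>M \<partial>M)
    \<le> ennreal (K * s) * (\<integral>\<^sup>+x. ennreal ((u x)\<^sup>2) \<partial>M)"
proof -
  define N where "N = (\<integral>\<^sup>+x. ennreal ((u x)\<^sup>2) \<partial>M)"
  have sf: "sigma_finite_measure M" ..
  have 1: "(\<integral>\<^sup>+y. \<integral>\<^sup>+x. ennreal ((u y)\<^sup>2 / 2) * of_bool (norm (x - y) < s) \<partial>M \<partial>M) \<le> ennreal (K * s / 2) * N"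
  proof -
    have "(\<integral>\<^sup>+y. \<integral>\<^sup>+x. ennreal ((u y)\<^sup>2 / 2) * of_bool (norm (x - y) < s) \<partial>M \<partial>M) = (\<integral>\<^sup>+y. ennreal ((u y)\<^sup>2 / 2) * emeasure M (ball y s) \<partial>M)"
    proof (rule nn_integral_cong)
      fix y
      have "(\<integral>\<^sup>+x. ennreal ((u y)\<^sup>2 / 2) * of_bool (norm (x - y) < s) \<partial>M) = (\<integral>\<^sup>+x. ennreal ((u y)\<^sup>2 / 2) * indicator (ball y s) x \<partial>M)"
        by (intro nn_integral_cong) (auto simp: indicator_def dist_norm norm_minus_commute)
      also have "\<dots> = ennreal ((u y)\<^sup>2 / 2) * emeasure M (ball y s)" by (rule nn_integral_cmult_indicator) simp
      finally show "(\<integral>\<^sup>+x. ennreal ((u y)\<^sup>2 / 2) * of_bool (norm (x - y) < s) \<partial>M) = ennreal ((u y)\<^sup>2 / 2) * emeasure M (ball y s)" .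
    qed
    also have "\<dots> \<le> (\<integral>\<^sup>+y. ennreal ((u y)\<^sup>2 / 2) * ennreal (K * s) \<partial>M)"
      by (intro nn_integral_mono mult_left_mono ball_mass s) auto
    also have "\<dots> = (\<integral>\<^sup>+y. ennreal (K * s / 2) * ennreal ((u y)\<^sup>2) \<partial>M)"
      using K_pos s by (intro nn_integral_cong) (simp add: ennreal_mult[symmetric] mult_ac)
    also have "\<dots> = ennreal (K * s / 2) * N" unfolding N_def by (rule nn_integral_cmult) measurable
    finally show ?thesis .
  qed
  have "(\<integral>\<^sup>+y. \<integral>\<^sup>+x. ennreal (u x * u y) * of_bool (norm (x - y) < s) \<partial>M \<partial>M)
    \<le> (\<integral>\<^sup>+y. \<integral>\<^sup>+x. ennreal ((u x)\<^sup>2 / 2) * of_bool (norm (y - x) < s) + ennreal ((u y)\<^sup>2 / 2) * of_bool (norm (x - y) < s) \<partial>M \<partial>M)"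
  proof (intro nn_integral_mono)
    fix x y
    have "u x * u y \<le> (u x)\<^sup>2 / 2 + (u y)\<^sup>2 / 2" using sum_squares_bound[of "u x" "u y"] by simp
    then have "ennreal (u x * u y) \<le> ennreal ((u x)\<^sup>2 / 2) + ennreal ((u y)\<^sup>2 / 2)"
      by (simp add: ennreal_plus[symmetric] ennreal_leI del: ennreal_plus)
    then show "ennreal (u x * u y) * of_bool (norm (x - y) < s) \<le> ennreal ((u x)\<^sup>2 / 2) * of_bool (norm (y - x) < s) + ennreal ((u y)\<^sup>2 / 2) * of_bool (norm (x - y) < s)"
      by (simp add: norm_minus_commute)
  qed
  also have "\<dots> = (\<integral>\<^sup>+y. \<integral>\<^sup>+x. ennreal ((u x)\<^sup>2 / 2) * of_bool (norm (y - x) < s) \<partial>M \<partial>M)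
     + (\<integral>\<^sup>+y. \<integral>\<^sup>+x. ennreal ((u y)\<^sup>2 / 2) * of_bool (norm (x - y) < s) \<partial>M \<partial>M)"
    by (simp add: nn_integral_add)
  also have "(\<integral>\<^sup>+y. \<integral>\<^sup>+x. ennreal ((u x)\<^sup>2 / 2) * of_bool (norm (y - x) < s) \<partial>M \<partial>M) = (\<integral>\<^sup>+y. \<integral>\<^sup>+x. ennreal ((u y)\<^sup>2 / 2) * of_bool (norm (x - y) < s) \<partial>M \<partial>M)"
    by (rule nn_integral_swap[OF sf sf]) measurable
  also have "\<dots> + \<dots> \<le> ennreal (K * s / 2) * N + ennreal (K * s / 2) * N" by (intro add_mono 1)
  also have "\<dots> = ennreal (K * s) * N"
    using K_pos s by (simp add: distrib_right[symmetric] ennreal_plus[symmetric] del: ennreal_plus)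
  finally show ?thesis by (simp add: N_def)
qed

end

section \<open>Summation over dyadic scales\<close>

lemma dyadic_scale:
  fixes x :: real
  assumes "1 \<le> x"
  obtains n where "2 ^ n \<le> x" "x < 2 ^ Suc n"
proof -
  define m where "m = (LEAST m. x < 2 ^ m)"
  have ex: "\<exists>m. x < 2 ^ m" using real_arch_pow[of 2 x] by simp
  then have m: "x < 2 ^ m" unfolding m_def by (rule LeastI_ex)
  then have "m \<noteq> 0" using assms by (intro notI) simp
  then obtain n where n: "m = Suc n" by (cases m) auto
  then have "\<not> x < 2 ^ n" unfolding m_def using not_less_Least[of n "\<lambda>m. x < 2 ^ m"] by simp
  then show ?thesis using m n by (intro that[of n]) auto
qed

text \<open>This is \<open>|s^2 + |z'|^2|\<close> for \<open>z = (z', z_3)\<close> and \<open>s = 1 - i z_3\<close>.\<close>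

definition light_defect :: "spacetime \<Rightarrow> real" where
  "light_defect z = cmod (Complex (1 + mink z z) (- 2 * snd z))"

lemma light_defect_ge: "light_defect z \<ge> \<bar>1 + mink z z\<bar>" "light_defect z \<ge> 2 * \<bar>snd z\<bar>"
  using abs_Re_le_cmod[of "Complex (1 + mink z z) (- 2 * snd z)"] abs_Im_le_cmod[of "Complex (1 + mink z z) (- 2 * snd z)"]
  by (simp_all add: light_defect_def abs_mult)

text \<open>Two facts about the modulus of the explicit kernel: it is bounded, and it decays like
  |s| / |s^2 + |z'|^2|^(3/2), multiplied out and with |s| replaced by 1 + |z_3|.\<close>

locale cone_kernel =
  fixes \<kappa> :: "spacetime \<Rightarrow> real"
  assumes kernel_le_1: "\<kappa> z \<le> 1"
    and kernel_decay: "\<kappa> z * (light_defect z * sqrt (light_defect z)) \<le> 1 + \<bar>snd z\<bar>"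
begin

lemma kernel_le:
  assumes "norm z \<le> 2 * r" "1 \<le> r" "0 < w" "w \<le> light_defect z"
  shows "\<kappa> z \<le> 3 * r / (w * sqrt w)"
proof (cases "\<kappa> z \<le> 0")
  case True
  moreover have "0 \<le> 3 * r / (w * sqrt w)" using assms by simp
  ultimately show ?thesis by linarith
next
  case False
  have "\<bar>snd z\<bar> \<le> norm z" using norm_snd_le[of "snd z" "fst z"] by simp
  then have "1 + \<bar>snd z\<bar> \<le> 3 * r" using assms by linarith
  moreover have "\<kappa> z * (w * sqrt w) \<le> \<kappa> z * (light_defect z * sqrt (light_defect z))"
    using False assms by (intro mult_left_mono mult_mono) auto
  ultimately have "\<kappa> z * (w * sqrt w) \<le> 3 * r" using kernel_decay[of z] by linarith
  then show ?thesis using assms by (simp add: pos_le_divide_eq)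
qed

text \<open>If \<open>mink z z\<close> has size l r, so has the real part of the defect, and 3r / (l
  r / 4)^(3/2) = 24 r^(-1/2) l^(-3/2). Once l exceeds r/4 the point is away from the cone and the
  bound becomes 192/r^2; such points are left to the ball condition.\<close>

lemma kernel_dyadic:
  assumes r: "4 \<le> r" "r \<le> norm z" "norm z < 2 * r"
  shows "(\<exists>j. 4 * 2 ^ j \<le> r \<and> near_light r (2 ^ j) z \<and> \<kappa> z \<le> 24 / (sqrt r * (2 ^ j * sqrt (2 ^ j)))) \<or> \<kappa> z \<le> 192 / r\<^sup>2"
proof (cases "\<bar>mink z z\<bar> \<le> r")
  case True
  then have n: "near_light r (2 ^ 0) z" using r by (simp add: near_light_def)
  \<comment> \<open>Next to the cone the real part 1 + \<open>mink z z\<close> may vanish; there the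
    imaginary part, of size at least r, bounds the defect from below.\<close>
  have "r / 2 \<le> \<bar>snd z\<bar>" using near_light_approx(1)[OF n] r by simp
  then have "\<kappa> z \<le> 3 * r / (r * sqrt r)" using light_defect_ge(2)[of z] r by (intro kernel_le) auto
  also have "\<dots> \<le> 24 / (sqrt r * (2 ^ 0 * sqrt (2 ^ 0)))" using r by (simp add: divide_right_mono)
  finally show ?thesis using n r by (intro disjI1 exI[of _ 0]) auto
next
  case False
  define q where "q = \<bar>mink z z\<bar> / r"
  have "1 < q" using False r by (simp add: q_def)
  then obtain n where n: "2 ^ n \<le> q" "q < 2 ^ Suc n" using dyadic_scale[of q] by auto
  define l where "l = (2 :: real) ^ Suc n"
  have l2: "2 \<le> l" by (simp add: l_def)
  have lq: "l * r / 2 \<le> \<bar>mink z z\<bar>" "\<bar>mink z z\<bar> \<le> l * r"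
    using n r by (auto simp: q_def l_def field_simps)
  have lr: "8 \<le> l * r" using mult_mono[of 2 l 4 r] l2 r by simp
  have W: "l * r / 4 \<le> light_defect z"
    using light_defect_ge(1)[of z] lq(1) lr by linarith
  have k: "\<kappa> z \<le> 3 * r / ((l * r / 4) * sqrt (l * r / 4))"
    using W lr r by (intro kernel_le) auto
  also have "\<dots> = 24 / (sqrt r * (l * sqrt l))"
    using r l2 by (simp add: real_sqrt_mult real_sqrt_divide field_simps)
  finally have k: "\<kappa> z \<le> 24 / (sqrt r * (l * sqrt l))" .
  show ?thesis
  proof (cases "4 * l \<le> r")
    case True
    then show ?thesis using k lq r by (intro disjI1 exI[of _ "Suc n"]) (auto simp: near_light_def l_def)
  next
    case False
    then have "r / 4 \<le> l" by simp
    then have "(r / 4) * sqrt (r / 4) \<le> l * sqrt l" using r by (intro mult_mono) auto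
    then have "sqrt r * ((r / 4) * sqrt (r / 4)) \<le> sqrt r * (l * sqrt l)" using r by (intro mult_left_mono) auto
    moreover have "sqrt r * ((r / 4) * sqrt (r / 4)) = r\<^sup>2 / 8"
      using r by (simp add: real_sqrt_divide power2_eq_square)
    ultimately have "r\<^sup>2 / 8 \<le> sqrt r * (l * sqrt l)" by (simp only:)
    then have "24 / (sqrt r * (l * sqrt l)) \<le> 24 / (r\<^sup>2 / 8)" using r by (intro frac_le) auto
    then show ?thesis using k by simp
  qed
qed

definition near_term :: "nat \<Rightarrow> nat \<Rightarrow> spacetime \<Rightarrow> real" where
  "near_term i j z = 24 / (sqrt (2 ^ i) * (2 ^ j * sqrt (2 ^ j))) * of_bool (4 * 2 ^ j \<le> (2 ^ i :: real) \<and> near_light (2 ^ i) (2 ^ j) z)"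

definition far_term :: "nat \<Rightarrow> spacetime \<Rightarrow> real" where
  "far_term i z = 192 / (2 ^ i)\<^sup>2 * of_bool (norm z < 2 * 2 ^ i)"

lemma near_term_nonneg: "0 \<le> near_term i j z" by (simp add: near_term_def)
lemma far_term_nonneg: "0 \<le> far_term i z" by (simp add: far_term_def)

lemma kernel_majorant:
  assumes z: "norm z < 2 ^ Suc n"
  shows "\<kappa> z \<le> of_bool (norm z < 4) + (\<Sum>i=2..n. \<Sum>j\<le>n. near_term i j z) + (\<Sum>i=2..n. far_term i z)"
proof (cases "norm z < 4")
  case True
  moreover have "0 \<le> (\<Sum>i=2..n. \<Sum>j\<le>n. near_term i j z)" "0 \<le> (\<Sum>i=2..n. far_term i z)"
    by (intro sum_nonneg near_term_nonneg far_term_nonneg)+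
  ultimately show ?thesis using kernel_le_1[of z] by simp
next
  case False
  then obtain i where i: "2 ^ i \<le> norm z" "norm z < 2 ^ Suc i" using dyadic_scale[of "norm z"] by auto
  have "(2 :: real) ^ 2 < 2 ^ Suc i" using False i by simp
  then have i2: "2 \<le> i" by (subst (asm) power_strict_increasing_iff) auto
  have "(2 :: real) ^ i < 2 ^ Suc n" using z i by linarith
  then have i_n: "i \<le> n" by (subst (asm) power_strict_increasing_iff) auto
  have "(2 :: real) ^ 2 \<le> 2 ^ i" using i2 by (intro power_increasing) auto
  then have i4: "(4 :: real) \<le> 2 ^ i" by simp
  have near0: "0 \<le> (\<Sum>i=2..n. \<Sum>j\<le>n. near_term i j z)" and far0: "0 \<le> (\<Sum>i=2..n. far_term i z)"
    by (intro sum_nonneg near_term_nonneg far_term_nonneg)+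
  have "norm z < 2 * 2 ^ i" using i by simp
  from kernel_dyadic[OF i4 i(1) this] show ?thesis
  proof (elim disjE exE conjE)
    fix j assume j: "4 * 2 ^ j \<le> (2 :: real) ^ i" "near_light (2 ^ i) (2 ^ j) z"
      and k: "\<kappa> z \<le> 24 / (sqrt (2 ^ i) * (2 ^ j * sqrt (2 ^ j)))"
    have "(2 :: real) ^ j \<le> 2 ^ i" using j(1) by (smt (verit) zero_le_power)
    then have "j \<le> n" using i_n by (subst (asm) power_increasing_iff) auto
    have "\<kappa> z \<le> near_term i j z" using j k by (simp add: near_term_def)
    also have "\<dots> \<le> (\<Sum>j\<le>n. near_term i j z)"
      using \<open>j \<le> n\<close> by (intro member_le_sum near_term_nonneg) auto
    also have "\<dots> \<le> (\<Sum>i=2..n. \<Sum>j\<le>n. near_term i j z)"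
      using i2 i_n by (intro member_le_sum[where f = "\<lambda>i. \<Sum>j\<le>n. near_term i j z"] sum_nonneg near_term_nonneg) auto
    finally show ?thesis using far0 by simp
  next
    assume "\<kappa> z \<le> 192 / (2 ^ i)\<^sup>2"
    then have "\<kappa> z \<le> far_term i z" using i by (simp add: far_term_def)
    also have "\<dots> \<le> (\<Sum>i=2..n. far_term i z)"
      using i2 i_n by (intro member_le_sum far_term_nonneg) auto
    finally show ?thesis using near0 by simp
  qed
qed

end

text \<open>A near term costs r^(-1/2) l^(-3/2) times l r (l/r)^(1/4) t, that is (r/l)^(1/4) t, at
  most (2R)^(1/4) t, and there are O(log^2 R) of them. Close and far terms come from the ball
  condition alone and carry no \<open>t\<close>; the lower bound \<open>c\<close> on
  \<open>t\<close> charges them to t/c (388 = 4 + 384). It also makes the constants of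
  \<open>near_light_bilinear\<close> uniform in \<open>t\<close>.\<close>

lemma (in ball_light_weight) kernel_bilinear:
  fixes u :: "spacetime \<Rightarrow> real"
  assumes "cone_kernel \<kappa>" and [measurable]: "\<kappa> \<in> borel_measurable borel"
    and u [measurable]: "u \<in> borel_measurable borel" and u0: "\<And>x. 0 \<le> u x"
    and supp: "\<And>x. u x \<noteq> 0 \<Longrightarrow> x \<in> ball a R" and R1: "R > 1" and c: "c > 0" "c \<le> t"
  defines "C \<equiv> 16 * (16002 + 4 * (1760 * 200000000 ^ 3) * (4 * K)\<^sup>2 / c\<^sup>2)"
  shows "(\<integral>\<^sup>+y. \<integral>\<^sup>+x. ennreal (\<kappa> (x - y)) * ennreal (u x * u y) \<partial>M \<partial>M)
    \<le> ennreal ((388 * K / c + 24 * C) * (1 + log 2 (2 * R))\<^sup>2 * sqrt (sqrt (2 * R)) * t) * (\<integral>\<^sup>+x. ennreal ((u x)\<^sup>2) \<partial>M)"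
proof -
  interpret cone_kernel \<kappa> by fact
  define N where "N = (\<integral>\<^sup>+x. ennreal ((u x)\<^sup>2) \<partial>M)"
  define S where "S = sqrt (sqrt (2 * R))"
  have S1: "S \<ge> 1" using R1 by (simp add: S_def)
  have C0: "C > 0" unfolding C_def by (intro mult_pos_pos add_pos_nonneg) auto
  obtain n where n: "2 ^ n \<le> 2 * R" "2 * R < 2 ^ Suc n" using dyadic_scale[of "2 * R"] R1 by auto
  have nlog: "real n \<le> log 2 (2 * R)" using n(1) R1 by (simp add: le_log_iff powr_realpow)
  have [measurable]: "near_term i j \<in> borel_measurable borel" "far_term i \<in> borel_measurable borel" for i j
    unfolding near_term_def far_term_def by measurable
  define U where "U x y = ennreal (u x * u y)" for x y
  have near: "(\<integral>\<^sup>+y. \<integral>\<^sup>+x. ennreal (near_term i j (x - y)) * U x y \<partial>M \<partial>M) \<le> ennreal (24 * C * S * t) * N"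
    if "i \<le> n" for i j
  proof (cases "4 * 2 ^ j \<le> (2 ^ i :: real)")
    case True
    \<comment> \<open>Fourth roots, so that the angle (l/r)^(1/4) is \<open>p / q\<close> and all
      powers of l and r are polynomial in \<open>p\<close> and \<open>q\<close>.\<close>
    define p where "p = sqrt (sqrt (2 ^ j :: real))"
    define q where "q = sqrt (sqrt (2 ^ i :: real))"
    have p: "p \<ge> 1" "sqrt (2 ^ j) = p\<^sup>2" "2 ^ j = p\<^sup>2 * p\<^sup>2"
      by (simp_all add: p_def)
    have q: "q \<ge> 1" "sqrt (2 ^ i) = q\<^sup>2" "2 ^ i = q\<^sup>2 * q\<^sup>2"
      by (simp_all add: q_def)
    have iR: "(2 :: real) ^ i \<le> 2 * R" using n(1) power_increasing[OF that, of "2 :: real"] by linarith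
    then have qS: "q \<le> S" by (simp add: q_def S_def)
    have pq: "0 < p / q" "(p / q)\<^sup>2 * (p / q)\<^sup>2 * 2 ^ i = 2 ^ j"
      using p(1) q(1) by (simp_all add: p(3) q(3) power_divide)
    define b where "b = 24 / (sqrt (2 ^ i) * (2 ^ j * sqrt (2 ^ j)) :: real)"
    have b0: "b \<ge> 0" by (simp add: b_def)
    let ?near = "\<lambda>x y. U x y * of_bool (near_light (2 ^ i) (2 ^ j) (x - y))"
    have [measurable]: "(\<lambda>p. ?near (fst p) (snd p)) \<in> borel_measurable (borel \<Otimes>\<^sub>M borel)"
      unfolding U_def by measurable
    have "(\<integral>\<^sup>+y. \<integral>\<^sup>+x. ennreal (near_term i j (x - y)) * U x y \<partial>M \<partial>M) = (\<integral>\<^sup>+y. \<integral>\<^sup>+x. ennreal b * ?near x y \<partial>M \<partial>M)"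
      using True by (intro nn_integral_cong) (simp add: near_term_def b_def)
    also have "\<dots> = (\<integral>\<^sup>+y. ennreal b * (\<integral>\<^sup>+x. ?near x y \<partial>M) \<partial>M)"
      by (intro nn_integral_cong nn_integral_cmult) (unfold U_def, measurable)
    also have "\<dots> = ennreal b * (\<integral>\<^sup>+y. \<integral>\<^sup>+x. ?near x y \<partial>M \<partial>M)"
      by (rule nn_integral_cmult) (unfold U_def, measurable)
    also have "\<dots> \<le> ennreal b * (ennreal (16 * (16002 + 4 * (1760 * 200000000 ^ 3) * (4 * K)\<^sup>2 / t\<^sup>2) * (2 ^ j * (p / q) * 2 ^ i * t)) * N)"
      unfolding U_def N_def using u0 True iR pq by (intro mult_left_mono near_light_bilinear) auto
    also have "\<dots> \<le> ennreal b * (ennreal (C * (2 ^ j * (p / q) * 2 ^ i * t)) * N)"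
    proof (intro mult_left_mono mult_right_mono ennreal_leI)
      have "(4 * K)\<^sup>2 / t\<^sup>2 \<le> (4 * K)\<^sup>2 / c\<^sup>2" using c by (intro divide_left_mono power_mono) auto
      then show "16 * (16002 + 4 * (1760 * 200000000 ^ 3) * (4 * K)\<^sup>2 / t\<^sup>2) \<le> C"
        unfolding C_def by (intro mult_left_mono add_left_mono) (simp_all add: mult_left_mono)
      show "0 \<le> 2 ^ j * (p / q) * 2 ^ i * t" using t_pos by (intro mult_nonneg_nonneg less_imp_le[OF pq(1)]) auto
    qed auto
    also have "\<dots> = ennreal (b * (C * (2 ^ j * (p / q) * 2 ^ i * t))) * N"
    proof -
      have e0: "0 \<le> C * (2 ^ j * (p / q) * 2 ^ i * t)"
        using t_pos by (intro mult_nonneg_nonneg less_imp_le[OF pq(1)] less_imp_le[OF C0]) auto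
      show ?thesis unfolding ennreal_mult[OF b0 e0] by (rule mult.assoc[symmetric])
    qed
    also have "\<dots> \<le> ennreal (24 * C * S * t) * N"
    proof (intro mult_right_mono ennreal_leI)
      have "b * (C * (2 ^ j * (p / q) * 2 ^ i * t)) = 24 * C * (q / p) * t"
      proof -
        have "b = 24 / (q\<^sup>2 * (2 ^ j * p\<^sup>2))" unfolding b_def p(2) q(2) ..
        then show ?thesis unfolding p(3) q(3) using p(1) q(1) by (simp add: power2_eq_square)
      qed
      also have "\<dots> \<le> 24 * C * S * t"
      proof (intro mult_left_mono mult_right_mono)
        have "q / p \<le> q" using p(1) q(1) by (simp add: divide_le_eq mult_le_cancel_left1)
        then show "q / p \<le> S" using qS by linarith
      qed (use C0 t_pos in auto)
      finally show "b * (C * (2 ^ j * (p / q) * 2 ^ i * t)) \<le> 24 * C * S * t" .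
    qed auto
    finally show ?thesis .
  qed (simp add: near_term_def)
  have close: "(\<integral>\<^sup>+y. \<integral>\<^sup>+x. U x y * of_bool (norm (x - y) < s) \<partial>M \<partial>M) \<le> ennreal (K * s) * N" if "s > 1" for s
    unfolding U_def N_def using u0 that by (intro close_bilinear) auto
  have far: "(\<integral>\<^sup>+y. \<integral>\<^sup>+x. ennreal (far_term i (x - y)) * U x y \<partial>M \<partial>M) \<le> ennreal (384 * K) * N" for i
  proof -
    let ?near = "\<lambda>x y. U x y * of_bool (norm (x - y) < 2 * 2 ^ i)"
    have "(\<integral>\<^sup>+y. \<integral>\<^sup>+x. ennreal (far_term i (x - y)) * U x y \<partial>M \<partial>M) = (\<integral>\<^sup>+y. \<integral>\<^sup>+x. ennreal (192 / (2 ^ i)\<^sup>2) * ?near x y \<partial>M \<partial>M)"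
      by (intro nn_integral_cong) (simp add: far_term_def)
    also have "\<dots> = (\<integral>\<^sup>+y. ennreal (192 / (2 ^ i)\<^sup>2) * (\<integral>\<^sup>+x. ?near x y \<partial>M) \<partial>M)"
      by (intro nn_integral_cong nn_integral_cmult) (unfold U_def, measurable)
    also have "\<dots> = ennreal (192 / (2 ^ i)\<^sup>2) * (\<integral>\<^sup>+y. \<integral>\<^sup>+x. ?near x y \<partial>M \<partial>M)"
      by (rule nn_integral_cmult) (unfold U_def, measurable)
    also have "\<dots> \<le> ennreal (192 / (2 ^ i)\<^sup>2) * (ennreal (K * (2 * 2 ^ i)) * N)"
    proof (intro mult_left_mono close)
      have "(1 :: real) \<le> 2 ^ i" by simp
      then show "(1 :: real) < 2 * 2 ^ i" by linarith
    qed simp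
    also have "\<dots> = ennreal (192 / (2 ^ i)\<^sup>2 * (K * (2 * 2 ^ i))) * N"
    proof -
      have e0: "0 \<le> K * (2 * 2 ^ i)" "0 \<le> (192 / (2 ^ i)\<^sup>2 :: real)" using K_pos by auto
      show ?thesis unfolding ennreal_mult[OF e0(2,1)] by (rule mult.assoc[symmetric])
    qed
    also have "\<dots> \<le> ennreal (384 * K) * N"
    proof (intro mult_right_mono ennreal_leI)
      have "192 / (2 ^ i)\<^sup>2 * (K * (2 * 2 ^ i)) = 384 * K / 2 ^ i" by (simp add: power2_eq_square field_simps)
      also have "\<dots> \<le> 384 * K / 1" using K_pos by (intro divide_left_mono) auto
      finally show "192 / (2 ^ i)\<^sup>2 * (K * (2 * 2 ^ i)) \<le> 384 * K" by simp
    qed auto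
    finally show ?thesis .
  qed
  have "(\<integral>\<^sup>+y. \<integral>\<^sup>+x. ennreal (\<kappa> (x - y)) * U x y \<partial>M \<partial>M)
    \<le> (\<integral>\<^sup>+y. \<integral>\<^sup>+x. U x y * of_bool (norm (x - y) < 4) +
          (\<Sum>i=2..n. \<Sum>j\<le>n. ennreal (near_term i j (x - y)) * U x y) + (\<Sum>i=2..n. ennreal (far_term i (x - y)) * U x y) \<partial>M \<partial>M)"
  proof (intro nn_integral_mono)
    fix x y :: "spacetime"
    let ?z = "x - y"
    show "ennreal (\<kappa> ?z) * U x y \<le> U x y * of_bool (norm ?z < 4) +
          (\<Sum>i=2..n. \<Sum>j\<le>n. ennreal (near_term i j ?z) * U x y) + (\<Sum>i=2..n. ennreal (far_term i ?z) * U x y)"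
    proof (cases "u x = 0 \<or> u y = 0")
      case False
      then have "x \<in> ball a R" "y \<in> ball a R" using supp by auto
      then have "norm ?z < 2 ^ Suc n"
        using n(2) dist_triangle2[of x y a] by (simp add: dist_norm norm_minus_commute)
      from kernel_majorant[OF this]
      have "ennreal (\<kappa> ?z) \<le> ennreal (of_bool (norm ?z < 4) + (\<Sum>i=2..n. \<Sum>j\<le>n. near_term i j ?z) + (\<Sum>i=2..n. far_term i ?z))"
        by (rule ennreal_leI)
      also have "\<dots> = of_bool (norm ?z < 4) + (\<Sum>i=2..n. \<Sum>j\<le>n. ennreal (near_term i j ?z)) + (\<Sum>i=2..n. ennreal (far_term i ?z))"
        by (simp add: ennreal_plus sum_nonneg near_term_nonneg far_term_nonneg sum_ennreal)
      finally have "ennreal (\<kappa> ?z) * U x y \<le> (of_bool (norm ?z < 4) + (\<Sum>i=2..n. \<Sum>j\<le>n. ennreal (near_term i j ?z)) + (\<Sum>i=2..n. ennreal (far_term i ?z))) * U x y"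
        by (rule mult_right_mono) simp
      also have "\<dots> = U x y * of_bool (norm ?z < 4) +
          (\<Sum>i=2..n. \<Sum>j\<le>n. ennreal (near_term i j ?z) * U x y) + (\<Sum>i=2..n. ennreal (far_term i ?z) * U x y)"
        by (simp only: distrib_right sum_distrib_right mult.commute[of "of_bool (norm ?z < 4)"])
      finally show ?thesis .
    qed (auto simp: U_def)
  qed
  also have "\<dots> = (\<integral>\<^sup>+y. \<integral>\<^sup>+x. U x y * of_bool (norm (x - y) < 4) \<partial>M \<partial>M)
     + (\<Sum>i=2..n. \<Sum>j\<le>n. (\<integral>\<^sup>+y. \<integral>\<^sup>+x. ennreal (near_term i j (x - y)) * U x y \<partial>M \<partial>M))
     + (\<Sum>i=2..n. (\<integral>\<^sup>+y. \<integral>\<^sup>+x. ennreal (far_term i (x - y)) * U x y \<partial>M \<partial>M))"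
    unfolding U_def by (simp add: nn_integral_add nn_integral_sum)
  also have "\<dots> \<le> ennreal (K * 4) * N + (\<Sum>i=2..n. \<Sum>j\<le>n. ennreal (24 * C * S * t) * N) + (\<Sum>i=2..n. ennreal (384 * K) * N)"
    by (intro add_mono sum_mono close near far) auto
  also have "\<dots> = ennreal (K * 4 + real (card {2..n}) * (real (n + 1) * (24 * C * S * t)) + real (card {2..n}) * (384 * K)) * N"
    using K_pos C0 S1 t_pos
    by (simp add: distrib_right ennreal_plus ennreal_mult ennreal_of_nat_eq_real_of_nat mult.assoc)
  also have "\<dots> \<le> ennreal ((388 * K / c + 24 * C) * (1 + log 2 (2 * R))\<^sup>2 * S * t) * N"
  proof (intro mult_right_mono ennreal_leI)
    define L where "L = 1 + log 2 (2 * R)"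
    have L: "real (n + 1) \<le> L" "1 \<le> L" "real (card {2..n}) \<le> L" using nlog by (auto simp: L_def)
    have LL: "L \<le> L\<^sup>2" "1 \<le> L\<^sup>2" using L(2) by (auto simp: power2_eq_square one_le_power[of L 2, simplified power2_eq_square])
    have tc: "1 \<le> S * t / c"
    proof -
      have "1 * c \<le> S * t" using S1 c by (intro mult_mono) auto
      then show ?thesis using c by (simp add: pos_le_divide_eq)
    qed
    have "real (card {2..n}) * (real (n + 1) * (24 * C * S * t)) \<le> L * (L * (24 * C * S * t))"
      using L C0 S1 t_pos by (intro mult_mono) auto
    moreover have "K * 4 \<le> L\<^sup>2 * (4 * K)" using LL K_pos by (simp add: mult_le_cancel_right1)
    moreover have "real (card {2..n}) * (384 * K) \<le> L\<^sup>2 * (384 * K)"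
      using L LL K_pos by (intro mult_right_mono) auto
    ultimately have "K * 4 + real (card {2..n}) * (real (n + 1) * (24 * C * S * t)) + real (card {2..n}) * (384 * K)
      \<le> L\<^sup>2 * (388 * K) * 1 + L\<^sup>2 * (24 * C * S * t)"
      by (simp add: power2_eq_square algebra_simps)
    also have "\<dots> \<le> L\<^sup>2 * (388 * K) * (S * t / c) + L\<^sup>2 * (24 * C * S * t)"
      using tc K_pos by (intro add_right_mono mult_left_mono) auto
    also have "\<dots> = (388 * K / c + 24 * C) * L\<^sup>2 * S * t" by (simp add: algebra_simps)
    finally show "K * 4 + real (card {2..n}) * (real (n + 1) * (24 * C * S * t)) + real (card {2..n}) * (384 * K)
      \<le> (388 * K / c + 24 * C) * (1 + log 2 (2 * R))\<^sup>2 * S * t" by (simp only: L_def)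
  qed auto
  finally show ?thesis by (simp only: U_def N_def S_def)
qed

section \<open>The kernel of a smooth measure on the cone\<close>

text \<open>(a, b, z3) is the point z. The parameter \<tau> scales (a, b) only: the kernel is wanted
  at \<tau> = 1, while at \<tau> = 0 the angular integrals are trivial. \<open>D\<close> and
  \<open>E\<close> come from positive and negative radius over a half circle of angles, and
  \<open>P\<close> at \<tau> = 1 is s^2 + |z'|^2.\<close>

locale cone_symbol =
  fixes a b z3 :: real
begin

definition s :: complex where "s = Complex 1 (- z3)"
definition A :: "real \<Rightarrow> real" where "A \<theta> = a * cos \<theta> + b * sin \<theta>"
definition D :: "real \<Rightarrow> real \<Rightarrow> complex" where "D \<tau> \<theta> = s - \<i> * of_real (\<tau> * A \<theta>)"
definition E :: "real \<Rightarrow> real \<Rightarrow> complex" where "E \<tau> \<theta> = s + \<i> * of_real (\<tau> * A \<theta>)"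
definition I1 :: "real \<Rightarrow> complex" where
  "I1 \<tau> = integral {- (pi/2)..pi/2} (\<lambda>\<theta>. 1 / D \<tau> \<theta> + 1 / E \<tau> \<theta>)"
definition I2 :: "real \<Rightarrow> complex" where
  "I2 \<tau> = integral {- (pi/2)..pi/2} (\<lambda>\<theta>. 1 / (D \<tau> \<theta>)\<^sup>2 + 1 / (E \<tau> \<theta>)\<^sup>2)"
definition P :: "real \<Rightarrow> complex" where "P \<tau> = s\<^sup>2 + of_real (\<tau>\<^sup>2 * (a\<^sup>2 + b\<^sup>2))"

lemma Re_DE: "Re (D \<tau> \<theta>) = 1" "Re (E \<tau> \<theta>) = 1"
  by (simp_all add: D_def E_def s_def)

lemma DE_nz [simp]: "D \<tau> \<theta> \<noteq> 0" "E \<tau> \<theta> \<noteq> 0"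
  using Re_DE[of \<tau> \<theta>] by (auto simp: complex_eq_iff)

lemma s_nz [simp]: "s \<noteq> 0" by (simp add: s_def complex_eq_iff)

lemma continuous_DE [continuous_intros]: "continuous_on S (\<lambda>x. D (fst x) (snd x))" "continuous_on S (\<lambda>x. E (fst x) (snd x))"
  "continuous_on T (D \<tau>)" "continuous_on T (E \<tau>)"
  unfolding D_def E_def A_def by (intro continuous_intros)+

lemma integrands_integrable:
  "(\<lambda>\<theta>. 1 / D \<tau> \<theta> + 1 / E \<tau> \<theta>) integrable_on {- (pi/2)..pi/2}"
  "(\<lambda>\<theta>. 1 / (D \<tau> \<theta>)\<^sup>2 + 1 / (E \<tau> \<theta>)\<^sup>2) integrable_on {- (pi/2)..pi/2}"
  by (intro integrable_continuous_real continuous_intros; simp)+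

text \<open>With B = \<tau> A and B' its angular derivative, the derivative of B' (1/D - 1/E) is i
  times the difference of the integrands of the two sides, because B'^2 + B^2 is constant and B = i
  (D - s). The boundary terms agree: a half turn changes the sign of B' and exchanges
  \<open>D\<close> and \<open>E\<close>.\<close>

lemma recursion: "P \<tau> * I2 \<tau> = s * I1 \<tau>"
proof -
  define A' where "A' \<theta> = b * cos \<theta> - a * sin \<theta>" for \<theta>
  define G where "G w = of_real \<tau> * (of_real b * cos w - of_real a * sin w) *
     (1 / (s - \<i> * of_real \<tau> * (of_real a * cos w + of_real b * sin w)) - 1 / (s + \<i> * of_real \<tau> * (of_real a * cos w + of_real b * sin w)))" for w :: complex
  have D: "D \<tau> \<theta> = s - \<i> * of_real \<tau> * (of_real a * cos (of_real \<theta>) + of_real b * sin (of_real \<theta>))"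
    and E: "E \<tau> \<theta> = s + \<i> * of_real \<tau> * (of_real a * cos (of_real \<theta>) + of_real b * sin (of_real \<theta>))" for \<theta>
    by (simp_all add: D_def E_def A_def cos_of_real sin_of_real mult.assoc)
  have "((\<lambda>\<theta>. G (of_real \<theta>)) has_vector_derivative
      \<i> * (P \<tau> * (1 / (D \<tau> \<theta>)\<^sup>2 + 1 / (E \<tau> \<theta>)\<^sup>2) - s * (1 / D \<tau> \<theta> + 1 / E \<tau> \<theta>))) (at \<theta> within {- (pi/2)..pi/2})" for \<theta>
  proof (rule has_vector_derivative_real_field)
    define c where "c = cos (of_real \<theta> :: complex)"
    define t where "t = sin (of_real \<theta> :: complex)"
    define B where "B = of_real \<tau> * (of_real a * c + of_real b * t)"
    define B' where "B' = of_real \<tau> * (of_real b * c - of_real a * t)"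
    have nz: "s - \<i> * B \<noteq> 0" "s + \<i> * B \<noteq> 0"
      using DE_nz[of \<tau> \<theta>] unfolding D E c_def[symmetric] t_def[symmetric] by (simp_all add: B_def mult.assoc)
    have sq: "B' * B' = of_real (\<tau>\<^sup>2 * (a\<^sup>2 + b\<^sup>2)) - B * B"
    proof -
      have "c * c + t * t = 1"
        unfolding c_def t_def using sin_cos_squared_add3[of "of_real \<theta> :: complex"] by (simp add: add.commute)
      then have "B' * B' + B * B = of_real \<tau> * of_real \<tau> * (of_real a * of_real a + of_real b * of_real b)"
        unfolding B_def B'_def by algebra
      then show ?thesis by (simp add: power2_eq_square algebra_simps)
    qed
    have "(G has_field_derivative
       - B * (1 / (s - \<i> * B) - 1 / (s + \<i> * B)) + B' * (\<i> * B' / (s - \<i> * B)\<^sup>2 + \<i> * B' / (s + \<i> * B)\<^sup>2)) (at (of_real \<theta>))"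
    proof -
      define m where "m w = of_real \<tau> * (of_real a * cos w + of_real b * sin w)" for w :: complex
      define m' where "m' w = of_real \<tau> * (of_real b * cos w - of_real a * sin w)" for w :: complex
      have 1: "m (of_real \<theta>) = B" "m' (of_real \<theta>) = B'"
        by (simp_all add: m_def m'_def B_def B'_def c_def t_def)
      have 2: "(m has_field_derivative B') (at (of_real \<theta>))" "(m' has_field_derivative - B) (at (of_real \<theta>))"
        unfolding m_def m'_def B_def B'_def c_def t_def by (auto intro!: derivative_eq_intros simp: algebra_simps)
      have "G = (\<lambda>w. m' w * (1 / (s - \<i> * m w) - 1 / (s + \<i> * m w)))"
        by (simp add: G_def[abs_def] m_def m'_def mult.assoc)
      then show ?thesis
        using nz by (auto intro!: derivative_eq_intros 2 simp: 1 power2_eq_square mult.commute)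
    qed
    moreover have "- B * (1 / (s - \<i> * B) - 1 / (s + \<i> * B)) + B' * (\<i> * B' / (s - \<i> * B)\<^sup>2 + \<i> * B' / (s + \<i> * B)\<^sup>2)
       = \<i> * (P \<tau> * (1 / (s - \<i> * B)\<^sup>2 + 1 / (s + \<i> * B)\<^sup>2) - s * (1 / (s - \<i> * B) + 1 / (s + \<i> * B)))"
    proof -
      have *: "- B * (1 / (s - \<i> * B)) + B' * (\<i> * B' / (s - \<i> * B)\<^sup>2) = \<i> * (P \<tau> * (1 / (s - \<i> * B)\<^sup>2) - s * (1 / (s - \<i> * B)))"
        if "B' * B' = of_real (\<tau>\<^sup>2 * (a\<^sup>2 + b\<^sup>2)) - B * B" "s - \<i> * B \<noteq> 0" for B B'
      proof -
        define d where "d = s - \<i> * B"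
        have Bd: "B = \<i> * (d - s)" by (simp add: d_def algebra_simps)
        have "- B * d + \<i> * (B' * B') = \<i> * (P \<tau> - s * d)"
          unfolding that(1) P_def Bd by (simp add: power2_eq_square algebra_simps)
        then have "(- B * d + \<i> * (B' * B')) / d\<^sup>2 = \<i> * (P \<tau> - s * d) / d\<^sup>2" by simp
        then show ?thesis unfolding d_def[symmetric]
          using that(2) unfolding d_def[symmetric] by (simp add: power2_eq_square field_simps)
      qed
      have m: "B * (1 / (s + \<i> * B)) + B' * (\<i> * B' / (s + \<i> * B)\<^sup>2) = \<i> * (P \<tau> * (1 / (s + \<i> * B)\<^sup>2) - s * (1 / (s + \<i> * B)))"
        using *[of B' "- B"] sq nz(2) by simp
      have "- B * (1 / (s - \<i> * B) - 1 / (s + \<i> * B)) + B' * (\<i> * B' / (s - \<i> * B)\<^sup>2 + \<i> * B' / (s + \<i> * B)\<^sup>2)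
        = (- B * (1 / (s - \<i> * B)) + B' * (\<i> * B' / (s - \<i> * B)\<^sup>2)) + (B * (1 / (s + \<i> * B)) + B' * (\<i> * B' / (s + \<i> * B)\<^sup>2))"
        by (simp only: distrib_left right_diff_distrib minus_mult_left[symmetric]) simp
      then show ?thesis unfolding *[OF sq nz(1)] m by (simp only: distrib_left right_diff_distrib) simp
    qed
    ultimately show "(G has_field_derivative \<i> * (P \<tau> * (1 / (D \<tau> \<theta>)\<^sup>2 + 1 / (E \<tau> \<theta>)\<^sup>2) - s * (1 / D \<tau> \<theta> + 1 / E \<tau> \<theta>))) (at (of_real \<theta>))"
      unfolding D E c_def[symmetric] t_def[symmetric] by (simp add: B_def mult.assoc)
  qed
  then have "((\<lambda>\<theta>. \<i> * (P \<tau> * (1 / (D \<tau> \<theta>)\<^sup>2 + 1 / (E \<tau> \<theta>)\<^sup>2) - s * (1 / D \<tau> \<theta> + 1 / E \<tau> \<theta>)))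
      has_integral G (of_real (pi/2)) - G (of_real (- (pi/2)))) {- (pi/2)..pi/2}"
    by (intro fundamental_theorem_of_calculus) auto
  moreover have "G (of_real (pi/2)) = G (of_real (- (pi/2)))"
    unfolding G_def cos_of_real sin_of_real by (simp add: algebra_simps)
  ultimately have "((\<lambda>\<theta>. \<i> * (P \<tau> * (1 / (D \<tau> \<theta>)\<^sup>2 + 1 / (E \<tau> \<theta>)\<^sup>2) - s * (1 / D \<tau> \<theta> + 1 / E \<tau> \<theta>))) has_integral 0) {- (pi/2)..pi/2}"
    by simp
  moreover have "((\<lambda>\<theta>. \<i> * (P \<tau> * (1 / (D \<tau> \<theta>)\<^sup>2 + 1 / (E \<tau> \<theta>)\<^sup>2) - s * (1 / D \<tau> \<theta> + 1 / E \<tau> \<theta>))) has_integral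
      \<i> * (P \<tau> * I2 \<tau> - s * I1 \<tau>)) {- (pi/2)..pi/2}"
    unfolding I1_def I2_def
    by (intro has_integral_mult_right has_integral_diff integrable_integral integrands_integrable)
  ultimately have "0 = \<i> * (P \<tau> * I2 \<tau> - s * I1 \<tau>)" by (rule has_integral_unique)
  then show ?thesis by simp
qed

lemma I1_deriv:
  "(I1 has_vector_derivative integral {- (pi/2)..pi/2} (\<lambda>\<theta>. \<i> * of_real (A \<theta>) / (D \<tau> \<theta>)\<^sup>2 - \<i> * of_real (A \<theta>) / (E \<tau> \<theta>)\<^sup>2)) (at \<tau>)"
proof -
  let ?f = "\<lambda>\<tau> \<theta>. 1 / D \<tau> \<theta> + 1 / E \<tau> \<theta>"
  let ?g = "\<lambda>\<tau> \<theta>. \<i> * of_real (A \<theta>) / (D \<tau> \<theta>)\<^sup>2 - \<i> * of_real (A \<theta>) / (E \<tau> \<theta>)\<^sup>2"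
  have "((\<lambda>\<tau>. integral (cbox (- (pi/2)) (pi/2)) (?f \<tau>)) has_vector_derivative integral (cbox (- (pi/2)) (pi/2)) (?g \<tau>)) (at \<tau> within UNIV)"
  proof (rule leibniz_rule_vector_derivative)
    fix \<tau> \<theta>
    have "((\<lambda>w. 1 / (s - \<i> * w * of_real (A \<theta>)) + 1 / (s + \<i> * w * of_real (A \<theta>))) has_field_derivative ?g \<tau> \<theta>) (at (of_real \<tau>))"
      using DE_nz[of \<tau> \<theta>] unfolding D_def E_def
      by (auto intro!: derivative_eq_intros simp: power2_eq_square mult_ac diff_divide_distrib)
    then show "((\<lambda>\<tau>. ?f \<tau> \<theta>) has_vector_derivative ?g \<tau> \<theta>) (at \<tau> within UNIV)"
      using has_vector_derivative_real_field[of "\<lambda>w. 1 / (s - \<i> * w * of_real (A \<theta>)) + 1 / (s + \<i> * w * of_real (A \<theta>))" "?g \<tau> \<theta>" \<tau> UNIV]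
      by (simp add: D_def E_def mult.assoc)
  next
    fix \<tau> show "?f \<tau> integrable_on cbox (- (pi/2)) (pi/2)" using integrands_integrable(1)[of \<tau>] by simp
  next
    have "continuous_on T (\<lambda>x. of_real (A (snd x)) :: complex)" for T :: "(real \<times> real) set"
      unfolding A_def by (intro continuous_intros)
    then show "continuous_on (UNIV \<times> cbox (- (pi/2)) (pi/2)) (\<lambda>(x, t). ?g x t)"
      unfolding case_prod_beta by (intro continuous_intros; simp)
  qed auto
  then show ?thesis by (simp add: I1_def[abs_def])
qed

text \<open>As i A equals both (s - D)/\<tau> and (E - s)/\<tau>, the differentiated integrand
  reduces to the integrands of \<open>I2\<close> and \<open>I1\<close>; with
  \<open>recursion\<close> this closes a differential equation for \<open>I1\<close>.\<close>

lemma I1_deriv_eq: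
  assumes "\<tau> \<noteq> 0"
  shows "(I1 has_vector_derivative (s * I2 \<tau> - I1 \<tau>) / of_real \<tau>) (at \<tau>)"
proof -
  have "(\<lambda>\<theta>. \<i> * of_real (A \<theta>) / (D \<tau> \<theta>)\<^sup>2 - \<i> * of_real (A \<theta>) / (E \<tau> \<theta>)\<^sup>2) =
    (\<lambda>\<theta>. (s * (1 / (D \<tau> \<theta>)\<^sup>2 + 1 / (E \<tau> \<theta>)\<^sup>2) - (1 / D \<tau> \<theta> + 1 / E \<tau> \<theta>)) / of_real \<tau>)"
  proof
    fix \<theta>
    have "\<i> * of_real (A \<theta>) = (s - D \<tau> \<theta>) / of_real \<tau>" "\<i> * of_real (A \<theta>) = (E \<tau> \<theta> - s) / of_real \<tau>"
      using assms by (simp_all add: D_def E_def)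
    then have "\<i> * of_real (A \<theta>) / (D \<tau> \<theta>)\<^sup>2 - \<i> * of_real (A \<theta>) / (E \<tau> \<theta>)\<^sup>2
      = ((s - D \<tau> \<theta>) / of_real \<tau>) / (D \<tau> \<theta>)\<^sup>2 - ((E \<tau> \<theta> - s) / of_real \<tau>) / (E \<tau> \<theta>)\<^sup>2" by metis
    also have "\<dots> = (s * (1 / (D \<tau> \<theta>)\<^sup>2 + 1 / (E \<tau> \<theta>)\<^sup>2) - (1 / D \<tau> \<theta> + 1 / E \<tau> \<theta>)) / of_real \<tau>"
    proof -
      have "((s - d) / c) / d\<^sup>2 - ((e - s) / c) / e\<^sup>2 = (s * (1 / d\<^sup>2 + 1 / e\<^sup>2) - (1 / d + 1 / e)) / c"
        if "d \<noteq> 0" "e \<noteq> 0" "c \<noteq> 0" for c d e :: complex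
        using that by (simp add: power2_eq_square diff_divide_distrib add_divide_distrib algebra_simps)
      then show ?thesis using assms by simp
    qed
    finally show "\<i> * of_real (A \<theta>) / (D \<tau> \<theta>)\<^sup>2 - \<i> * of_real (A \<theta>) / (E \<tau> \<theta>)\<^sup>2 =
      (s * (1 / (D \<tau> \<theta>)\<^sup>2 + 1 / (E \<tau> \<theta>)\<^sup>2) - (1 / D \<tau> \<theta> + 1 / E \<tau> \<theta>)) / of_real \<tau>" .
  qed
  moreover have "integral {- (pi/2)..pi/2} (\<lambda>\<theta>. (s * (1 / (D \<tau> \<theta>)\<^sup>2 + 1 / (E \<tau> \<theta>)\<^sup>2) - (1 / D \<tau> \<theta> + 1 / E \<tau> \<theta>)) / of_real \<tau>)
     = (s * I2 \<tau> - I1 \<tau>) / of_real \<tau>"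
    unfolding I1_def I2_def
    by (intro integral_unique has_integral_divide has_integral_diff has_integral_mult_right integrable_integral integrands_integrable)
  ultimately show ?thesis using I1_deriv[of \<tau>] by (simp only:)
qed

text \<open>\<open>(I1 \<tau>)^2 P \<tau>\<close> has derivative 0 in \<open>\<tau>\<close>, which evaluates \<open>I1\<close> up to sign without contour integration.\<close>

lemma I1_squared: "(I1 1)\<^sup>2 * P 1 = (2 * of_real pi)\<^sup>2"
proof -
  define F where "F \<tau> = (I1 \<tau>)\<^sup>2 * P \<tau>" for \<tau>
  have P': "(P has_vector_derivative of_real (2 * \<tau> * (a\<^sup>2 + b\<^sup>2))) (at \<tau>)" for \<tau>
  proof -
    have "((\<lambda>w. s\<^sup>2 + w\<^sup>2 * of_real (a\<^sup>2 + b\<^sup>2)) has_field_derivative of_real (2 * \<tau> * (a\<^sup>2 + b\<^sup>2))) (at (of_real \<tau>))"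
      by (auto intro!: derivative_eq_intros)
    from has_vector_derivative_real_field[OF this, of UNIV] show ?thesis by (simp add: P_def[abs_def])
  qed
  have F': "(F has_vector_derivative 0) (at \<tau>)" for \<tau>
  proof -
    \<comment> \<open>\<open>I1_deriv_eq\<close> divides by \<tau>. At \<tau> = 0 both denominators
      equal s and the derivative vanishes, so the constant can be evaluated there.\<close>
    obtain d where d: "(I1 has_vector_derivative d) (at \<tau>)" and d0: "of_real \<tau> * d = s * I2 \<tau> - I1 \<tau>" and d1: "\<tau> = 0 \<Longrightarrow> d = 0"
    proof (cases "\<tau> = 0")
      case True
      have "s * I2 0 = I1 0" using recursion[of 0] by (simp add: P_def power2_eq_square)
      then show ?thesis using I1_deriv[of 0] True by (intro that[of 0]) (simp_all add: D_def E_def)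
    next
      case False
      then show ?thesis by (intro that[OF I1_deriv_eq]) auto
    qed
    have F1: "(F has_vector_derivative (I1 \<tau> * d + d * I1 \<tau>) * P \<tau> + (I1 \<tau>)\<^sup>2 * of_real (2 * \<tau> * (a\<^sup>2 + b\<^sup>2))) (at \<tau>)"
      unfolding F_def power2_eq_square[of "I1 _"]
      by (rule derivative_eq_intros d P' refl)+ (simp add: algebra_simps)
    have "(I1 \<tau> * d + d * I1 \<tau>) * P \<tau> + (I1 \<tau>)\<^sup>2 * of_real (2 * \<tau> * (a\<^sup>2 + b\<^sup>2)) = 0"
    proof (cases "\<tau> = 0")
      case False
      have "of_real \<tau> * ((I1 \<tau> * d + d * I1 \<tau>) * P \<tau> + (I1 \<tau>)\<^sup>2 * of_real (2 * \<tau> * (a\<^sup>2 + b\<^sup>2)))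
         = 2 * I1 \<tau> * ((of_real \<tau> * d) * P \<tau> + I1 \<tau> * of_real (\<tau>\<^sup>2 * (a\<^sup>2 + b\<^sup>2)))"
        by (simp add: power2_eq_square algebra_simps)
      also have "(of_real \<tau> * d) * P \<tau> = s * (P \<tau> * I2 \<tau>) - I1 \<tau> * P \<tau>" unfolding d0 by (simp add: algebra_simps)
      also have "s * (P \<tau> * I2 \<tau>) - I1 \<tau> * P \<tau> = - (I1 \<tau> * of_real (\<tau>\<^sup>2 * (a\<^sup>2 + b\<^sup>2)))"
        unfolding recursion by (simp add: P_def power2_eq_square algebra_simps)
      finally show ?thesis using False by simp
    qed (use d1 in simp)
    with F1 show ?thesis by simp
  qed
  obtain c where c: "\<And>\<tau>. \<tau> \<in> UNIV \<Longrightarrow> F \<tau> = c"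
    using has_vector_derivative_zero_constant[of UNIV F] F' by auto
  have "F 1 = F 0" using c by simp
  also have "I1 0 = 2 * of_real pi / s"
  proof -
    have "I1 0 = integral {- (pi/2)..pi/2} (\<lambda>\<theta>. 1 / s + 1 / s)" by (simp add: I1_def D_def E_def)
    also have "\<dots> = of_real pi * (1 / s + 1 / s)" by (simp only: integral_const_real) (simp add: scaleR_conv_of_real)
    finally show ?thesis by simp
  qed
  then have "F 0 = (2 * of_real pi)\<^sup>2" by (simp add: F_def P_def power_divide)
  finally show ?thesis by (simp add: F_def)
qed

lemma norm_P: "cmod (P 1) = cmod (Complex (1 + (a\<^sup>2 + b\<^sup>2 - z3\<^sup>2)) (- 2 * z3))"
proof -
  have "P 1 = Complex (1 + (a\<^sup>2 + b\<^sup>2 - z3\<^sup>2)) (- 2 * z3)"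
    by (simp add: P_def s_def complex_eq_iff power2_eq_square)
  then show ?thesis by simp
qed

text \<open>Combines \<open>recursion\<close> with \<open>I1_squared\<close>; in modulus the
  undetermined sign of the root disappears. This is the decay |s| / |P|^(3/2) of the kernel.\<close>

lemma norm_I2: "cmod (I2 1) * (cmod (P 1) * sqrt (cmod (P 1))) = 2 * pi * cmod s"
proof -
  have "(cmod (I1 1))\<^sup>2 * cmod (P 1) = (2 * pi)\<^sup>2"
    using arg_cong[OF I1_squared, of cmod] by (simp add: norm_mult norm_power)
  then have "sqrt ((cmod (I1 1))\<^sup>2 * cmod (P 1)) = 2 * pi" by (intro real_sqrt_unique) auto
  then have 1: "cmod (I1 1) * sqrt (cmod (P 1)) = 2 * pi" by (simp add: real_sqrt_mult)
  have "cmod (P 1) * cmod (I2 1) = cmod s * cmod (I1 1)"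
    using arg_cong[OF recursion[of 1], of cmod] by (simp add: norm_mult)
  then have "cmod (I2 1) * (cmod (P 1) * sqrt (cmod (P 1))) = cmod s * (cmod (I1 1) * sqrt (cmod (P 1)))"
    by (simp add: mult_ac)
  then show ?thesis by (simp add: 1 mult_ac)
qed

lemma norm_I2_le: "cmod (I2 1) \<le> 2 * pi"
proof -
  have "1 \<le> cmod (D \<tau> \<theta>)" "1 \<le> cmod (E \<tau> \<theta>)" for \<tau> \<theta>
    using complex_Re_le_cmod[of "D \<tau> \<theta>"] complex_Re_le_cmod[of "E \<tau> \<theta>"] by (simp_all add: Re_DE)
  then have "cmod (1 / (D 1 \<theta>)\<^sup>2) \<le> 1" "cmod (1 / (E 1 \<theta>)\<^sup>2) \<le> 1" for \<theta>
    by (simp_all add: norm_divide norm_power divide_le_eq_1 one_le_power)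
  then have "cmod (1 / (D 1 \<theta>)\<^sup>2 + 1 / (E 1 \<theta>)\<^sup>2) \<le> 2" for \<theta>
    using norm_triangle_ineq[of "1 / (D 1 \<theta>)\<^sup>2" "1 / (E 1 \<theta>)\<^sup>2"] by (smt (verit))
  then have "cmod (I2 1) \<le> 2 * (pi / 2 - - (pi / 2))"
    unfolding I2_def by (intro integral_bound continuous_intros) auto
  then show ?thesis by simp
qed

end

section \<open>The Laplace integral over the radius\<close>

lemma exp_decay_at_top:
  fixes r :: real
  assumes "r > 0"
  shows "((\<lambda>x. x * exp (- (r * x))) \<longlongrightarrow> 0) at_top" "((\<lambda>x. exp (- (r * x))) \<longlongrightarrow> 0) at_top"
proof -
  have f: "filterlim (\<lambda>x. r * x) at_top at_top"
    using assms by (intro filterlim_tendsto_pos_mult_at_top[OF tendsto_const]) (auto simp: filterlim_ident)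
  have "((\<lambda>x. (r * x) ^ k / exp (r * x)) \<longlongrightarrow> 0) at_top" for k
    by (rule filterlim_compose[OF tendsto_power_div_exp_0 f])
  from this[of 1] this[of 0] have 1: "((\<lambda>x. (r * x) / exp (r * x)) \<longlongrightarrow> 0) at_top"
    and 2: "((\<lambda>x. 1 / exp (r * x)) \<longlongrightarrow> 0) at_top" by simp_all
  have "(\<lambda>x. (1 / r) * ((r * x) / exp (r * x))) = (\<lambda>x. x * exp (- (r * x)))"
    using assms by (auto simp: fun_eq_iff exp_minus divide_inverse)
  then show "((\<lambda>x. x * exp (- (r * x))) \<longlongrightarrow> 0) at_top" using tendsto_mult_left[OF 1, of "1 / r"] by (simp only: mult_zero_right)
  show "((\<lambda>x. exp (- (r * x))) \<longlongrightarrow> 0) at_top" using 2 by (simp add: exp_minus divide_inverse)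
qed

text \<open>The explicit antiderivative serves twice: for the real exponent Re c it yields
  integrability, since the integrand is nonnegative, and given that it yields the complex
  value.\<close>

lemma has_bochner_integral_mult_exp:
  fixes c :: complex
  assumes c: "Re c > 0"
  shows "has_bochner_integral lborel (\<lambda>x. indicator {0<..} x *\<^sub>R (of_real x * exp (- (c * of_real x)))) (1 / c\<^sup>2)"
proof -
  have real_int: "set_integrable lborel {0<..} (\<lambda>x. x * exp (- (r * x)))" if r: "r > 0" for r :: real
  proof -
    define F where "F x = - (x / r + 1 / r\<^sup>2) * exp (- (r * x))" for x
    have "set_integrable lborel (einterval (ereal 0) \<infinity>) (\<lambda>x. x * exp (- (r * x)))"
    proof (rule interval_integral_FTC_nonneg(1)[where F = F])
      show "DERIV F x :> x * exp (- (r * x))" for x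
        unfolding F_def using r by (auto intro!: derivative_eq_intros simp: field_simps power2_eq_square)
      show "((F \<circ> real_of_ereal) \<longlongrightarrow> - 1 / r\<^sup>2) (at_right (ereal 0))"
      proof -
        have "isCont F 0" unfolding F_def using r by (intro continuous_intros) auto
        then have "(F \<longlongrightarrow> F 0) (at_right 0)" unfolding isCont_def by (rule tendsto_mono[OF at_le[OF subset_UNIV]])
        then show ?thesis unfolding ereal_tendsto_simps1 by (simp add: F_def)
      qed
      have "((\<lambda>x. - (1 / r) * (x * exp (- (r * x))) - 1 / r\<^sup>2 * exp (- (r * x))) \<longlongrightarrow> - (1 / r) * 0 - 1 / r\<^sup>2 * 0) at_top"
        by (intro tendsto_intros exp_decay_at_top r)
      then show "((F \<circ> real_of_ereal) \<longlongrightarrow> 0) (at_left \<infinity>)"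
        unfolding ereal_tendsto_simps1 F_def by (simp add: algebra_simps)
    qed auto
    then show ?thesis by simp
  qed
  define F where "F w = - (w / c + 1 / c\<^sup>2) * exp (- (c * w))" for w :: complex
  have c0: "c \<noteq> 0" using c by auto
  let ?f = "\<lambda>x. of_real x * exp (- (c * of_real x))"
  have nf: "norm (?f x) = \<bar>x\<bar> * exp (- (Re c * x))" for x :: real
    by (simp add: norm_mult)
  have int: "set_integrable lborel {0<..} ?f"
    unfolding set_integrable_def
    by (rule Bochner_Integration.integrable_bound[OF real_int[OF c, unfolded set_integrable_def]])
       (auto simp: nf indicator_def norm_mult)
  have "(LBINT x=ereal 0..\<infinity>. ?f x) = 0 - (- (1 / c\<^sup>2))"
  proof (rule interval_integral_FTC_integrable[where F = "\<lambda>x. F (of_real x)"])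
    show "((\<lambda>x. F (of_real x)) has_vector_derivative ?f x) (at x)" for x
    proof (rule has_vector_derivative_real_field)
      show "(F has_field_derivative ?f x) (at (of_real x))"
        unfolding F_def using c0 by (auto intro!: derivative_eq_intros simp: field_simps power2_eq_square)
    qed
    show "(((\<lambda>x. F (of_real x)) \<circ> real_of_ereal) \<longlongrightarrow> - (1 / c\<^sup>2)) (at_right (ereal 0))"
    proof -
      have "isCont (\<lambda>x :: real. F (of_real x)) 0" unfolding F_def using c0 by (intro continuous_intros) auto
      then have "((\<lambda>x :: real. F (of_real x)) \<longlongrightarrow> F (of_real 0)) (at_right 0)" unfolding isCont_def by (rule tendsto_mono[OF at_le[OF subset_UNIV]])
      then show ?thesis unfolding ereal_tendsto_simps1 by (simp add: F_def)
    qed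
    have 1: "((\<lambda>x. ?f x) \<longlongrightarrow> 0) at_top"
    proof (rule Lim_null_comparison)
      show "eventually (\<lambda>x. norm (?f x) \<le> x * exp (- (Re c * x))) at_top"
        using eventually_ge_at_top[of 0] by eventually_elim (simp add: nf)
    qed (rule exp_decay_at_top[OF c])
    have 2: "((\<lambda>x. exp (- (c * of_real x))) \<longlongrightarrow> 0) at_top"
      by (rule Lim_null_comparison[OF _ exp_decay_at_top(2)[OF c]]) simp
    have "((\<lambda>x. - (1 / c) * ?f x - 1 / c\<^sup>2 * exp (- (c * of_real x))) \<longlongrightarrow> - (1 / c) * 0 - 1 / c\<^sup>2 * 0) at_top"
      by (intro tendsto_intros 1 2)
    then show "(((\<lambda>x. F (of_real x)) \<circ> real_of_ereal) \<longlongrightarrow> 0) (at_left \<infinity>)"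
      unfolding ereal_tendsto_simps1 F_def by (simp add: algebra_simps)
  qed (use int in auto)
  then have "(LBINT x:{0<..}. ?f x) = 1 / c\<^sup>2" by (simp add: interval_integral_to_infinity_eq)
  then show ?thesis using int
    by (simp add: has_bochner_integral_iff set_integrable_def set_lebesgue_integral_def)
qed

lemma has_bochner_integral_two_sided:
  fixes c c' :: complex
  assumes "Re c > 0" "Re c' > 0"
  shows "has_bochner_integral lborel (\<lambda>x. of_real \<bar>x\<bar> * exp (- ((if x > 0 then c else c') * of_real \<bar>x\<bar>))) (1 / c\<^sup>2 + 1 / c'\<^sup>2)"
proof -
  have 1: "has_bochner_integral lborel (\<lambda>x. indicator {0<..} x *\<^sub>R (of_real x * exp (- (c * of_real x)))) (1 / c\<^sup>2)"
    by (rule has_bochner_integral_mult_exp) fact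
  have 2: "has_bochner_integral lborel (\<lambda>x. indicator {0<..} (0 + (-1) * x) *\<^sub>R (of_real (0 + (-1) * x) * exp (- (c' * of_real (0 + (-1) * x))))) (1 / c'\<^sup>2 /\<^sub>R \<bar>-1\<bar>)"
    by (subst lborel_has_bochner_integral_real_affine_iff[symmetric]) (use has_bochner_integral_mult_exp[OF assms(2)] in auto)
  have "has_bochner_integral lborel (\<lambda>x. indicator {0<..} x *\<^sub>R (of_real x * exp (- (c * of_real x))) +
     indicator {0<..} (0 + (-1) * x) *\<^sub>R (of_real (0 + (-1) * x) * exp (- (c' * of_real (0 + (-1) * x))))) (1 / c\<^sup>2 + 1 / c'\<^sup>2 /\<^sub>R \<bar>-1\<bar>)"
    by (rule has_bochner_integral_add[OF 1 2])
  moreover have "(\<lambda>x. indicator {0<..} x *\<^sub>R (of_real x * exp (- (c * of_real x))) +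
     indicator {0<..} (0 + (-1) * x) *\<^sub>R (of_real (0 + (-1) * x) * exp (- (c' * of_real (0 + (-1) * x)))))
     = (\<lambda>x :: real. of_real \<bar>x\<bar> * exp (- ((if x > 0 then c else c') * of_real \<bar>x\<bar>)))"
    by (auto simp: fun_eq_iff indicator_def)
  ultimately show ?thesis by simp
qed

section \<open>The damped measure on the forward cone and its Fourier transform\<close>

definition cone_weight :: "real \<times> real \<Rightarrow> real" where
  "cone_weight p = indicator {- (pi/2)..pi/2} (fst p) * (\<bar>snd p\<bar> * exp (- (2 * pi * \<bar>snd p\<bar>)))"

text \<open>A negative radius reaches the antipodal direction on the same forward cone, so half a
  turn of angles covers everything; this range fits the substitution by
  \<open>arctan\<close>.\<close>

definition cone_param :: "real \<times> real \<Rightarrow> spacetime" where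
  "cone_param p = (snd p *\<^sub>R circ (fst p), \<bar>snd p\<bar>)"

text \<open>A smooth measure on the whole forward cone, in polar coordinates with a signed radius. It dominates the surface measure
  of the truncated cone, and its Fourier transform has a closed form.\<close>

definition cone_density :: "(real \<times> real) measure" where
  "cone_density = density (lborel \<Otimes>\<^sub>M lborel) (\<lambda>p. ennreal (cone_weight p))"

lemma cone_weight_measurable [measurable]: "cone_weight \<in> borel_measurable (lborel \<Otimes>\<^sub>M lborel)"
  unfolding cone_weight_def by measurable

lemma cone_weight_nonneg: "cone_weight p \<ge> 0"
  by (simp add: cone_weight_def)

lemma continuous_circ [continuous_intros]:
  fixes f :: "'a :: t2_space \<Rightarrow> real"
  assumes f: "continuous_on S f"
  shows "continuous_on S (\<lambda>x. circ (f x))"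
proof -
  have circ: "circ \<theta> = (\<chi> i. if i = 1 then cos \<theta> else sin \<theta>)" for \<theta>
    by (auto simp: vec_eq_iff forall_2)
  show ?thesis
    unfolding circ
  proof (rule continuous_on_vec_lambda)
    show "continuous_on S (\<lambda>x. if i = 1 then cos (f x) else sin (f x))" for i :: 2
      by (cases "i = 1") (simp_all add: continuous_on_cos continuous_on_sin f)
  qed
qed

lemma cone_param_measurable [measurable]: "cone_param \<in> borel_measurable (lborel \<Otimes>\<^sub>M lborel)"
proof -
  have "continuous_on UNIV cone_param"
    unfolding cone_param_def by (intro continuous_intros)
  then have "cone_param \<in> borel_measurable borel" by (rule borel_measurable_continuous_onI)
  then show ?thesis by (simp add: borel_prod lborel_prod)
qed

lemma integrable_cone_weight: "integrable (lborel \<Otimes>\<^sub>M lborel) cone_weight"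
proof (rule lborel_pair.Fubini_integrable)
  have "has_bochner_integral lborel (\<lambda>x. of_real \<bar>x\<bar> * exp (- ((if x > 0 then of_real (2 * pi) else of_real (2 * pi)) * of_real \<bar>x\<bar>))) (1 / (of_real (2 * pi))\<^sup>2 + 1 / (of_real (2 * pi) :: complex)\<^sup>2)"
    by (rule has_bochner_integral_two_sided) auto
  moreover have "norm (of_real \<bar>x\<bar> * exp (- ((if x > 0 then of_real (2 * pi) else of_real (2 * pi)) * of_real \<bar>x\<bar>)) :: complex) = \<bar>x\<bar> * exp (- (2 * pi * \<bar>x\<bar>))" for x
    by (simp add: norm_mult)
  ultimately have int: "integrable lborel (\<lambda>x. \<bar>x\<bar> * exp (- (2 * pi * \<bar>x\<bar>)))"
    using integrable_norm[OF has_bochner_integral_iff[THEN iffD1, THEN conjunct1]] by (metis (no_types, lifting) Bochner_Integration.integrable_cong)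
  show "AE x in lborel. integrable lborel (\<lambda>y. cone_weight (x, y))"
    unfolding cone_weight_def using int by (intro AE_I2) simp
  have "(\<lambda>x. \<integral>y. norm (cone_weight (x, y)) \<partial>lborel) = (\<lambda>x. indicator {- (pi/2)..pi/2} x * (\<integral>y. \<bar>y\<bar> * exp (- (2 * pi * \<bar>y\<bar>)) \<partial>lborel))"
    by (simp add: cone_weight_def abs_mult)
  then show "integrable lborel (\<lambda>x. \<integral>y. norm (cone_weight (x, y)) \<partial>lborel)"
    by simp
qed (rule cone_weight_measurable)

lemma finite_cone_density: "finite_measure cone_density"
proof (rule finite_measureI)
  have "emeasure cone_density (space cone_density) = (\<integral>\<^sup>+p. ennreal (cone_weight p) \<partial>(lborel \<Otimes>\<^sub>M lborel))"
    unfolding cone_density_def space_density by (subst emeasure_density[OF _ sets.top]) (auto intro!: nn_integral_cong)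
  also have "\<dots> < \<infinity>"
    using integrable_cone_weight by (simp add: integrable_iff_bounded cone_weight_nonneg)
  finally show "emeasure cone_density (space cone_density) \<noteq> \<infinity>" by simp
qed

definition cone_kernel_fun :: "spacetime \<Rightarrow> complex" where
  "cone_kernel_fun z = (\<integral>p. exp (2 * of_real pi * \<i> * of_real (z \<bullet> cone_param p)) \<partial>cone_density)"

text \<open>The damping exp (-2 pi |\<rho>|) supplies the real part 1 of \<open>s\<close>: damping
  and phase at radius \<rho> combine to the exponent -2 pi |\<rho>| times \<open>D\<close> or
  \<open>E\<close>, according to the sign of \<rho>. Integrating |\<rho>| against this gives the
  inverse squares.\<close>

lemma cone_kernel_fun_eq:
  "cone_kernel_fun z = cone_symbol.I2 (fst z $ 1) (fst z $ 2) (snd z) 1 / (4 * of_real pi ^ 2)"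
proof -
  interpret cone_symbol "fst z $ 1" "fst z $ 2" "snd z" .
  let ?e = "\<lambda>p. exp (2 * of_real pi * \<i> * of_real (z \<bullet> cone_param p)) :: complex"
  have [measurable]: "?e \<in> borel_measurable (lborel \<Otimes>\<^sub>M lborel)" by measurable
  have int: "integrable (lborel \<Otimes>\<^sub>M lborel) (\<lambda>p. cone_weight p *\<^sub>R ?e p)"
    by (rule Bochner_Integration.integrable_bound[OF integrable_cone_weight]) (auto simp: cone_weight_nonneg)
  have inner: "has_bochner_integral lborel (\<lambda>\<rho>. (\<bar>\<rho>\<bar> * exp (- (2 * pi * \<bar>\<rho>\<bar>))) *\<^sub>R ?e (\<theta>, \<rho>)) ((1 / (D 1 \<theta>)\<^sup>2 + 1 / (E 1 \<theta>)\<^sup>2) / (4 * of_real pi ^ 2))" for \<theta>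
  proof -
    have "has_bochner_integral lborel (\<lambda>x. of_real \<bar>x\<bar> * exp (- ((if x > 0 then 2 * of_real pi * D 1 \<theta> else 2 * of_real pi * E 1 \<theta>) * of_real \<bar>x\<bar>)))
      (1 / (2 * of_real pi * D 1 \<theta>)\<^sup>2 + 1 / (2 * of_real pi * E 1 \<theta>)\<^sup>2)"
      by (rule has_bochner_integral_two_sided) (simp_all add: Re_DE)
    moreover have "1 / (2 * of_real pi * D 1 \<theta>)\<^sup>2 + 1 / (2 * of_real pi * E 1 \<theta>)\<^sup>2 = (1 / (D 1 \<theta>)\<^sup>2 + 1 / (E 1 \<theta>)\<^sup>2) / (4 * of_real pi ^ 2)"
      by (simp add: power_mult_distrib add_divide_distrib mult.commute)
    moreover have "of_real \<bar>x\<bar> * exp (- ((if x > 0 then 2 * of_real pi * D 1 \<theta> else 2 * of_real pi * E 1 \<theta>) * of_real \<bar>x\<bar>)) =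
       (\<bar>x\<bar> * exp (- (2 * pi * \<bar>x\<bar>))) *\<^sub>R ?e (\<theta>, x)" for x :: real
    proof -
      have "- ((if x > 0 then 2 * of_real pi * D 1 \<theta> else 2 * of_real pi * E 1 \<theta>) * of_real \<bar>x\<bar>)
        = complex_of_real (- (2 * pi * \<bar>x\<bar>)) + 2 * of_real pi * \<i> * of_real (z \<bullet> cone_param (\<theta>, x))"
        by (auto simp: complex_eq_iff D_def E_def s_def A_def cone_param_def inner_prod_def inner_vec2 algebra_simps)
      then show ?thesis by (simp only: exp_add exp_of_real scaleR_conv_of_real of_real_mult mult.assoc)
    qed
    ultimately show ?thesis by simp
  qed
  have "cone_kernel_fun z = (\<integral>p. cone_weight p *\<^sub>R ?e p \<partial>(lborel \<Otimes>\<^sub>M lborel))"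
    unfolding cone_kernel_fun_def cone_density_def
    by (subst integral_density) (auto simp: cone_weight_nonneg)
  also have "\<dots> = (\<integral>\<theta>. \<integral>\<rho>. cone_weight (\<theta>, \<rho>) *\<^sub>R ?e (\<theta>, \<rho>) \<partial>lborel \<partial>lborel)"
    using lborel_pair.integral_fst'[OF int] by simp
  also have "\<dots> = (\<integral>\<theta>. indicator {- (pi/2)..pi/2} \<theta> *\<^sub>R ((1 / (D 1 \<theta>)\<^sup>2 + 1 / (E 1 \<theta>)\<^sup>2) / (4 * of_real pi ^ 2)) \<partial>lborel)"
  proof (rule Bochner_Integration.integral_cong[OF refl])
    fix \<theta>
    have "(\<integral>\<rho>. cone_weight (\<theta>, \<rho>) *\<^sub>R ?e (\<theta>, \<rho>) \<partial>lborel) = (\<integral>\<rho>. indicator {- (pi/2)..pi/2} \<theta> *\<^sub>R ((\<bar>\<rho>\<bar> * exp (- (2 * pi * \<bar>\<rho>\<bar>))) *\<^sub>R ?e (\<theta>, \<rho>)) \<partial>lborel)"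
      by (simp add: cone_weight_def)
    also have "\<dots> = indicator {- (pi/2)..pi/2} \<theta> *\<^sub>R ((1 / (D 1 \<theta>)\<^sup>2 + 1 / (E 1 \<theta>)\<^sup>2) / (4 * of_real pi ^ 2))"
      using has_bochner_integral_integral_eq[OF inner[of \<theta>]] by (simp only: integral_scaleR_right)
    finally show "(\<integral>\<rho>. cone_weight (\<theta>, \<rho>) *\<^sub>R ?e (\<theta>, \<rho>) \<partial>lborel) = \<dots>" .
  qed
  also have "\<dots> = (LINT \<theta>:{- (pi/2)..pi/2}|lborel. (1 / (D 1 \<theta>)\<^sup>2 + 1 / (E 1 \<theta>)\<^sup>2) / (4 * of_real pi ^ 2))"
    by (simp only: set_lebesgue_integral_def)
  also have "\<dots> = integral {- (pi/2)..pi/2} (\<lambda>\<theta>. (1 / (D 1 \<theta>)\<^sup>2 + 1 / (E 1 \<theta>)\<^sup>2) / (4 * of_real pi ^ 2))"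
    by (intro set_borel_integral_eq_integral borel_integrable_atLeastAtMost' continuous_intros) auto
  also have "\<dots> = I2 1 / (4 * of_real pi ^ 2)" unfolding I2_def by simp
  finally show ?thesis .
qed

lemma cone_kernel_cmod: "cone_kernel (\<lambda>z. cmod (cone_kernel_fun z))"
proof
  fix z :: "spacetime"
  interpret cone_symbol "fst z $ 1" "fst z $ 2" "snd z" .
  have n: "cmod (cone_kernel_fun z) = cmod (I2 1) / (4 * pi\<^sup>2)"
    by (simp add: cone_kernel_fun_eq norm_divide norm_mult norm_power)
  have pi1: "pi \<ge> 1" using pi_ge_two by linarith
  have pp: "2 * pi \<le> 4 * pi\<^sup>2" "0 < 4 * pi\<^sup>2" using pi1 by (auto simp: power2_eq_square)
  show "cmod (cone_kernel_fun z) \<le> 1"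
    unfolding n using norm_I2_le pp by (simp add: divide_le_eq_1)
  have W: "light_defect z = cmod (P 1)"
    unfolding norm_P light_defect_def mink_def inner_vec2 by (simp add: power2_eq_square)
  have "cmod (cone_kernel_fun z) * (light_defect z * sqrt (light_defect z)) = 2 * pi * cmod s / (4 * pi\<^sup>2)"
    unfolding W n using norm_I2 by (simp add: field_simps)
  also have "\<dots> \<le> (4 * pi\<^sup>2) * cmod s / (4 * pi\<^sup>2)" using pp by (intro divide_right_mono mult_right_mono) auto
  also have "\<dots> = cmod s" by simp
  also have "\<dots> \<le> 1 + \<bar>snd z\<bar>" unfolding s_def using cmod_le[of "Complex 1 (- snd z)"] by simp
  finally show "cmod (cone_kernel_fun z) * (light_defect z * sqrt (light_defect z)) \<le> 1 + \<bar>snd z\<bar>" .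
qed

section \<open>Polar coordinates and the surface measure\<close>

lemma vector2_measurable [measurable]: "(\<lambda>p. vector [fst p, snd p] :: real ^ 2) \<in> borel_measurable (borel \<Otimes>\<^sub>M borel)"
proof -
  have v: "(vector [x, y] :: real ^ 2) = (\<chi> i. if i = 1 then x else y)" for x y
    by (auto simp: vec_eq_iff forall_2)
  have "continuous_on UNIV (\<lambda>p :: real \<times> real. vector [fst p, snd p] :: real ^ 2)"
    unfolding v
  proof (rule continuous_on_vec_lambda)
    show "continuous_on UNIV (\<lambda>x :: real \<times> real. if i = 1 then fst x else snd x)" for i :: 2
      by (cases "i = 1") (auto intro!: continuous_intros)
  qed
  then show ?thesis unfolding borel_prod by (rule borel_measurable_continuous_onI)
qed

lemma vector2_measurable' [measurable (raw)]:
  assumes "f \<in> borel_measurable N" "g \<in> borel_measurable N"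
  shows "(\<lambda>x. vector [f x, g x] :: real ^ 2) \<in> borel_measurable N"
  using measurable_compose[OF measurable_Pair[OF assms] vector2_measurable] by simp

text \<open>\<open>real ^ 2\<close> is a function space rather than a product type; this opens the
  plane to iterated integrals.\<close>

lemma lborel_vector2: "lborel = distr (lborel \<Otimes>\<^sub>M lborel) borel (\<lambda>p. vector [fst p, snd p] :: real ^ 2)"
proof (rule lborel_eqI)
  fix l u :: "real ^ 2" assume le: "\<And>b. b \<in> Basis \<Longrightarrow> l \<bullet> b \<le> u \<bullet> b"
  have comp: "l $ i \<le> u $ i" for i using le[of "axis i 1"] by (simp add: inner_axis axis_in_Basis_iff)
  have "(\<lambda>p. vector [fst p, snd p] :: real ^ 2) -` box l u = {l $ 1 <..< u $ 1} \<times> {l $ 2 <..< u $ 2}"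
    by (auto simp: mem_box_cart forall_2 set_eq_iff)
  then have "emeasure (distr (lborel \<Otimes>\<^sub>M lborel) borel (\<lambda>p. vector [fst p, snd p] :: real ^ 2)) (box l u) =
     emeasure (lborel \<Otimes>\<^sub>M lborel) ({l $ 1 <..< u $ 1} \<times> {l $ 2 <..< u $ 2})"
    by (subst emeasure_distr) (auto simp: space_pair_measure)
  also have "\<dots> = ennreal (u $ 1 - l $ 1) * ennreal (u $ 2 - l $ 2)"
    using comp by (subst lborel.emeasure_pair_measure_Times) auto
  also have "\<dots> = ennreal ((u $ 1 - l $ 1) * (u $ 2 - l $ 2))"
    using comp by (simp add: ennreal_mult)
  also have "(u $ 1 - l $ 1) * (u $ 2 - l $ 2) = (\<Prod>b\<in>Basis. (u - l) \<bullet> b)"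
  proof -
    have B: "(Basis :: (real ^ 2) set) = {axis 1 1, axis 2 1}"
      by (auto simp: Basis_vec_def) (metis exhaust_2)
    have "(axis 1 1 :: real ^ 2) \<noteq> axis 2 1" by (simp add: axis_eq_axis)
    then show ?thesis unfolding B by (simp add: inner_axis)
  qed
  finally show "emeasure (distr (lborel \<Otimes>\<^sub>M lborel) borel (\<lambda>p. vector [fst p, snd p] :: real ^ 2)) (box l u) = (\<Prod>b\<in>Basis. (u - l) \<bullet> b)" .
qed simp

text \<open>Substitution on [-n, n] and monotone convergence. An inequality is enough, because the
  surface measure has only to be dominated.\<close>

lemma nn_integral_arctan_le:
  fixes \<Phi> :: "real \<Rightarrow> ennreal"
  assumes [measurable]: "\<Phi> \<in> borel_measurable borel"
  shows "(\<integral>\<^sup>+m. \<Phi> (arctan m) * ennreal (inverse (1 + m\<^sup>2)) \<partial>lborel) \<le> (\<integral>\<^sup>+\<theta>. \<Phi> \<theta> * indicator {- (pi/2)..pi/2} \<theta> \<partial>lborel)"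
proof -
  let ?f = "\<lambda>m. \<Phi> (arctan m) * ennreal (inverse (1 + m\<^sup>2))"
  have "(\<integral>\<^sup>+m. ?f m \<partial>lborel) = (\<integral>\<^sup>+m. (SUP n :: nat. ?f m * indicator {- real n..real n} m) \<partial>lborel)"
  proof (rule nn_integral_cong)
    fix m :: real
    obtain n where n: "\<bar>m\<bar> \<le> real n" using real_arch_simple by blast
    have "(SUP n :: nat. ?f m * indicator {- real n..real n} m) = ?f m"
    proof (rule antisym)
      show "(SUP n :: nat. ?f m * indicator {- real n..real n} m) \<le> ?f m"
        by (intro SUP_least) (auto simp: indicator_def)
      have "?f m = ?f m * indicator {- real n..real n} m" using n by (auto simp: indicator_def)
      also have "\<dots> \<le> (SUP n :: nat. ?f m * indicator {- real n..real n} m)" by (rule SUP_upper) simp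
      finally show "?f m \<le> (SUP n :: nat. ?f m * indicator {- real n..real n} m)" .
    qed
    then show "?f m = (SUP n :: nat. ?f m * indicator {- real n..real n} m)" by simp
  qed
  also have "\<dots> = (SUP n :: nat. \<integral>\<^sup>+m. ?f m * indicator {- real n..real n} m \<partial>lborel)"
    by (rule nn_integral_monotone_convergence_SUP)
       (auto simp: incseq_def le_fun_def indicator_def intro!: mult_left_mono)
  also have "\<dots> \<le> (\<integral>\<^sup>+\<theta>. \<Phi> \<theta> * indicator {- (pi/2)..pi/2} \<theta> \<partial>lborel)"
  proof (rule SUP_least)
    fix n :: nat
    show "(\<integral>\<^sup>+m. ?f m * indicator {- real n..real n} m \<partial>lborel) \<le> (\<integral>\<^sup>+\<theta>. \<Phi> \<theta> * indicator {- (pi/2)..pi/2} \<theta> \<partial>lborel)"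
    proof (cases "n = 0")
      \<comment> \<open>For n = 0 the interval shrinks to a point, and the substitution is made on
        proper intervals only.\<close>
      case True
      have "(\<integral>\<^sup>+m. ?f m * indicator {- real n..real n} m \<partial>lborel) = (\<integral>\<^sup>+m. ?f 0 * indicator {0::real} m \<partial>lborel)"
        using True by (intro nn_integral_cong) (auto simp: indicator_def)
      also have "\<dots> = 0" by (subst nn_integral_cmult_indicator) auto
      finally show ?thesis by simp
    next
      case False
      have "(\<integral>\<^sup>+m. ?f m * indicator {- real n..real n} m \<partial>lborel) = (\<integral>\<^sup>+x. \<Phi> x * indicator {arctan (- real n)..arctan (real n)} x \<partial>lborel)"
        by (rule nn_integral_substitution_aux[symmetric])
           (use False in \<open>auto intro!: derivative_eq_intros continuous_intros simp: add_nonneg_eq_0_iff\<close>)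
      also have "\<dots> \<le> (\<integral>\<^sup>+\<theta>. \<Phi> \<theta> * indicator {- (pi/2)..pi/2} \<theta> \<partial>lborel)"
        using arctan_bounded[of "real n"] by (intro nn_integral_mono mult_left_mono) (auto simp: indicator_def arctan_minus)
      finally show ?thesis .
    qed
  qed
  finally show ?thesis .
qed

lemma circ_measurable [measurable]: "circ \<in> borel_measurable borel"
  by (intro borel_measurable_continuous_onI continuous_intros)

text \<open>Polar coordinates through the slope: y = x m has Jacobian |x|, and x = \<rho> cos
  \<theta> with m = tan \<theta> adds cos^2 = 1 / (1 + m^2), the weight that the arctangent
  substitution consumes. The sign of x becomes the sign of the radius.\<close>

lemma nn_integral_polar_le:
  fixes G :: "real ^ 2 \<Rightarrow> ennreal"
  assumes [measurable]: "G \<in> borel_measurable borel"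
  shows "(\<integral>\<^sup>+\<eta>. G \<eta> \<partial>lborel) \<le> (\<integral>\<^sup>+p. indicator {- (pi/2)..pi/2} (fst p) * (ennreal \<bar>snd p\<bar> * G (snd p *\<^sub>R circ (fst p))) \<partial>(lborel \<Otimes>\<^sub>M lborel))"
proof -
  let ?v = "\<lambda>x y. vector [x, y] :: real ^ 2"
  have sf: "sigma_finite_measure (lborel :: real measure)" ..
  define \<Phi> where "\<Phi> \<theta> = (\<integral>\<^sup>+\<rho>. ennreal \<bar>\<rho>\<bar> * G (\<rho> *\<^sub>R circ \<theta>) \<partial>lborel)" for \<theta>
  have [measurable]: "\<Phi> \<in> borel_measurable borel" unfolding \<Phi>_def by measurable
  have "(\<integral>\<^sup>+\<eta>. G \<eta> \<partial>lborel) = (\<integral>\<^sup>+p. G (?v (fst p) (snd p)) \<partial>(lborel \<Otimes>\<^sub>M lborel))"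
    by (subst lborel_vector2, subst nn_integral_distr) auto
  also have "\<dots> = (\<integral>\<^sup>+x. \<integral>\<^sup>+y. G (?v x y) \<partial>lborel \<partial>lborel)"
    by (subst lborel.nn_integral_fst[symmetric]) auto
  also have "\<dots> = (\<integral>\<^sup>+x. \<integral>\<^sup>+m. ennreal \<bar>x\<bar> * G (?v x (x * m)) \<partial>lborel \<partial>lborel)"
  proof (rule nn_integral_cong_AE)
    have "AE x in lborel. x \<noteq> (0 :: real)" by (rule AE_lborel_singleton)
    then show "AE x in lborel. (\<integral>\<^sup>+y. G (?v x y) \<partial>lborel) = (\<integral>\<^sup>+m. ennreal \<bar>x\<bar> * G (?v x (x * m)) \<partial>lborel)"
    proof eventually_elim
      fix x :: real assume "x \<noteq> 0"
      then have "(\<integral>\<^sup>+y. G (?v x y) \<partial>lborel) = \<bar>x\<bar> * (\<integral>\<^sup>+m. G (?v x (0 + x * m)) \<partial>lborel)"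
        by (intro nn_integral_real_affine) auto
      also have "\<dots> = (\<integral>\<^sup>+m. ennreal \<bar>x\<bar> * G (?v x (x * m)) \<partial>lborel)"
        by (subst nn_integral_cmult) auto
      finally show "(\<integral>\<^sup>+y. G (?v x y) \<partial>lborel) = (\<integral>\<^sup>+m. ennreal \<bar>x\<bar> * G (?v x (x * m)) \<partial>lborel)" .
    qed
  qed
  also have "\<dots> = (\<integral>\<^sup>+m. \<integral>\<^sup>+x. ennreal \<bar>x\<bar> * G (?v x (x * m)) \<partial>lborel \<partial>lborel)"
    by (rule nn_integral_swap[OF sf sf]) measurable
  also have "\<dots> = (\<integral>\<^sup>+m. \<Phi> (arctan m) * ennreal (inverse (1 + m\<^sup>2)) \<partial>lborel)"
  proof (rule nn_integral_cong)
    fix m :: real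
    define c where "c = cos (arctan m)"
    have c: "c > 0" unfolding c_def using arctan_bounded[of m] by (intro cos_gt_zero_pi) auto
    have s: "sin (arctan m) = c * m" unfolding c_def by (simp add: cos_arctan sin_arctan)
    have c2: "c * c = inverse (1 + m\<^sup>2)"
      unfolding c_def cos_arctan by (simp add: inverse_eq_divide)
    have v: "?v (c * x) (c * x * m) = x *\<^sub>R circ (arctan m)" for x
      by (simp add: vec_eq_iff forall_2 s c_def[symmetric])
    have "(\<integral>\<^sup>+x. ennreal \<bar>x\<bar> * G (?v x (x * m)) \<partial>lborel) = \<bar>c\<bar> * (\<integral>\<^sup>+x. ennreal \<bar>0 + c * x\<bar> * G (?v (0 + c * x) ((0 + c * x) * m)) \<partial>lborel)"
      using c by (intro nn_integral_real_affine) auto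
    also have "\<dots> = (\<integral>\<^sup>+x. ennreal c * (ennreal \<bar>c * x\<bar> * G (x *\<^sub>R circ (arctan m))) \<partial>lborel)"
      using c by (subst nn_integral_cmult) (auto simp: v)
    also have "\<dots> = (\<integral>\<^sup>+x. ennreal \<bar>x\<bar> * G (x *\<^sub>R circ (arctan m)) * ennreal (c * c) \<partial>lborel)"
      using c by (intro nn_integral_cong) (simp add: abs_mult ennreal_mult mult_ac)
    also have "\<dots> = \<Phi> (arctan m) * ennreal (c * c)"
      unfolding \<Phi>_def by (rule nn_integral_multc) measurable
    finally show "(\<integral>\<^sup>+x. ennreal \<bar>x\<bar> * G (?v x (x * m)) \<partial>lborel) = \<Phi> (arctan m) * ennreal (inverse (1 + m\<^sup>2))"
      by (simp only: c2)
  qed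
  also have "\<dots> \<le> (\<integral>\<^sup>+\<theta>. \<Phi> \<theta> * indicator {- (pi/2)..pi/2} \<theta> \<partial>lborel)"
    by (rule nn_integral_arctan_le) measurable
  also have "\<dots> = (\<integral>\<^sup>+\<theta>. \<integral>\<^sup>+\<rho>. indicator {- (pi/2)..pi/2} \<theta> * (ennreal \<bar>\<rho>\<bar> * G (\<rho> *\<^sub>R circ \<theta>)) \<partial>lborel \<partial>lborel)"
    unfolding \<Phi>_def by (intro nn_integral_cong) (subst nn_integral_cmult, auto simp: mult.commute)
  also have "\<dots> = (\<integral>\<^sup>+p. indicator {- (pi/2)..pi/2} (fst p) * (ennreal \<bar>snd p\<bar> * G (snd p *\<^sub>R circ (fst p))) \<partial>(lborel \<Otimes>\<^sub>M lborel))"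
    by (subst lborel.nn_integral_fst[symmetric]) auto
  finally show ?thesis .
qed

section \<open>The surface measure of the truncated cone\<close>

lemma gradient_norm:
  fixes \<eta> :: "'a :: euclidean_space"
  assumes "\<eta> \<noteq> 0"
  shows "norm (gradient norm \<eta>) = 1"
proof -
  have g: "GDERIV norm \<eta> :> sgn \<eta>" using GDERIV_norm[OF assms] by simp
  have "D = sgn \<eta>" if "GDERIV norm \<eta> :> D" for D
  proof -
    have "(\<lambda>h. h \<bullet> D) = (\<lambda>h. h \<bullet> sgn \<eta>)"
      using that g unfolding gderiv_def by (rule has_derivative_unique)
    then have "\<forall>h. h \<bullet> D = h \<bullet> sgn \<eta>" by meson
    then show ?thesis using vector_eq_ldot[of D "sgn \<eta>"] by blast
  qed
  then have "gradient norm \<eta> = sgn \<eta>" unfolding gradient_def using g by (intro the_equality)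
  then show ?thesis using assms by (simp add: norm_sgn)
qed

definition annulus :: "(real ^ 2) set" where "annulus = {\<eta>. 1 < norm \<eta> \<and> norm \<eta> < 2}"

lemma annulus_borel [measurable]: "annulus \<in> sets borel"
  unfolding annulus_def by measurable

lemma sets_cone2_measure: "sets cone2_measure = sets (restrict_space borel ((\<lambda>y. (y, norm y)) ` annulus))"
  by (simp add: cone2_measure_def graph_surface_measure_def annulus_def)

lemma id_cone2_measurable: "(\<lambda>\<xi>. \<xi>) \<in> borel_measurable cone2_measure"
  using measurable_restrict_space1[OF measurable_ident_sets[OF refl], of borel]
  by (simp add: measurable_cong_sets[OF sets_cone2_measure refl] id_def)

text \<open>The gradient of the norm is a unit vector on the annulus, so the surface density is the
  constant sqrt 2.\<close>

lemma nn_integral_cone2_measure: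
  assumes F: "F \<in> borel_measurable cone2_measure"
  shows "(\<integral>\<^sup>+\<xi>. F \<xi> \<partial>cone2_measure) = (\<integral>\<^sup>+\<eta>\<in>annulus. ennreal (sqrt 2) * F (\<eta>, norm \<eta>) \<partial>lborel)"
proof -
  let ?G = "\<lambda>y :: real ^ 2. (y, norm y)"
  let ?d = "\<lambda>y :: real ^ 2. ennreal (sqrt (1 + (norm (gradient norm y))\<^sup>2))"
  let ?L = "restrict_space lborel annulus"
  have sp: "space ?L = annulus" by (simp add: space_restrict_space)
  have d: "?d y = ennreal (sqrt 2)" if "y \<in> annulus" for y
  proof -
    have "y \<noteq> 0" using that by (auto simp: annulus_def)
    then show ?thesis by (simp add: gradient_norm)
  qed
  have dm: "?d \<in> borel_measurable ?L"
    by (subst measurable_cong[where g = "\<lambda>_. ennreal (sqrt 2)"]) (auto simp: sp d)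
  have "continuous_on UNIV ?G" by (intro continuous_intros)
  then have "?G \<in> borel_measurable borel" by (rule borel_measurable_continuous_onI)
  then have G: "?G \<in> measurable (density ?L ?d) (restrict_space borel (?G ` annulus))"
    by (intro measurable_restrict_space2) (auto simp: sp intro!: measurable_restrict_space1)
  have F': "F \<in> borel_measurable (restrict_space borel (?G ` annulus))"
    using F by (simp add: measurable_cong_sets[OF sets_cone2_measure refl])
  have GL: "?G \<in> measurable ?L (restrict_space borel (?G ` annulus))" using G by simp
  have FG: "(\<lambda>y. F (?G y)) \<in> borel_measurable ?L"
    by (rule measurable_compose[OF GL F'])
  have "(\<integral>\<^sup>+\<xi>. F \<xi> \<partial>cone2_measure) = (\<integral>\<^sup>+y. F (?G y) \<partial>density ?L ?d)"
    unfolding cone2_measure_def graph_surface_measure_def annulus_def[symmetric]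
    by (rule nn_integral_distr[OF G]) (use F' in simp)
  also have "\<dots> = (\<integral>\<^sup>+y. ?d y * F (?G y) \<partial>?L)"
    by (rule nn_integral_density[OF dm FG])
  also have "\<dots> = (\<integral>\<^sup>+y. ennreal (sqrt 2) * F (?G y) \<partial>?L)"
    by (intro nn_integral_cong) (simp add: sp d)
  also have "\<dots> = (\<integral>\<^sup>+y\<in>annulus. ennreal (sqrt 2) * F (?G y) \<partial>lborel)"
    by (subst nn_integral_restrict_space) auto
  finally show ?thesis .
qed

lemma finite_cone2_measure: "finite_measure cone2_measure"
proof (rule finite_measureI)
  have "emeasure cone2_measure (space cone2_measure) = (\<integral>\<^sup>+\<xi>. 1 \<partial>cone2_measure)" by simp
  also have "\<dots> = (\<integral>\<^sup>+\<eta>\<in>annulus. ennreal (sqrt 2) * 1 \<partial>lborel)" by (rule nn_integral_cone2_measure) simp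
  also have "\<dots> = ennreal (sqrt 2) * emeasure lborel annulus"
    by (simp add: nn_integral_cmult_indicator)
  also have "emeasure lborel annulus \<le> emeasure lborel (ball (0 :: real ^ 2) 2)"
    by (intro emeasure_mono) (auto simp: annulus_def)
  then have "ennreal (sqrt 2) * emeasure lborel annulus < \<infinity>"
    using emeasure_lborel_ball_finite[of "0 :: real ^ 2" 2] by (auto simp: ennreal_mult_less_top)
  finally show "emeasure cone2_measure (space cone2_measure) \<noteq> \<infinity>" by simp
qed

text \<open>sqrt 2 is the surface density, and exp (4 pi) undoes the damping, as the radius stays
  below 2 on the annulus.\<close>

lemma nn_integral_cone2_measure_le:
  assumes [measurable]: "F \<in> borel_measurable borel"
  shows "(\<integral>\<^sup>+\<xi>. F \<xi> \<partial>cone2_measure) \<le> ennreal (sqrt 2 * exp (4 * pi)) * (\<integral>\<^sup>+p. F (cone_param p) \<partial>cone_density)"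
proof -
  have "continuous_on UNIV (\<lambda>y :: real ^ 2. (y, norm y))" by (intro continuous_intros)
  then have [measurable]: "(\<lambda>y :: real ^ 2. (y, norm y)) \<in> borel_measurable borel" by (rule borel_measurable_continuous_onI)
  have [measurable]: "(\<lambda>p. snd p *\<^sub>R circ (fst p)) \<in> borel_measurable (lborel \<Otimes>\<^sub>M lborel)" by measurable
  let ?G = "\<lambda>\<eta>. ennreal (sqrt 2) * F (\<eta>, norm \<eta>) * indicator annulus \<eta>"
  have [measurable]: "?G \<in> borel_measurable borel" by measurable
  have "F \<in> borel_measurable cone2_measure"
    using measurable_compose[OF id_cone2_measurable assms] .
  then have "(\<integral>\<^sup>+\<xi>. F \<xi> \<partial>cone2_measure) = (\<integral>\<^sup>+\<eta>. ?G \<eta> \<partial>lborel)"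
    by (rule nn_integral_cone2_measure)
  also have "\<dots> \<le> (\<integral>\<^sup>+p. indicator {- (pi/2)..pi/2} (fst p) * (ennreal \<bar>snd p\<bar> * ?G (snd p *\<^sub>R circ (fst p))) \<partial>(lborel \<Otimes>\<^sub>M lborel))"
    by (rule nn_integral_polar_le) measurable
  also have "\<dots> \<le> (\<integral>\<^sup>+p. ennreal (sqrt 2 * exp (4 * pi)) * (ennreal (cone_weight p) * F (cone_param p)) \<partial>(lborel \<Otimes>\<^sub>M lborel))"
  proof (rule nn_integral_mono)
    fix p :: "real \<times> real"
    show "indicator {- (pi/2)..pi/2} (fst p) * (ennreal \<bar>snd p\<bar> * ?G (snd p *\<^sub>R circ (fst p)))
      \<le> ennreal (sqrt 2 * exp (4 * pi)) * (ennreal (cone_weight p) * F (cone_param p))"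
    proof (cases "fst p \<in> {- (pi/2)..pi/2} \<and> snd p *\<^sub>R circ (fst p) \<in> annulus")
      case True
      then have s: "\<bar>snd p\<bar> < 2" by (simp add: annulus_def)
      have "1 \<le> exp (4 * pi) * exp (- (2 * pi * \<bar>snd p\<bar>))"
        using s by (simp add: mult_exp_exp)
      then have "\<bar>snd p\<bar> * 1 \<le> \<bar>snd p\<bar> * (exp (4 * pi) * exp (- (2 * pi * \<bar>snd p\<bar>)))" by (intro mult_left_mono) auto
      then have "\<bar>snd p\<bar> * sqrt 2 \<le> (sqrt 2 * exp (4 * pi)) * cone_weight p"
      proof -
        have "\<bar>snd p\<bar> * 1 * sqrt 2 \<le> \<bar>snd p\<bar> * (exp (4 * pi) * exp (- (2 * pi * \<bar>snd p\<bar>))) * sqrt 2"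
          using \<open>\<bar>snd p\<bar> * 1 \<le> _\<close> by (rule mult_right_mono) simp
        then show ?thesis using True by (simp add: cone_weight_def mult_ac)
      qed
      then have "ennreal (\<bar>snd p\<bar> * sqrt 2) * F (cone_param p) \<le> ennreal ((sqrt 2 * exp (4 * pi)) * cone_weight p) * F (cone_param p)"
        by (intro mult_right_mono ennreal_leI) auto
      then show ?thesis using True
        by (simp add: cone_param_def ennreal_mult cone_weight_nonneg mult_ac)
    qed (auto simp: indicator_def)
  qed
  also have "\<dots> = ennreal (sqrt 2 * exp (4 * pi)) * (\<integral>\<^sup>+p. ennreal (cone_weight p) * F (cone_param p) \<partial>(lborel \<Otimes>\<^sub>M lborel))"
    by (rule nn_integral_cmult) measurable
  also have "(\<integral>\<^sup>+p. ennreal (cone_weight p) * F (cone_param p) \<partial>(lborel \<Otimes>\<^sub>M lborel)) = (\<integral>\<^sup>+p. F (cone_param p) \<partial>cone_density)"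
    unfolding cone_density_def by (rule nn_integral_density[symmetric]) measurable
  finally show ?thesis .
qed

section \<open>Duality and conclusion\<close>

abbreviation wave :: "spacetime \<Rightarrow> spacetime \<Rightarrow> complex" where
  "wave x \<xi> \<equiv> exp (2 * of_real pi * \<i> * of_real (x \<bullet> \<xi>))"

lemma norm_wave: "cmod (wave x \<xi>) = 1"
proof -
  have "2 * of_real pi * \<i> * of_real (x \<bullet> \<xi>) = \<i> * of_real (2 * pi * (x \<bullet> \<xi>))" by (simp add: mult_ac)
  then show ?thesis by (simp only: norm_exp_i_times)
qed

lemma wave_diff: "wave (x - y) \<xi> = wave x \<xi> * cnj (wave y \<xi>)"
  by (simp add: exp_cnj inner_diff_left mult_exp_exp algebra_simps)

lemma borel_measurable_cnj' [measurable (raw)]: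
  assumes "f \<in> borel_measurable N"
  shows "(\<lambda>x. cnj (f x)) \<in> borel_measurable N"
  using assms by (rule borel_measurable_continuous_on[rotated]) (intro continuous_intros)

text \<open>The TT-star argument: the squared modulus is a double integral over \<open>M\<close>,
  and integrating in \<open>p\<close> first leaves the Fourier transform of \<Lambda> at x - y.
  Absolute values are taken only after that, so the cancellation kept is the one inside this kernel.
  Boundedness of \<open>h\<close> and finiteness of the measures justify the interchanges.\<close>

lemma tt_star:
  fixes M :: "spacetime measure" and h :: "spacetime \<Rightarrow> complex"
  assumes "finite_measure M" and sets_M [measurable_cong]: "sets M = sets borel" and "finite_measure \<Lambda>"
    and [measurable]: "\<xi> \<in> borel_measurable \<Lambda>" "h \<in> borel_measurable borel" and B: "\<And>x. cmod (h x) \<le> B"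
  shows "(\<integral>\<^sup>+p. ennreal ((cmod (\<integral>x. h x * wave x (\<xi> p) \<partial>M))\<^sup>2) \<partial>\<Lambda>)
    \<le> (\<integral>\<^sup>+y. \<integral>\<^sup>+x. ennreal (cmod (\<integral>p. wave (x - y) (\<xi> p) \<partial>\<Lambda>)) * ennreal (cmod (h x) * cmod (h y)) \<partial>M \<partial>M)"
proof -
  interpret M: finite_measure M by fact
  interpret L: finite_measure \<Lambda> by fact
  interpret MM: pair_sigma_finite M M ..
  interpret MMf: finite_measure "M \<Otimes>\<^sub>M M" by (intro finite_measure_pair_measure M.finite_measure_axioms)
  interpret LMM: pair_sigma_finite \<Lambda> "M \<Otimes>\<^sub>M M" ..
  interpret LMMf: finite_measure "\<Lambda> \<Otimes>\<^sub>M (M \<Otimes>\<^sub>M M)"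
    by (intro finite_measure_pair_measure L.finite_measure_axioms MMf.finite_measure_axioms)
  have B0: "B \<ge> 0" using B[of 0] norm_ge_zero order_trans by blast
  define \<Phi> where "\<Phi> p x y = h x * cnj (h y) * wave (x - y) (\<xi> p)" for p x y
  define H where "H p = (\<integral>x. h x * wave x (\<xi> p) \<partial>M)" for p
  have [measurable]: "H \<in> borel_measurable \<Lambda>" unfolding H_def by measurable
  have \<Phi>: "cmod (\<Phi> p x y) \<le> B * B" for p x y
    unfolding \<Phi>_def norm_mult norm_wave complex_mod_cnj using B B0 by (simp add: mult_mono)
  have int1: "integrable M (\<lambda>x. h x * wave x (\<xi> p))" for p
    by (rule M.integrable_const_bound[where B = B]) (auto simp: norm_mult norm_wave B)
  have int2: "integrable (M \<Otimes>\<^sub>M M) (\<lambda>q. \<Phi> p (fst q) (snd q))" for p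
    by (rule MMf.integrable_const_bound[where B = "B * B"]) (auto simp: \<Phi>, simp add: \<Phi>_def)
  have int3: "integrable (\<Lambda> \<Otimes>\<^sub>M (M \<Otimes>\<^sub>M M)) (\<lambda>(p, q). \<Phi> p (fst q) (snd q))"
    by (rule LMMf.integrable_const_bound[where B = "B * B"]) (auto simp: \<Phi>, simp add: \<Phi>_def split_beta)
  have HH: "of_real ((cmod (H p))\<^sup>2) = (\<integral>q. \<Phi> p (fst q) (snd q) \<partial>(M \<Otimes>\<^sub>M M))" for p
  proof -
    have "(\<integral>q. \<Phi> p (fst q) (snd q) \<partial>(M \<Otimes>\<^sub>M M)) = (\<integral>x. \<integral>y. \<Phi> p x y \<partial>M \<partial>M)"
      using MM.integral_fst'[OF int2[of p]] by simp
    also have "\<dots> = (\<integral>x. (h x * wave x (\<xi> p)) * cnj (H p) \<partial>M)"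
    proof (rule Bochner_Integration.integral_cong[OF refl])
      fix x
      have "(\<integral>y. \<Phi> p x y \<partial>M) = (\<integral>y. (h x * wave x (\<xi> p)) * cnj (h y * wave y (\<xi> p)) \<partial>M)"
        unfolding \<Phi>_def wave_diff complex_cnj_mult by (simp only: mult_ac)
      also have "\<dots> = (h x * wave x (\<xi> p)) * (\<integral>y. cnj (h y * wave y (\<xi> p)) \<partial>M)"
        by (rule integral_mult_right_zero)
      also have "(\<integral>y. cnj (h y * wave y (\<xi> p)) \<partial>M) = cnj (H p)" unfolding H_def by (rule Bochner_Integration.integral_cnj)
      finally show "(\<integral>y. \<Phi> p x y \<partial>M) = (h x * wave x (\<xi> p)) * cnj (H p)" .
    qed
    also have "\<dots> = H p * cnj (H p)" unfolding H_def by (rule integral_mult_left_zero)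
    finally show ?thesis by (simp only: complex_norm_square)
  qed
  have Hint: "integrable \<Lambda> (\<lambda>p. (cmod (H p))\<^sup>2)"
  proof (rule L.integrable_const_bound[where B = "(B * measure M (space M))\<^sup>2"])
    have "cmod (H p) \<le> B * measure M (space M)" for p
    proof -
      have "cmod (H p) \<le> (\<integral>x. cmod (h x * wave x (\<xi> p)) \<partial>M)" unfolding H_def by (rule integral_norm_bound)
      also have "\<dots> \<le> (\<integral>x. B \<partial>M)"
        using int1[of p] by (intro integral_mono integrable_norm) (auto simp: norm_mult norm_wave B)
      finally show ?thesis by (simp add: mult.commute)
    qed
    then show "AE p in \<Lambda>. norm ((cmod (H p))\<^sup>2) \<le> (B * measure M (space M))\<^sup>2"
      by (intro AE_I2) (simp add: power_mono)
  qed measurable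
  have kern: "(\<integral>p. \<Phi> p x y \<partial>\<Lambda>) = h x * cnj (h y) * (\<integral>p. wave (x - y) (\<xi> p) \<partial>\<Lambda>)" for x y
    unfolding \<Phi>_def by (rule integral_mult_right_zero)
  have "(\<integral>\<^sup>+p. ennreal ((cmod (H p))\<^sup>2) \<partial>\<Lambda>) = ennreal (\<integral>p. (cmod (H p))\<^sup>2 \<partial>\<Lambda>)"
    by (rule nn_integral_eq_integral[OF Hint]) simp
  also have "(\<integral>p. (cmod (H p))\<^sup>2 \<partial>\<Lambda>) = cmod (\<integral>p. of_real ((cmod (H p))\<^sup>2) \<partial>\<Lambda>)"
    by (simp only: integral_complex_of_real norm_of_real) (simp add: integral_nonneg_AE)
  also have "(\<integral>p. complex_of_real ((cmod (H p))\<^sup>2) \<partial>\<Lambda>) = (\<integral>p. \<integral>q. \<Phi> p (fst q) (snd q) \<partial>(M \<Otimes>\<^sub>M M) \<partial>\<Lambda>)"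
    by (simp only: HH)
  also have "\<dots> = (\<integral>q. \<integral>p. \<Phi> p (fst q) (snd q) \<partial>\<Lambda> \<partial>(M \<Otimes>\<^sub>M M))"
    using LMM.Fubini_integral[OF int3] by simp
  also have "ennreal (cmod \<dots>) \<le> (\<integral>\<^sup>+q. ennreal (cmod (\<integral>p. \<Phi> p (fst q) (snd q) \<partial>\<Lambda>)) \<partial>(M \<Otimes>\<^sub>M M))"
    using LMM.integrable_snd[OF int3] by (intro integral_norm_bound_ennreal) simp
  also have "\<dots> = (\<integral>\<^sup>+q. ennreal (cmod (\<integral>p. wave (fst q - snd q) (\<xi> p) \<partial>\<Lambda>)) * ennreal (cmod (h (fst q)) * cmod (h (snd q))) \<partial>(M \<Otimes>\<^sub>M M))"
    by (intro nn_integral_cong) (simp add: kern norm_mult ennreal_mult mult_ac)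
  also have "\<dots> = (\<integral>\<^sup>+y. \<integral>\<^sup>+x. ennreal (cmod (\<integral>p. wave (x - y) (\<xi> p) \<partial>\<Lambda>)) * ennreal (cmod (h x) * cmod (h y)) \<partial>M \<partial>M)"
  proof -
    have [measurable]: "(\<lambda>q. \<integral>p. wave (fst q - snd q) (\<xi> p) \<partial>\<Lambda>) \<in> borel_measurable (M \<Otimes>\<^sub>M M)"
      by (rule L.borel_measurable_lebesgue_integral) measurable
    have "(\<lambda>q. ennreal (cmod (\<integral>p. wave (fst q - snd q) (\<xi> p) \<partial>\<Lambda>)) * ennreal (cmod (h (fst q)) * cmod (h (snd q)))) \<in> borel_measurable (M \<Otimes>\<^sub>M M)"
      by measurable
    from MM.nn_integral_snd[OF this] show ?thesis by simp
  qed
  finally show ?thesis unfolding H_def .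
qed

text \<open>The extension is tested against its own conjugate on X. Fubini turns the integral
  \<open>S\<close> over X into the pairing of \<open>f\<close> with \<open>H\<close>, and
  Cauchy-Schwarz bounds S^2 by \<open>F2\<close> times the squared norm of \<open>H\<close> on the
  cone, which \<open>tt_star\<close> and the hypothesis on \<open>D\<close> bound by a multiple of
  \<open>S\<close>. One factor \<open>S\<close>, finite because the extension is bounded,
  cancels.\<close>

lemma extension_estimate:
  fixes X :: "spacetime set"
  defines "M \<equiv> density lborel (indicator X)"
  assumes [measurable]: "X \<in> sets borel" and fin: "emeasure lborel X < \<infinity>" and f: "f \<in> L2 cone2_measure"
    and D: "\<And>u. u \<in> borel_measurable borel \<Longrightarrow> (\<And>x. 0 \<le> u x) \<Longrightarrow> (\<And>x. u x \<noteq> 0 \<Longrightarrow> x \<in> X) \<Longrightarrow>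
      (\<integral>\<^sup>+y. \<integral>\<^sup>+x. ennreal (cmod (cone_kernel_fun (x - y))) * ennreal (u x * u y) \<partial>M \<partial>M) \<le> D * (\<integral>\<^sup>+x. ennreal ((u x)\<^sup>2) \<partial>M)"
  shows "(\<integral>\<^sup>+x\<in>X. ennreal ((cmod (cone2_extension f x))\<^sup>2) \<partial>lborel) \<le>
    ennreal (sqrt 2 * exp (4 * pi)) * D * (\<integral>\<^sup>+\<xi>. ennreal ((cmod (f \<xi>))\<^sup>2) \<partial>cone2_measure)"
proof -
  interpret S: finite_measure cone2_measure by (rule finite_cone2_measure)
  have sets_M [measurable_cong]: "sets M = sets borel" by (simp add: M_def)
  have "emeasure M (space M) = emeasure lborel X"
    by (simp add: M_def emeasure_density)
  then interpret M: finite_measure M using fin by (intro finite_measureI) auto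
  interpret MS: pair_sigma_finite M cone2_measure ..
  interpret MSf: finite_measure "M \<Otimes>\<^sub>M cone2_measure"
    by (intro finite_measure_pair_measure M.finite_measure_axioms S.finite_measure_axioms)
  have fm [measurable]: "f \<in> borel_measurable cone2_measure" and f2: "integrable cone2_measure (\<lambda>\<xi>. (cmod (f \<xi>))\<^sup>2)"
    using f by (auto simp: L2_def)
  have f1: "integrable cone2_measure f" proof -
    have "integrable cone2_measure (\<lambda>\<xi>. cmod (f \<xi>))"
      by (rule S.square_integrable_imp_integrable[OF _ f2]) measurable
    then show ?thesis by (simp add: integrable_norm_iff)
  qed
  define B where "B = (\<integral>\<xi>. cmod (f \<xi>) \<partial>cone2_measure)"
  have wm [measurable]: "(\<lambda>q. wave (fst q) (snd q)) \<in> borel_measurable (borel \<Otimes>\<^sub>M cone2_measure)"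
  proof -
    have [measurable]: "snd \<in> borel_measurable (borel \<Otimes>\<^sub>M cone2_measure)"
      using measurable_compose[OF measurable_snd id_cone2_measurable] .
    show ?thesis by measurable
  qed
  have wm1 [measurable]: "(\<lambda>\<xi>. wave x \<xi>) \<in> borel_measurable cone2_measure" for x
    using measurable_compose[OF measurable_Pair1' wm, of x] by simp
  have Ef: "cone2_extension f x = (\<integral>\<xi>. f \<xi> * wave x \<xi> \<partial>cone2_measure)" for x
    by (simp add: cone2_extension_def)
  have [measurable]: "cone2_extension f \<in> borel_measurable borel"
    unfolding cone2_extension_def[abs_def] using wm by measurable
  have EB: "cmod (cone2_extension f x) \<le> B" for x
  proof -
    have "cmod (cone2_extension f x) \<le> (\<integral>\<xi>. cmod (f \<xi> * wave x \<xi>) \<partial>cone2_measure)"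
      unfolding Ef by (rule integral_norm_bound)
    then show ?thesis by (simp add: B_def norm_mult norm_wave)
  qed
  have B0: "B \<ge> 0" by (simp add: B_def)
  define h where "h x = indicator X x * cnj (cone2_extension f x)" for x
  have [measurable]: "h \<in> borel_measurable borel" unfolding h_def by measurable
  have hB: "cmod (h x) \<le> B" for x using EB[of x] B0 by (simp add: h_def norm_mult indicator_def)
  define H where "H \<xi> = (\<integral>x. h x * wave x \<xi> \<partial>M)" for \<xi>
  have [measurable]: "H \<in> borel_measurable borel" unfolding H_def by measurable
  have Hs [measurable]: "H \<in> borel_measurable cone2_measure"
    using measurable_compose[OF id_cone2_measurable \<open>H \<in> borel_measurable borel\<close>] .
  define S where "S = (\<integral>\<^sup>+x. ennreal ((cmod (h x))\<^sup>2) \<partial>M)"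
  define F2 where "F2 = (\<integral>\<^sup>+\<xi>. ennreal ((cmod (f \<xi>))\<^sup>2) \<partial>cone2_measure)"
  have hint: "integrable M (\<lambda>x. (cmod (h x))\<^sup>2)"
    by (rule M.integrable_const_bound[where B = "B\<^sup>2"]) (rule AE_I2, simp add: hB power_mono, measurable)
  have S_eq: "S = ennreal (\<integral>x. (cmod (h x))\<^sup>2 \<partial>M)"
    unfolding S_def by (rule nn_integral_eq_integral[OF hint]) simp
  have S_X: "(\<integral>\<^sup>+x\<in>X. ennreal ((cmod (cone2_extension f x))\<^sup>2) \<partial>lborel) = S"
    unfolding S_def M_def by (subst nn_integral_density) (auto intro!: nn_integral_cong simp: h_def indicator_def)
  have int: "integrable (M \<Otimes>\<^sub>M cone2_measure) (\<lambda>(x, \<xi>). h x * (f \<xi> * wave x \<xi>))"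
  proof (rule Bochner_Integration.integrable_bound)
    show "integrable (M \<Otimes>\<^sub>M cone2_measure) (\<lambda>(x, \<xi>). B * cmod (f \<xi>))"
    proof (rule MS.Fubini_integrable)
      show "integrable M (\<lambda>x. \<integral>y. norm (case (x, y) of (x, \<xi>) \<Rightarrow> B * cmod (f \<xi>)) \<partial>cone2_measure)"
        by simp
      show "AE x in M. integrable cone2_measure (\<lambda>y. case (x, y) of (x, \<xi>) \<Rightarrow> B * cmod (f \<xi>))"
        using f1 by simp
    qed measurable
    show "(\<lambda>(x, \<xi>). h x * (f \<xi> * wave x \<xi>)) \<in> borel_measurable (M \<Otimes>\<^sub>M cone2_measure)"
      using wm by (simp add: split_beta)
    show "AE q in M \<Otimes>\<^sub>M cone2_measure. norm (case q of (x, \<xi>) \<Rightarrow> h x * (f \<xi> * wave x \<xi>)) \<le> norm (case q of (x, \<xi>) \<Rightarrow> B * cmod (f \<xi>))"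
      using hB B0 by (intro AE_I2) (auto simp: norm_mult norm_wave mult_right_mono)
  qed
  have "complex_of_real (\<integral>x. (cmod (h x))\<^sup>2 \<partial>M) = (\<integral>x. of_real ((cmod (h x))\<^sup>2) \<partial>M)"
    by (simp only: integral_complex_of_real)
  also have "\<dots> = (\<integral>x. h x * cone2_extension f x \<partial>M)"
    unfolding complex_norm_square by (intro Bochner_Integration.integral_cong refl) (auto simp: h_def indicator_def)
  also have "\<dots> = (\<integral>x. \<integral>\<xi>. h x * (f \<xi> * wave x \<xi>) \<partial>cone2_measure \<partial>M)"
    unfolding Ef by (intro Bochner_Integration.integral_cong refl integral_mult_right_zero[symmetric])
  also have "\<dots> = (\<integral>\<xi>. \<integral>x. h x * (f \<xi> * wave x \<xi>) \<partial>M \<partial>cone2_measure)"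
    by (rule MS.Fubini_integral[OF int, symmetric])
  also have "\<dots> = (\<integral>\<xi>. f \<xi> * H \<xi> \<partial>cone2_measure)"
  proof (intro Bochner_Integration.integral_cong refl)
    fix \<xi>
    have "(\<integral>x. h x * (f \<xi> * wave x \<xi>) \<partial>M) = (\<integral>x. f \<xi> * (h x * wave x \<xi>) \<partial>M)" by (simp only: mult_ac)
    then show "(\<integral>x. h x * (f \<xi> * wave x \<xi>) \<partial>M) = f \<xi> * H \<xi>" unfolding H_def by (simp only: integral_mult_right_zero)
  qed
  finally have eq: "complex_of_real (\<integral>x. (cmod (h x))\<^sup>2 \<partial>M) = (\<integral>\<xi>. f \<xi> * H \<xi> \<partial>cone2_measure)" .
  have HB: "cmod (H \<xi>) \<le> B * measure M (space M)" for \<xi>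
  proof -
    have i: "integrable M (\<lambda>x. h x * wave x \<xi>)"
      by (rule M.integrable_const_bound[where B = B]) (auto simp: norm_mult norm_wave hB)
    have "cmod (H \<xi>) \<le> (\<integral>x. cmod (h x * wave x \<xi>) \<partial>M)" unfolding H_def by (rule integral_norm_bound)
    also have "\<dots> \<le> (\<integral>x. B \<partial>M)" using i by (intro integral_mono integrable_norm) (auto simp: norm_mult norm_wave hB)
    finally show ?thesis by (simp add: mult.commute)
  qed
  have fH: "integrable cone2_measure (\<lambda>\<xi>. f \<xi> * H \<xi>)"
  proof (rule Bochner_Integration.integrable_bound)
    show "integrable cone2_measure (\<lambda>\<xi>. (B * measure M (space M)) * cmod (f \<xi>))" using f1 by simp
    show "AE \<xi> in cone2_measure. norm (f \<xi> * H \<xi>) \<le> norm ((B * measure M (space M)) * cmod (f \<xi>))"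
    proof (rule AE_I2)
      fix \<xi>
      have "cmod (H \<xi>) * cmod (f \<xi>) \<le> (B * measure M (space M)) * cmod (f \<xi>)" using HB by (rule mult_right_mono) simp
      then show "norm (f \<xi> * H \<xi>) \<le> norm ((B * measure M (space M)) * cmod (f \<xi>))" using B0 by (simp add: norm_mult mult.commute)
    qed
  qed measurable
  have "S = ennreal (cmod (complex_of_real (\<integral>x. (cmod (h x))\<^sup>2 \<partial>M)))"
    unfolding S_eq by (simp only: norm_of_real) (simp add: integral_nonneg_AE)
  also have "\<dots> \<le> (\<integral>\<^sup>+\<xi>. ennreal (cmod (f \<xi> * H \<xi>)) \<partial>cone2_measure)"
    unfolding eq by (rule integral_norm_bound_ennreal[OF fH])
  also have "\<dots> = (\<integral>\<^sup>+\<xi>. ennreal (cmod (f \<xi>)) * ennreal (cmod (H \<xi>)) \<partial>cone2_measure)"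
    by (simp add: norm_mult ennreal_mult)
  finally have "S\<^sup>2 \<le> (\<integral>\<^sup>+\<xi>. ennreal (cmod (f \<xi>)) * ennreal (cmod (H \<xi>)) \<partial>cone2_measure)\<^sup>2"
    by (rule power_mono) simp
  also have "\<dots> \<le> (\<integral>\<^sup>+\<xi>. ennreal (cmod (f \<xi>)) ^ 2 \<partial>cone2_measure) * (\<integral>\<^sup>+\<xi>. ennreal (cmod (H \<xi>)) ^ 2 \<partial>cone2_measure)"
    by (rule Cauchy_Schwarz_nn_integral) measurable
  also have "\<dots> = F2 * (\<integral>\<^sup>+\<xi>. ennreal ((cmod (H \<xi>))\<^sup>2) \<partial>cone2_measure)"
    by (simp add: F2_def ennreal_power)
  also have "\<dots> \<le> F2 * (ennreal (sqrt 2 * exp (4 * pi)) * (\<integral>\<^sup>+p. ennreal ((cmod (H (cone_param p)))\<^sup>2) \<partial>cone_density))"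
    by (intro mult_left_mono nn_integral_cone2_measure_le) auto
  also have "\<dots> \<le> F2 * (ennreal (sqrt 2 * exp (4 * pi)) * (D * S))"
  proof (intro mult_left_mono)
    have cp: "cone_param \<in> borel_measurable cone_density" unfolding cone_density_def by simp
    have "(\<integral>\<^sup>+p. ennreal ((cmod (H (cone_param p)))\<^sup>2) \<partial>cone_density)
      \<le> (\<integral>\<^sup>+y. \<integral>\<^sup>+x. ennreal (cmod (cone_kernel_fun (x - y))) * ennreal (cmod (h x) * cmod (h y)) \<partial>M \<partial>M)"
      unfolding H_def cone_kernel_fun_def
      by (rule tt_star[OF M.finite_measure_axioms sets_M finite_cone_density cp]) (measurable, rule hB)
    also have "\<dots> \<le> D * S"
      unfolding S_def by (rule D) (auto simp: h_def indicator_def)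
    finally show "(\<integral>\<^sup>+p. ennreal ((cmod (H (cone_param p)))\<^sup>2) \<partial>cone_density) \<le> D * S" .
  qed auto
  finally have SS: "S * S \<le> S * (ennreal (sqrt 2 * exp (4 * pi)) * D * F2)"
    by (simp add: power2_eq_square mult_ac)
  have "S \<le> ennreal (sqrt 2 * exp (4 * pi)) * D * F2"
  proof (cases "S = 0")
    case False
    then show ?thesis using SS by (simp add: ennreal_mult_le_mult_iff S_eq)
  qed simp
  then show ?thesis by (simp add: S_X F2_def)
qed

section \<open>Light boxes as admissible tubes\<close>

lemma frame_expansion: "z = (z \<bullet> frame_u \<theta>) *\<^sub>R frame_u \<theta> + (z \<bullet> frame_v \<theta>) *\<^sub>R frame_v \<theta> + (z \<bullet> frame_w \<theta>) *\<^sub>R frame_w \<theta>"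
proof -
  define k g where "k = fst z \<bullet> circ \<theta>" and "g = fst z \<bullet> circ (\<theta> + pi / 2)"
  have cs: "cos \<theta> * cos \<theta> = 1 - sin \<theta> * sin \<theta>"
    using sin_cos_squared_add3[of \<theta>] by linarith
  have 1: "g *\<^sub>R circ (\<theta> + pi / 2) + k *\<^sub>R circ \<theta> = fst z"
    using cs unfolding vec_eq_iff forall_2 g_def k_def inner_vec2
    by (simp add: sin_add cos_add) algebra
  have 2: "((k - snd z) / sqrt 2) *\<^sub>R frame_v \<theta> + ((k + snd z) / sqrt 2) *\<^sub>R frame_w \<theta> = (k *\<^sub>R circ \<theta>, snd z)"
    by (simp add: frame_v_def frame_w_def scaleR_left_distrib[symmetric] add_divide_distrib[symmetric] field_simps)
  show ?thesis
    unfolding inner_frame k_def[symmetric] g_def[symmetric] add.assoc 2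
    by (simp add: frame_u_def 1 prod_eq_iff)
qed

lemma light_box_eq_tube: "light_box \<theta> c (1/2) (1/2) (R/2) = tube R c (frame_u \<theta>) (frame_v \<theta>) (frame_w \<theta>)"
proof (intro set_eqI iffI)
  fix x assume x: "x \<in> light_box \<theta> c (1/2) (1/2) (R/2)"
  have "x = c + ((x - c) \<bullet> frame_u \<theta>) *\<^sub>R frame_u \<theta> + ((x - c) \<bullet> frame_v \<theta>) *\<^sub>R frame_v \<theta> + ((x - c) \<bullet> frame_w \<theta>) *\<^sub>R frame_w \<theta>"
    using frame_expansion[of "x - c" \<theta>] by (simp add: algebra_simps)
  then show "x \<in> tube R c (frame_u \<theta>) (frame_v \<theta>) (frame_w \<theta>)"
    using x unfolding tube_def light_box_def by blast
next
  fix x assume "x \<in> tube R c (frame_u \<theta>) (frame_v \<theta>) (frame_w \<theta>)"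
  then obtain a b t where x: "x = c + a *\<^sub>R frame_u \<theta> + b *\<^sub>R frame_v \<theta> + t *\<^sub>R frame_w \<theta>"
    and ab: "\<bar>a\<bar> \<le> 1/2" "\<bar>b\<bar> \<le> 1/2" "\<bar>t\<bar> \<le> R/2" unfolding tube_def by blast
  show "x \<in> light_box \<theta> c (1/2) (1/2) (R/2)"
    using ab by (simp add: light_box_def x inner_add_left frame_orthonormal)
qed

text \<open>The form vanishes on the cone, so its value along a curve in the cone is constant near
  0, while its derivative there is \<open>2 * mink \<xi> v\<close>.\<close>

lemma tangent_cone2:
  assumes "v \<in> tangent_space cone2 \<xi>"
  shows "mink \<xi> v = 0"
proof -
  obtain \<gamma> where \<gamma>: "\<gamma> 0 = \<xi>" "\<forall>\<^sub>F t in nhds 0. \<gamma> t \<in> cone2" "(\<gamma> has_vector_derivative v) (at (0 :: real))"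
    using assms by (auto simp: tangent_space_def)
  have f: "((\<lambda>t. fst (\<gamma> t)) has_vector_derivative fst v) (at 0)" and s: "((\<lambda>t. snd (\<gamma> t)) has_vector_derivative snd v) (at 0)"
    using bounded_linear.has_vector_derivative[OF bounded_linear_fst \<gamma>(3)] bounded_linear.has_vector_derivative[OF bounded_linear_snd \<gamma>(3)] by simp_all
  have f2: "((\<lambda>t. fst (\<gamma> t) \<bullet> fst (\<gamma> t)) has_vector_derivative (fst (\<gamma> 0) \<bullet> fst v + fst v \<bullet> fst (\<gamma> 0))) (at 0)"
    by (rule bounded_bilinear.has_vector_derivative[OF bounded_bilinear_inner f f])
  have s2: "((\<lambda>t. snd (\<gamma> t) * snd (\<gamma> t)) has_vector_derivative (snd (\<gamma> 0) * snd v + snd v * snd (\<gamma> 0))) (at 0)"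
    by (rule has_vector_derivative_mult[OF s s])
  have "(fst (\<gamma> 0) \<bullet> fst v + fst v \<bullet> fst (\<gamma> 0)) - (snd (\<gamma> 0) * snd v + snd v * snd (\<gamma> 0)) = 2 * mink \<xi> v"
    by (simp add: mink_def \<gamma>(1) inner_commute)
  then have "((\<lambda>t. mink (\<gamma> t) (\<gamma> t)) has_vector_derivative 2 * mink \<xi> v) (at 0)"
    using has_vector_derivative_diff[OF f2 s2] by (simp only: mink_def)
  then have d: "((\<lambda>t. mink (\<gamma> t) (\<gamma> t)) has_real_derivative 2 * mink \<xi> v) (at 0)"
    by (simp add: has_real_derivative_iff_has_vector_derivative)
  have "\<forall>\<^sub>F t in nhds 0. mink (\<gamma> t) (\<gamma> t) = 0"
    using \<gamma>(2) by eventually_elim (auto simp: cone2_def mink_def dot_square_norm power2_eq_square)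
  then have "((\<lambda>t. 0 :: real) has_real_derivative 2 * mink \<xi> v) (at 0)"
    using d by (subst (asm) DERIV_cong_ev[OF refl _ refl])
  then have "2 * mink \<xi> v = 0" using DERIV_const DERIV_unique by blast
  then show ?thesis by simp
qed

lemma norm_frame: "norm (frame_u \<theta>) = 1" "norm (frame_v \<theta>) = 1" "norm (frame_w \<theta>) = 1"
  by (simp_all add: norm_eq_sqrt_inner frame_orthonormal del: inner_Pair)

lemma light_box_in_tubes: "light_box \<theta> c (1/2) (1/2) (R/2) \<in> cone2_tubes R"
proof -
  \<comment> \<open>The normal at (\<eta>, |\<eta>|) is parallel to (\<eta>, -|\<eta>|). Hence it is
    the point antipodal to \<open>circ \<theta>\<close> whose normal is parallel to
    \<open>frame_w \<theta>\<close>; the radius 3/2 lies inside the annulus.\<close>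
  define \<xi> where "\<xi> = (- (3/2) *\<^sub>R circ \<theta>, 3 / 2 :: real)"
  have "\<xi> \<in> cone2" by (simp add: \<xi>_def cone2_def)
  moreover have "frame_w \<theta> \<bullet> v = 0" if "v \<in> tangent_space cone2 \<xi>" for v
  proof -
    have "- (3/2) * (circ \<theta> \<bullet> fst v) - 3 / 2 * snd v = 0"
      using tangent_cone2[OF that] by (simp add: \<xi>_def mink_def)
    then show ?thesis by (simp add: inner_commute[of "frame_w \<theta>"] inner_frame inner_commute[of "fst v"])
  qed
  ultimately have "\<exists>\<xi>\<in>cone2. \<forall>\<tau>\<in>tangent_space cone2 \<xi>. frame_w \<theta> \<bullet> \<tau> = 0" by blast
  then show ?thesis
    unfolding cone2_tubes_def light_box_eq_tube mem_Collect_eq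
    by (intro exI conjI) (rule refl | rule norm_frame frame_orthonormal | assumption)+
qed

lemma cone_kernel_fun_measurable: "(\<lambda>z. cmod (cone_kernel_fun z)) \<in> borel_measurable borel"
proof -
  interpret finite_measure cone_density by (rule finite_cone_density)
  have [measurable]: "cone_param \<in> borel_measurable cone_density" unfolding cone_density_def by simp
  show ?thesis unfolding cone_kernel_fun_def by measurable
qed

lemma log_factor_le:
  fixes R \<epsilon> :: real
  assumes R: "R > 1" and \<epsilon>: "\<epsilon> > 0"
  shows "(1 + log 2 (2 * R))\<^sup>2 * sqrt (sqrt (2 * R)) \<le> 2 * (2 + 2 / (\<epsilon> * ln 2))\<^sup>2 * R powr (1/4 + \<epsilon>)"
proof -
  \<comment> \<open>Half of \<epsilon>, since the logarithm occurs squared; ln x \<le> x then bounds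
    it by a multiple of x.\<close>
  define x where "x = R powr (\<epsilon> / 2)"
  have x1: "x \<ge> 1" unfolding x_def using R \<epsilon> by (simp add: ge_one_powr_ge_zero)
  have lx: "ln R = (2 / \<epsilon>) * ln x" using R \<epsilon> by (simp add: x_def ln_powr)
  have "ln x \<le> x" using x1 ln_le_minus_one[of x] by linarith
  then have "ln R \<le> (2 / \<epsilon>) * x" unfolding lx using \<epsilon> by (intro mult_left_mono) auto
  then have "ln R / ln 2 \<le> (2 / \<epsilon>) * x / ln 2" by (intro divide_right_mono) auto
  then have "log 2 R \<le> 2 / (\<epsilon> * ln 2) * x" by (simp add: log_def mult_ac)
  moreover have "log 2 (2 * R) = 1 + log 2 R" using R by (subst log_mult) auto
  moreover have "(2 :: real) \<le> 2 * x" using x1 by simp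
  ultimately have "1 + log 2 (2 * R) \<le> (2 + 2 / (\<epsilon> * ln 2)) * x" by (simp add: distrib_right)
  moreover have "0 \<le> 1 + log 2 (2 * R)" using R by (simp add: add_nonneg_nonneg)
  ultimately have 1: "(1 + log 2 (2 * R))\<^sup>2 \<le> ((2 + 2 / (\<epsilon> * ln 2)) * x)\<^sup>2" by (rule power_mono)
  have 2: "sqrt (sqrt (2 * R)) \<le> 2 * R powr (1/4)"
  proof -
    have r: "R powr (1/4) = sqrt (sqrt R)" using R by (simp add: powr_half_sqrt[symmetric] powr_powr)
    have "sqrt (sqrt 2) \<le> sqrt (sqrt 16)" by (intro real_sqrt_le_mono) auto
    also have "sqrt 16 = (4 :: real)" by (rule real_sqrt_unique) auto
    also have "sqrt 4 = (2 :: real)" by (rule real_sqrt_unique) auto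
    finally have "sqrt (sqrt 2) * sqrt (sqrt R) \<le> 2 * sqrt (sqrt R)" using R by (intro mult_right_mono) auto
    then show ?thesis by (simp add: r real_sqrt_mult)
  qed
  have "(1 + log 2 (2 * R))\<^sup>2 * sqrt (sqrt (2 * R)) \<le> ((2 + 2 / (\<epsilon> * ln 2)) * x)\<^sup>2 * (2 * R powr (1/4))"
    using R by (intro mult_mono 1 2) auto
  also have "\<dots> = 2 * (2 + 2 / (\<epsilon> * ln 2))\<^sup>2 * (R powr (1/4) * x\<^sup>2)" by (simp add: power_mult_distrib)
  also have "R powr (1/4) * x\<^sup>2 = R powr (1/4 + \<epsilon>)"
    by (simp add: x_def power2_eq_square powr_add[symmetric])
  finally show ?thesis .
qed

text \<open>\<open>c\<close> is the absolute lower bound for the tube mass: a nonempty X contains a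
  unit ball, and the concentric ball of radius 1/2 fits into a tube as R > 1. It replaces the tube
  mass in the constants, so that \<open>A\<close> depends on \<open>K\<close> alone.\<close>

lemma weighted_extension_estimate:
  fixes R K \<epsilon> :: real
  defines "c \<equiv> measure lborel (ball (0 :: spacetime) (1/2))"
  defines "A \<equiv> 388 * K / c + 24 * (16 * (16002 + 4 * (1760 * 200000000 ^ 3) * (4 * K)\<^sup>2 / c\<^sup>2))"
  assumes \<epsilon>: "\<epsilon> > 0" and K: "K > 0" and R: "R > 1"
    and X: "disjoint_union_of_unit_balls X" "X \<subseteq> ball a R"
    and ball: "\<And>x r. r > 1 \<Longrightarrow> emeasure lborel (X \<inter> ball x r) \<le> ennreal (K * r)"
    and f: "f \<in> L2 cone2_measure"
  shows "(\<integral>\<^sup>+x\<in>X. ennreal ((cmod (cone2_extension f x))\<^sup>2) \<partial>lborel)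
     \<le> ennreal (sqrt 2 * exp (4 * pi) * A * (2 * (2 + 2 / (\<epsilon> * ln 2))\<^sup>2) * R powr (1/4 + \<epsilon>)) * cone2_T R X * ennreal ((L2_norm cone2_measure f)\<^sup>2)"
proof (cases "X = {}")
  case False
  obtain P where P: "X = (\<Union>p\<in>P. ball p 1)" using X(1) by (auto simp: disjoint_union_of_unit_balls_def)
  then obtain p where p: "ball p 1 \<subseteq> X" using False by auto
  have "open X" by (simp add: P open_UN)
  then have Xm [measurable]: "X \<in> sets borel" by (rule borel_open)
  have fin: "emeasure lborel X < \<infinity>"
    using emeasure_mono[OF X(2), of lborel] emeasure_lborel_ball_finite[of a R] by (auto simp: order_le_less_trans)
  define M where "M = density lborel (indicator X :: _ \<Rightarrow> ennreal)"
  have emM: "emeasure M B = emeasure lborel (X \<inter> B)" if "B \<in> sets borel" for B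
    using that by (simp add: M_def emeasure_density indicator_inter_arith[symmetric])
  define t where "t = enn2real (cone2_T R X)"
  have "cone2_T R X \<le> emeasure lborel X"
    unfolding cone2_T_def by (intro SUP_least emeasure_mono) auto
  \<comment> \<open>X lies in a ball and has finite measure, so the supremum is a real number, as
    the locale parameter \<open>t\<close> must be.\<close>
  then have T: "cone2_T R X = ennreal t" using fin by (auto simp: t_def ennreal_enn2real_if)
  have tube: "emeasure M (light_box \<theta> q (1/2) (1/2) (R/2)) \<le> ennreal t" for \<theta> q
    unfolding T[symmetric] cone2_T_def emM[OF light_box_borel] by (rule SUP_upper) (rule light_box_in_tubes)
  have cball: "emeasure lborel (ball q (1/2)) = ennreal c" for q :: "spacetime"
  proof -
    have "emeasure lborel (ball q (1/2)) = emeasure lborel (ball (0 :: spacetime) (1/2))"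
      by (subst (1 2) emeasure_ball) auto
    also have "\<dots> = ennreal c"
      unfolding c_def using emeasure_lborel_ball_finite[of "0 :: spacetime" "1/2"] by (intro emeasure_eq_ennreal_measure) auto
    finally show ?thesis .
  qed
  have c0: "c > 0" unfolding c_def by (rule content_ball_pos) simp
  have "ball p (1/2) \<subseteq> X \<inter> light_box 0 p (1/2) (1/2) (R/2)"
  proof
    fix x assume "x \<in> ball p (1/2)"
    then have x: "norm (x - p) < 1/2" by (simp add: dist_norm norm_minus_commute)
    have "\<bar>(x - p) \<bullet> frame_u 0\<bar> \<le> norm (x - p)" "\<bar>(x - p) \<bullet> frame_v 0\<bar> \<le> norm (x - p)" "\<bar>(x - p) \<bullet> frame_w 0\<bar> \<le> norm (x - p)"
      by (intro inner_unit_le norm_frame)+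
    moreover have "x \<in> X" using x by (intro subsetD[OF p]) (simp add: dist_norm norm_minus_commute)
    ultimately show "x \<in> X \<inter> light_box 0 p (1/2) (1/2) (R/2)"
      using x R by (simp add: light_box_def)
  qed
  then have "emeasure lborel (ball p (1/2)) \<le> emeasure lborel (X \<inter> light_box 0 p (1/2) (1/2) (R/2))"
    by (rule emeasure_mono) simp
  also have "\<dots> \<le> ennreal t" using tube[of 0 p] by (simp add: emM)
  finally have "ennreal c \<le> ennreal t" by (simp only: cball)
  then have ct: "c \<le> t" using c0 by (auto simp: ennreal_le_iff2)
  interpret ball_light_weight M R t K
  proof (intro ball_light_weight.intro light_weight.intro light_weight_axioms.intro ball_light_weight_axioms.intro finite_measureI)
    show "emeasure M (space M) \<noteq> \<infinity>" using fin emM[of UNIV] by (simp add: M_def)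
    show "sets M = sets borel" by (simp add: M_def)
    show "emeasure M (ball x s) \<le> ennreal (K * s)" if "1 < s" for x s using ball[OF that] by (simp add: emM)
  qed (use R c0 ct tube K in auto)
  define D where "D = A * (1 + log 2 (2 * R))\<^sup>2 * sqrt (sqrt (2 * R)) * t"
  have A0: "A > 0" unfolding A_def using K c0 by (intro add_pos_pos mult_pos_pos divide_pos_pos add_pos_nonneg) auto
  have "(\<integral>\<^sup>+x\<in>X. ennreal ((cmod (cone2_extension f x))\<^sup>2) \<partial>lborel)
    \<le> ennreal (sqrt 2 * exp (4 * pi)) * ennreal D * (\<integral>\<^sup>+\<xi>. ennreal ((cmod (f \<xi>))\<^sup>2) \<partial>cone2_measure)"
  proof (rule extension_estimate[OF Xm fin f], fold M_def)
    fix u :: "spacetime \<Rightarrow> real"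
    assume u: "u \<in> borel_measurable borel" "\<And>x. 0 \<le> u x" "\<And>x. u x \<noteq> 0 \<Longrightarrow> x \<in> X"
    have s: "x \<in> ball a R" if "u x \<noteq> 0" for x using u(3)[OF that] X(2) by blast
    show "(\<integral>\<^sup>+y. \<integral>\<^sup>+x. ennreal (cmod (cone_kernel_fun (x - y))) * ennreal (u x * u y) \<partial>M \<partial>M) \<le> ennreal D * (\<integral>\<^sup>+x. ennreal ((u x)\<^sup>2) \<partial>M)"
      unfolding D_def A_def
      by (rule kernel_bilinear[OF cone_kernel_cmod cone_kernel_fun_measurable u(1,2) s R c0 ct])
  qed
  also have "(\<integral>\<^sup>+\<xi>. ennreal ((cmod (f \<xi>))\<^sup>2) \<partial>cone2_measure) = ennreal ((L2_norm cone2_measure f)\<^sup>2)"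
    using f by (simp add: L2_def L2_norm_def nn_integral_eq_integral integral_nonneg_AE)
  also have "ennreal (sqrt 2 * exp (4 * pi)) * ennreal D = ennreal (sqrt 2 * exp (4 * pi) * D)"
    using c0 ct A0 R by (simp add: D_def ennreal_mult)
  also have "\<dots> \<le> ennreal ((sqrt 2 * exp (4 * pi) * A * (2 * (2 + 2 / (\<epsilon> * ln 2))\<^sup>2) * R powr (1/4 + \<epsilon>)) * t)"
  proof (rule ennreal_leI)
    have "sqrt 2 * exp (4 * pi) * D = (sqrt 2 * exp (4 * pi) * A) * ((1 + log 2 (2 * R))\<^sup>2 * sqrt (sqrt (2 * R))) * t"
      by (simp add: D_def mult_ac)
    also have "\<dots> \<le> (sqrt 2 * exp (4 * pi) * A) * (2 * (2 + 2 / (\<epsilon> * ln 2))\<^sup>2 * R powr (1/4 + \<epsilon>)) * t"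
      using A0 c0 ct log_factor_le[OF R \<epsilon>] by (intro mult_right_mono mult_left_mono) auto
    finally show "sqrt 2 * exp (4 * pi) * D \<le> (sqrt 2 * exp (4 * pi) * A * (2 * (2 + 2 / (\<epsilon> * ln 2))\<^sup>2) * R powr (1/4 + \<epsilon>)) * t"
      by (simp only: mult.assoc)
  qed
  also have "\<dots> = ennreal (sqrt 2 * exp (4 * pi) * A * (2 * (2 + 2 / (\<epsilon> * ln 2))\<^sup>2) * R powr (1/4 + \<epsilon>)) * cone2_T R X"
    unfolding T using A0 c0 ct by (intro ennreal_mult) auto
  finally show ?thesis by (simp add: mult_right_mono)
qed simp

theorem corollary1p1:
  "\<forall>\<epsilon>>0. \<forall>K>0. \<exists>C::real. \<forall>R>1. \<forall>X a.
     disjoint_union_of_unit_balls X \<longrightarrow>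
     X \<subseteq> ball a R \<longrightarrow>
     (\<forall>x. \<forall>r>1. emeasure lborel (X \<inter> ball x r) \<le> ennreal (K * r)) \<longrightarrow>
     (\<forall>f \<in> L2 cone2_measure.
        (\<integral>\<^sup>+x\<in>X. ennreal ((cmod (cone2_extension f x))\<^sup>2) \<partial>lborel)
          \<le> ennreal (C * R powr (1/4 + \<epsilon>)) * cone2_T R X * ennreal ((L2_norm cone2_measure f)\<^sup>2))"
proof (intro allI impI)
  fix \<epsilon> K :: real
  assume "\<epsilon> > 0" "K > 0"
  then show "\<exists>C::real. \<forall>R>1. \<forall>X a.
     disjoint_union_of_unit_balls X \<longrightarrow>
     X \<subseteq> ball a R \<longrightarrow>
     (\<forall>x. \<forall>r>1. emeasure lborel (X \<inter> ball x r) \<le> ennreal (K * r)) \<longrightarrow>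
     (\<forall>f \<in> L2 cone2_measure.
        (\<integral>\<^sup>+x\<in>X. ennreal ((cmod (cone2_extension f x))\<^sup>2) \<partial>lborel)
          \<le> ennreal (C * R powr (1/4 + \<epsilon>)) * cone2_T R X * ennreal ((L2_norm cone2_measure f)\<^sup>2))"
    \<comment> \<open>The witness stays schematic and is read off by unification from
      \<open>weighted_extension_estimate\<close>; it depends on \<epsilon> and \<open>K\<close>
      only.\<close>
    by (intro exI allI impI ballI, rule weighted_extension_estimate) (assumption | blast)+
qed

end
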